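(* Let $k\ge 1$ be a fixed integer and let $\Omega\subseteq\mathbb{N}_0$ be a set of non-negative integers that contains $0$, $1$ and at least one integer greater than $1$. Let $\mathcal{G}_{n,k}$ be the class of labelled $\Omega$-$k$-trees with $n$ hedra, and let $\mathsf{G}_{n,k}^\circ$ be a random $\Omega$-$k$-tree that is uniformly selected from $\mathcal{G}_{n,k}$ and then rooted at a front chosen uniformly at random. Then there is a random, infinite but locally finite, front-rooted $\Omega$-$k$-tree $\mathsf{G}_{\infty,k}$ such that, as $n\to\infty$ (along those $n$ for which $\mathcal{G}_{n,k}\ne\emptyset$), $\mathsf{G}_{n,k}^\circ$ converges to $\mathsf{G}_{\infty,k}$ in the local weak sense, $$\mathsf{G}_{n,k}^\circ\ \xrightarrow{\;d\;}\ \mathsf{G}_{\infty,k};$$ that is, for every fixed integer $\ell\ge 0$ and every finite front-rooted graph $G$, $$\lim_{n\to\infty}\mathbb{P}\bigl[U_\ell(\mathsf{G}_{n,k}^\circ)\simeq G\bigr]=\mathbb{P}\bigl[U_\ell(\mathsf{G}_{\infty,k})\simeq G\bigr].$$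
   Context: **k-trees.** A $k$-tree is either a complete graph on $k$ vertices, or a graph obtained from a smaller $k$-tree by adding a new vertex together with $k$ edges connecting it to the vertices of a $k$-clique of the smaller $k$-tree. A front is a $k$-clique and a hedron is a $(k+1)$-clique. A $k$-tree with $n$ hedra has $n+k$ vertices and $kn+1$ fronts; it is labelled if its vertex set is $\{1,\dots,n+k\}$, and two labelled graphs are different if their edge sets differ. **$\Omega$-$k$-trees.** An $\Omega$-$k$-tree is a $k$-tree such that, for every $k$-clique, the number of $(k+1)$-cliques containing it belongs to $\Omega$. An infinite $\Omega$-$k$-tree is an infinite graph that is obtained by the same recursive procedure continued indefinitely (the union of an infinite increasing sequence of $k$-trees starting with a $k$-clique, each obtained from the previous one by adding one vertex joined to a $k$-clique), and in which, for every $k$-clique, the number of $(k+1)$-cliques containing it belongs to $\Omega$. A graph is locally finite if all vertex degrees are finite. **Front-rooted graphs and neighbourhoods.** A front-rooted graph is a graph with a distinguished front (the root front). For a front-rooted graph $G^*$ and $\ell\ge 0$, $U_\ell(G^* )$ denotes the front-rooted subgraph induced by all vertices at graph distance at most $\ell$ from the root front. The relation $\simeq$ denotes isomorphism of (unlabelled) graphs mapping root front to root front. *)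

theory Defs
  imports "HOL-Probability.Probability"
begin

section \<open>Graphs and cliques\<close>

type_synonym 'a graph = "'a set \<times> 'a set set"

definition complete_edges :: "'a set \<Rightarrow> 'a set set" where
  "complete_edges V = {{u, v} | u v. u \<in> V \<and> v \<in> V \<and> u \<noteq> v}"

definition simple_graph :: "'a graph \<Rightarrow> bool" where
  "simple_graph G \<longleftrightarrow> snd G \<subseteq> complete_edges (fst G)"

definition cliques :: "nat \<Rightarrow> 'a graph \<Rightarrow> 'a set set" where
  "cliques m G = {C. C \<subseteq> fst G \<and> finite C \<and> card C = m \<and> complete_edges C \<subseteq> snd G}"

definition locally_finite :: "'a graph \<Rightarrow> bool" where
  "locally_finite G \<longleftrightarrow> (\<forall>v\<in>fst G. finite {u \<in> fst G. {u, v} \<in> snd G})"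

definition graph_dist :: "'a graph \<Rightarrow> 'a \<Rightarrow> 'a \<Rightarrow> enat" where
  "graph_dist G u v = (INF m\<in>{m. (u, v) \<in> {(x, y). {x, y} \<in> snd G} ^^ m}. enat m)"


section \<open>k-trees\<close>

abbreviation fronts :: "nat \<Rightarrow> 'a graph \<Rightarrow> 'a set set" where
  "fronts k \<equiv> cliques k"

abbreviation hedra :: "nat \<Rightarrow> 'a graph \<Rightarrow> 'a set set" where
  "hedra k \<equiv> cliques (Suc k)"

definition ktree_step :: "nat \<Rightarrow> 'a graph \<Rightarrow> 'a graph \<Rightarrow> bool" where
  "ktree_step k G G' \<longleftrightarrow> (\<exists>v C. v \<notin> fst G \<and> C \<in> cliques k G \<and>
     G' = (insert v (fst G), snd G \<union> {{v, u} | u. u \<in> C}))"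

inductive ktree :: "nat \<Rightarrow> 'a graph \<Rightarrow> bool" for k :: nat where
  base: "finite K \<Longrightarrow> card K = k \<Longrightarrow> ktree k (K, complete_edges K)"
| step: "ktree k G \<Longrightarrow> ktree_step k G G' \<Longrightarrow> ktree k G'"

definition infinite_ktree :: "nat \<Rightarrow> 'a graph \<Rightarrow> bool" where
  "infinite_ktree k G \<longleftrightarrow> (\<exists>H :: nat \<Rightarrow> 'a graph.
     (\<exists>K. finite K \<and> card K = k \<and> H 0 = (K, complete_edges K)) \<and>
     (\<forall>i. ktree_step k (H i) (H (Suc i))) \<and>
     G = (\<Union>i. fst (H i), \<Union>i. snd (H i)))"

text \<open>Finiteness is required explicitly because \<open>card\<close> is 0 on infinite sets.\<close>

definition hedra_condition :: "nat set \<Rightarrow> nat \<Rightarrow> 'a graph \<Rightarrow> bool" where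
  "hedra_condition \<Omega> k G \<longleftrightarrow> (\<forall>C \<in> fronts k G.
     finite {D \<in> hedra k G. C \<subseteq> D} \<and> card {D \<in> hedra k G. C \<subseteq> D} \<in> \<Omega>)"

definition Omega_ktree :: "nat set \<Rightarrow> nat \<Rightarrow> 'a graph \<Rightarrow> bool" where
  "Omega_ktree \<Omega> k G \<longleftrightarrow> ktree k G \<and> hedra_condition \<Omega> k G"

definition infinite_Omega_ktree :: "nat set \<Rightarrow> nat \<Rightarrow> 'a graph \<Rightarrow> bool" where
  "infinite_Omega_ktree \<Omega> k G \<longleftrightarrow> infinite_ktree k G \<and> hedra_condition \<Omega> k G"

definition labelled_Omega_ktrees :: "nat set \<Rightarrow> nat \<Rightarrow> nat \<Rightarrow> nat graph set" where
  "labelled_Omega_ktrees \<Omega> k n =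
     {G. Omega_ktree \<Omega> k G \<and> card (hedra k G) = n \<and> fst G = {1..n + k}}"


section \<open>Front-rooted graphs and neighbourhoods of the root\<close>

type_synonym 'a rooted_graph = "'a graph \<times> 'a set"

definition front_rooted :: "nat \<Rightarrow> 'a rooted_graph \<Rightarrow> bool" where
  "front_rooted k G \<longleftrightarrow> simple_graph (fst G) \<and> snd G \<in> fronts k (fst G)"

definition ball_vertices :: "nat \<Rightarrow> 'a rooted_graph \<Rightarrow> 'a set" where
  "ball_vertices l G =
     {v \<in> fst (fst G). \<exists>u \<in> snd G. graph_dist (fst G) u v \<le> enat l}"

definition U :: "nat \<Rightarrow> 'a rooted_graph \<Rightarrow> 'a rooted_graph" where
  "U l G = ((ball_vertices l G, {e \<in> snd (fst G). e \<subseteq> ball_vertices l G}), snd G)"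

definition rooted_iso :: "'a rooted_graph \<Rightarrow> 'b rooted_graph \<Rightarrow> bool" (infix "\<simeq>" 50) where
  "G \<simeq> H \<longleftrightarrow> (\<exists>f. bij_betw f (fst (fst G)) (fst (fst H)) \<and>
     (\<forall>u \<in> fst (fst G). \<forall>v \<in> fst (fst G). {u, v} \<in> snd (fst G) \<longleftrightarrow> {f u, f v} \<in> snd (fst H)) \<and>
     f ` snd G = snd H)"


section \<open>Random front-rooted graphs\<close>

definition random_rooted_Omega_ktree :: "nat set \<Rightarrow> nat \<Rightarrow> nat \<Rightarrow> nat rooted_graph pmf" where
  "random_rooted_Omega_ktree \<Omega> k n =
     bind_pmf (pmf_of_set (labelled_Omega_ktrees \<Omega> k n)) (\<lambda>G.
       map_pmf (\<lambda>R. (G, R)) (pmf_of_set (fronts k G)))"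

text \<open>An infinite \<open>k\<close>-tree has countably many vertices, and an arbitrary finite graph is isomorphic
  to one on natural numbers, so \<open>nat\<close> suffices as vertex type both for the possible limit objects
  and for the finite graphs they are compared with.\<close>

definition infinite_rooted_Omega_ktrees :: "nat set \<Rightarrow> nat \<Rightarrow> nat rooted_graph set" where
  "infinite_rooted_Omega_ktrees \<Omega> k =
     {G. infinite_Omega_ktree \<Omega> k (fst G) \<and> locally_finite (fst G) \<and> front_rooted k G}"

text \<open>On locally finite graphs, the sets generating this \<open>\<sigma>\<close>-algebra form a countable base (up to
  isomorphism of \<open>H\<close>) of the topology of local convergence, so it is the corresponding Borel
  \<open>\<sigma>\<close>-algebra.\<close>

definition local_space :: "nat set \<Rightarrow> nat \<Rightarrow> nat rooted_graph measure" where
  "local_space \<Omega> k = sigma (infinite_rooted_Omega_ktrees \<Omega> k)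
     {{G \<in> infinite_rooted_Omega_ktrees \<Omega> k. U l G \<simeq> H} | l H :: nat rooted_graph.
        finite (fst (fst H)) \<and> front_rooted k H}"

lemma space_local_space: "space (local_space \<Omega> k) = infinite_rooted_Omega_ktrees \<Omega> k"
  unfolding local_space_def by (rule space_measure_of) blast

lemma neighbourhood_event_in_sets:
  fixes H :: "nat rooted_graph"
  assumes "finite (fst (fst H))" "front_rooted k H"
  shows "{G \<in> space (local_space \<Omega> k). U l G \<simeq> H} \<in> sets (local_space \<Omega> k)"
  unfolding space_local_space unfolding local_space_def
  by (rule in_measure_of) (use assms in blast)+

end

theory Submission
  imports Defs "HOL-Combinatorics.Multiset_Permutations" "HOL-Real_Asymp.Real_Asymp"
begin

text \<open>A front-rooted k-tree is a rooted tree in disguise. Each front carries the hedra that contain it and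
  lie on the side away from the root; such a hedron adds one vertex \<open>v\<close> to the front \<open>C\<close> and produces
  the \<open>k\<close> further fronts \<open>C - u + v\<close> with \<open>u \<in> C\<close>. Hence the graph can be explored front by front, and
  the word of the numbers \<open>d\<close> of new vertices at the explored fronts determines it up to isomorphism.
  The condition on the hedra says that \<open>d \<in> \<Omega>\<close> at the root front and \<open>d + 1 \<in> \<Omega>\<close> at every other front.
  The \<open>d\<close> new vertices of a front can be listed in \<open>d!\<close> orders; with weight \<open>1 / d!\<close> per front, the
  explorations of a given rooted k-tree with ordered root front have total weight one
  (\<open>root_completions_weight\<close>). Therefore the uniformly random rooted k-tree is, up to isomorphism, the
  graph of a random word whose probability is proportional to the product of the \<open>1 / d!\<close>
  (\<open>rooted_count\<close>, \<open>rooted_prob\<close>).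

  The weight of all continuations of a word depends only on the number \<open>q\<close> of active fronts and the
  number \<open>m\<close> of hedra that are still missing. With \<open>\<phi>\<close> the exponential generating function of the
  numbers \<open>d\<close> with \<open>d + 1 \<in> \<Omega>\<close>, it is \<open>q / (q + k m)\<close> times the coefficient of \<open>t^m\<close> in \<open>\<phi>^(q + k m)\<close>
  (\<open>forest_weight_sum\<close>). The probability of a prefix is thus a ratio of such coefficients. Choose
  \<open>\<tau>\<close> so that the distribution with weights \<open>\<phi>_d \<tau>^d\<close> has mean \<open>1 / k\<close>, which makes the number of active
  fronts a centred random walk. Then the ratios converge (\<open>prefix_ratio\<close>): given the sum of \<open>N\<close>
  independent numbers with this distribution, the frequency of each value is close to its
  probability, because large deviations are exponentially unlikely while the value of the sum in
  question is not. The limiting exploration is the walk conditioned to stay positive, the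
  Doob transform with the harmonic function \<open>q\<close>. If there is no such \<open>\<tau>\<close>, then \<open>k = 1\<close> and
  \<open>\<Omega> = {0, 1, 2}\<close>; the trees are paths, and the limit is the two-sided infinite path.

  The exploration prefers fronts near the root. Once all active fronts have distance at least \<open>l\<close> from
  the root, the ball of radius \<open>l\<close> is known (\<open>U_root_graph_append\<close>, \<open>U_limit\<close>). In the limiting process
  this happens after finitely many steps, since the active vertices at the current distance behave
  like a subcritical branching process (\<open>phase_finishes\<close>). So the limiting exploration almost surely builds an
  infinite, locally finite \<open>\<Omega>\<close>-k-tree, and the words at which level \<open>l\<close> is finished carry the
  full mass in the limit. Convergence of the probabilities of all words then gives convergence of the
  probabilities of all events about balls (\<open>hit_prob_liminf\<close>).\<close>

section \<open>Common neighbours and attaching vertices to a clique\<close>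

definition nbrs :: "'a graph \<Rightarrow> 'a set \<Rightarrow> 'a set" where
  "nbrs G F = {x \<in> fst G. x \<notin> F \<and> (\<forall>u\<in>F. {x, u} \<in> snd G)}"

definition attach :: "'a graph \<Rightarrow> 'a set \<Rightarrow> 'a set \<Rightarrow> 'a graph" where
  "attach G C L = (fst G \<union> L, snd G \<union> {{v, u} | v u. v \<in> L \<and> u \<in> C})"

lemma edge_complete_iff: "{u, v} \<in> complete_edges V \<longleftrightarrow> u \<in> V \<and> v \<in> V \<and> u \<noteq> v"
  unfolding complete_edges_def by (auto simp: doubleton_eq_iff)

lemma cliques_iff:
  "C \<in> cliques m G \<longleftrightarrow> C \<subseteq> fst G \<and> finite C \<and> card C = m \<and> (\<forall>u\<in>C. \<forall>v\<in>C. u \<noteq> v \<longrightarrow> {u, v} \<in> snd G)"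
  unfolding cliques_def complete_edges_def by auto

lemma simple_edgeD: "simple_graph G \<Longrightarrow> {u, v} \<in> snd G \<Longrightarrow> u \<in> fst G \<and> v \<in> fst G \<and> u \<noteq> v"
  unfolding simple_graph_def using edge_complete_iff[of u v "fst G"] by blast

lemma fst_attach [simp]: "fst (attach G C L) = fst G \<union> L"
  by (simp add: attach_def)

lemma edge_attach_iff:
  "{x, y} \<in> snd (attach G C L) \<longleftrightarrow> {x, y} \<in> snd G \<or> (x \<in> L \<and> y \<in> C) \<or> (y \<in> L \<and> x \<in> C)"
  unfolding attach_def by (auto simp: doubleton_eq_iff)

lemma attach_empty [simp]: "attach G C {} = G"
  by (simp add: attach_def)

lemma attach_commute: "attach (attach G B L) C M = attach (attach G C M) B L"
  by (auto simp: attach_def)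

lemma attach_Un: "attach G C (L \<union> M) = attach (attach G C L) C M"
  by (auto simp: attach_def)

lemma ktree_step_iff:
  "ktree_step k G G' \<longleftrightarrow> (\<exists>v C. v \<notin> fst G \<and> C \<in> cliques k G \<and> G' = attach G C {v})"
  unfolding ktree_step_def attach_def by simp

lemma simple_attach:
  assumes "simple_graph G" "C \<subseteq> fst G" "L \<inter> fst G = {}"
  shows "simple_graph (attach G C L)"
  unfolding simple_graph_def
proof
  fix e assume e: "e \<in> snd (attach G C L)"
  show "e \<in> complete_edges (fst (attach G C L))"
  proof (cases "e \<in> snd G")
    case True
    thus ?thesis using assms(1) unfolding simple_graph_def complete_edges_def fst_attach by blast
  next
    case False
    then obtain v u where "e = {v, u}" "v \<in> L" "u \<in> C" using e by (auto simp: attach_def)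
    thus ?thesis using assms(2,3) by (auto simp: edge_complete_iff)
  qed
qed

lemma cliques_attach_mono: "C \<in> cliques m G \<Longrightarrow> C \<in> cliques m (attach G B L)"
  by (auto simp: cliques_iff attach_def)

lemma cliques_attach_inside:
  assumes "simple_graph G" "L \<inter> fst G = {}" "B \<subseteq> fst G" "C \<in> cliques m (attach G B L)" "C \<inter> L = {}"
  shows "C \<in> cliques m G"
proof -
  have "x \<notin> L" if "x \<in> C" for x using that assms(5) by auto
  thus ?thesis using assms(4) unfolding cliques_iff edge_attach_iff fst_attach by fast
qed

lemma cliques_attach_new:
  assumes G: "simple_graph G" and L: "L \<inter> fst G = {}" and B: "B \<subseteq> fst G"
    and C: "C \<in> cliques m (attach G B L)" and v: "v \<in> C" "v \<in> L"
  shows "C - {v} \<subseteq> B"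
proof
  fix x assume x: "x \<in> C - {v}"
  hence "{x, v} \<in> snd (attach G B L)" using C v by (auto simp: cliques_iff)
  thus "x \<in> B" using simple_edgeD[OF G, of x v] v L B unfolding edge_attach_iff by auto
qed

text \<open>All neighbours of a new vertex \<open>v\<close> are in \<open>B\<close>; so a clique that contains \<open>v\<close> consists of \<open>v\<close> and
  vertices of \<open>B\<close>.\<close>

lemma fronts_attach:
  assumes G: "simple_graph G" and L: "L \<inter> fst G = {}" and B: "B \<in> cliques k G" and k: "k \<ge> 1"
  shows "cliques k (attach G B L) = cliques k G \<union> {insert v (B - {u}) | v u. v \<in> L \<and> u \<in> B}"
proof (intro equalityI subsetI)
  fix C assume C: "C \<in> cliques k (attach G B L)"
  have fin: "finite B" "card B = k" "B \<subseteq> fst G" using B by (auto simp: cliques_iff)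
  have finC: "finite C" "card C = k" using C by (auto simp: cliques_iff)
  show "C \<in> cliques k G \<union> {insert v (B - {u}) | v u. v \<in> L \<and> u \<in> B}"
  proof (cases "C \<inter> L = {}")
    case True thus ?thesis using cliques_attach_inside[OF G L fin(3) C] by auto
  next
    case False
    then obtain v where v: "v \<in> C" "v \<in> L" by auto
    have sub: "C - {v} \<subseteq> B" by (rule cliques_attach_new[OF G L fin(3) C v])
    have "card (B - (C - {v})) = card B - card (C - {v})"
      using sub fin finC by (intro card_Diff_subset) auto
    also have "\<dots> = 1" using fin finC v k by simp
    finally obtain u where u: "B - (C - {v}) = {u}" by (auto simp: card_1_singleton_iff)
    hence "C - {v} = B - {u}" "u \<in> B" using sub by auto
    hence "C = insert v (B - {u})" using v by auto
    thus ?thesis using v \<open>u \<in> B\<close> by auto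
  qed
next
  fix C assume "C \<in> cliques k G \<union> {insert v (B - {u}) | v u. v \<in> L \<and> u \<in> B}"
  then consider "C \<in> cliques k G" | v u where "C = insert v (B - {u})" "v \<in> L" "u \<in> B" by auto
  thus "C \<in> cliques k (attach G B L)"
  proof cases
    case 1 thus ?thesis by (rule cliques_attach_mono)
  next
    case 2
    have "v \<notin> B" using 2 L B by (auto simp: cliques_iff)
    thus ?thesis using 2 B k unfolding cliques_iff edge_attach_iff
      by (auto simp: card_insert_if)
  qed
qed

lemma hedra_attach:
  assumes G: "simple_graph G" and L: "L \<inter> fst G = {}" and B: "B \<in> cliques k G"
  shows "cliques (Suc k) (attach G B L) = cliques (Suc k) G \<union> {insert v B | v. v \<in> L}"
proof (intro equalityI subsetI)
  fix C assume C: "C \<in> cliques (Suc k) (attach G B L)"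
  have fin: "finite B" "card B = k" "B \<subseteq> fst G" using B by (auto simp: cliques_iff)
  have finC: "finite C" "card C = Suc k" using C by (auto simp: cliques_iff)
  show "C \<in> cliques (Suc k) G \<union> {insert v B | v. v \<in> L}"
  proof (cases "C \<inter> L = {}")
    case True thus ?thesis using cliques_attach_inside[OF G L fin(3) C] by auto
  next
    case False
    then obtain v where v: "v \<in> C" "v \<in> L" by auto
    have sub: "C - {v} \<subseteq> B" by (rule cliques_attach_new[OF G L fin(3) C v])
    have "C - {v} = B" using sub fin finC v by (intro card_subset_eq) auto
    hence "C = insert v B" using v by auto
    thus ?thesis using v by auto
  qed
next
  fix C assume "C \<in> cliques (Suc k) G \<union> {insert v B | v. v \<in> L}"
  then consider "C \<in> cliques (Suc k) G" | v where "C = insert v B" "v \<in> L" by auto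
  thus "C \<in> cliques (Suc k) (attach G B L)"
  proof cases
    case 1 thus ?thesis by (rule cliques_attach_mono)
  next
    case 2
    have "v \<notin> B" using 2 L B by (auto simp: cliques_iff)
    thus ?thesis using 2 B unfolding cliques_iff edge_attach_iff by (auto simp: card_insert_if)
  qed
qed

lemma nbrs_attach_self:
  assumes "simple_graph G" "L \<inter> fst G = {}" "B \<in> cliques k G"
  shows "nbrs (attach G B L) B = nbrs G B \<union> L"
  using assms unfolding nbrs_def edge_attach_iff by (auto simp: cliques_iff)

text \<open>A front that is different from \<open>B\<close> has a vertex outside of \<open>B\<close>, to which no new vertex is
  adjacent.\<close>

lemma nbrs_attach_other:
  assumes "simple_graph G" "L \<inter> fst G = {}" "B \<in> cliques k G" "F \<in> cliques k G" "F \<noteq> B"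
  shows "nbrs (attach G B L) F = nbrs G F"
proof -
  have BV: "B \<subseteq> fst G" and FV: "F \<subseteq> fst G" using assms(3,4) by (auto simp: cliques_iff)
  have "\<not> F \<subseteq> B" using assms(3-5) card_subset_eq[of B F] by (auto simp: cliques_iff)
  then obtain u where u: "u \<in> F" "u \<notin> B" by blast
  have "x \<notin> L" if "x \<in> nbrs (attach G B L) F" for x
  proof
    assume x: "x \<in> L"
    have "{x, u} \<in> snd (attach G B L)" using that u by (simp add: nbrs_def)
    thus False using x u FV assms(2) simple_edgeD[OF assms(1), of x u] unfolding edge_attach_iff by blast
  qed
  moreover have "(\<forall>w\<in>F. {x, w} \<in> snd (attach G B L)) \<longleftrightarrow> (\<forall>w\<in>F. {x, w} \<in> snd G)" if "x \<notin> L" for x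
    using that FV assms(2) unfolding edge_attach_iff by blast
  ultimately have "x \<in> nbrs (attach G B L) F \<longleftrightarrow> x \<in> nbrs G F" for x
    unfolding nbrs_def using assms(2) by auto
  thus ?thesis by blast
qed

text \<open>A new vertex is adjacent to \<open>B\<close> only, so the one vertex that completes a newly created front to a
  hedron is the vertex of \<open>B\<close> that was replaced.\<close>

lemma nbrs_attach_new:
  assumes G: "simple_graph G" and L: "L \<inter> fst G = {}" and B: "B \<in> cliques k G"
    and v: "v \<in> L" and u: "u \<in> B"
  shows "nbrs (attach G B L) (insert v (B - {u})) = {u}"
proof -
  have BV: "B \<subseteq> fst G" using B by (auto simp: cliques_iff)
  have nv: "{x, v} \<in> snd (attach G B L) \<longleftrightarrow> x \<in> B" for x
    using simple_edgeD[OF G, of x v] v L BV unfolding edge_attach_iff by auto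
  have "x = u" if "x \<in> nbrs (attach G B L) (insert v (B - {u}))" for x
    using that nv[of x] unfolding nbrs_def by auto
  moreover have "u \<in> nbrs (attach G B L) (insert v (B - {u}))"
    using nv[of u] u B BV v L unfolding nbrs_def by (auto simp: cliques_iff edge_attach_iff)
  ultimately show ?thesis by auto
qed

text \<open>The hedra above a front are obtained by adding one of its common neighbours, so the
  condition on a front is one on the number of its common neighbours.\<close>

lemma hedra_above_front:
  assumes F: "F \<in> cliques k G"
  shows "{D \<in> hedra k G. F \<subseteq> D} = (\<lambda>x. insert x F) ` nbrs G F"
proof (intro equalityI subsetI)
  fix D assume "D \<in> {D \<in> hedra k G. F \<subseteq> D}"
  hence D: "D \<in> cliques (Suc k) G" "F \<subseteq> D" by auto
  have "card (D - F) = 1" using D F by (auto simp: cliques_iff card_Diff_subset)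
  then obtain x where x: "D - F = {x}" by (auto simp: card_1_singleton_iff)
  hence "D = insert x F" "x \<notin> F" using D by auto
  moreover have "x \<in> nbrs G F" proof -
    have "x \<in> D" using x by blast
    have e: "\<forall>u\<in>D. \<forall>v\<in>D. u \<noteq> v \<longrightarrow> {u, v} \<in> snd G" and DV: "D \<subseteq> fst G" using D by (auto simp: cliques_iff)
    have "{x, u} \<in> snd G" if "u \<in> F" for u
      using e \<open>x \<in> D\<close> \<open>x \<notin> F\<close> that D(2) by (metis subsetD)
    thus ?thesis using \<open>x \<in> D\<close> DV \<open>x \<notin> F\<close> unfolding nbrs_def by auto
  qed
  ultimately show "D \<in> (\<lambda>x. insert x F) ` nbrs G F" by auto
next
  fix D assume "D \<in> (\<lambda>x. insert x F) ` nbrs G F"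
  then obtain x where "x \<in> nbrs G F" "D = insert x F" by auto
  thus "D \<in> {D \<in> hedra k G. F \<subseteq> D}"
    using F unfolding nbrs_def cliques_iff by (auto simp: insert_commute)
qed

lemma inj_on_insert_nbrs: "inj_on (\<lambda>x. insert x F) (nbrs G F)"
  unfolding inj_on_def nbrs_def by auto

lemma hedra_condition_iff:
  "hedra_condition \<Omega> k G \<longleftrightarrow> (\<forall>F\<in>cliques k G. finite (nbrs G F) \<and> card (nbrs G F) \<in> \<Omega>)"
proof -
  have "finite {D \<in> hedra k G. F \<subseteq> D} \<longleftrightarrow> finite (nbrs G F)"
    "card {D \<in> hedra k G. F \<subseteq> D} = card (nbrs G F)" if "F \<in> cliques k G" for F
    unfolding hedra_above_front[OF that]
    by (simp_all add: card_image inj_on_insert_nbrs finite_image_iff)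
  thus ?thesis unfolding hedra_condition_def by simp
qed

section \<open>Finite k-trees\<close>

lemma cliques_complete: "finite K \<Longrightarrow> card K = k \<Longrightarrow> cliques k (K, complete_edges K) = {K}"
  using card_subset_eq[of K] by (fastforce simp: cliques_iff edge_complete_iff)

lemma ktree_simple: "ktree k G \<Longrightarrow> simple_graph G \<and> finite (fst G)"
proof (induction rule: ktree.induct)
  case (base K)
  show ?case using base by (simp add: simple_graph_def)
next
  case (step G G')
  then obtain v C where "v \<notin> fst G" "C \<in> cliques k G" "G' = attach G C {v}" by (auto simp: ktree_step_iff)
  thus ?case using step.IH simple_attach[of G C "{v}"] by (auto simp: cliques_iff)
qed

lemma finite_cliques: "finite (fst G) \<Longrightarrow> finite (cliques m G)"
  by (rule finite_subset[of _ "Pow (fst G)"]) (auto simp: cliques_iff)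

lemma ktree_counts:
  assumes "ktree k G" "k \<ge> 1"
  shows "card (fst G) = card (hedra k G) + k \<and> card (fronts k G) = k * card (hedra k G) + 1"
  using assms
proof (induction rule: ktree.induct)
  case (base K)
  have "cliques (Suc k) (K, complete_edges K) = {}"
    using base card_mono[of K] by (fastforce simp: cliques_iff)
  thus ?case using base cliques_complete[of K k] by simp
next
  case (step G G')
  then obtain v C where vC: "v \<notin> fst G" "C \<in> cliques k G" "G' = attach G C {v}" by (auto simp: ktree_step_iff)
  note G = ktree_simple[OF step.hyps(1)]
  have L: "{v} \<inter> fst G = {}" using vC by auto
  have vn: "v \<notin> A" if "A \<in> cliques m G" for A m using that vC by (auto simp: cliques_iff)
  have h: "hedra k G' = insert (insert v C) (hedra k G)"
    using hedra_attach[OF conjunct1[OF G] L vC(2)] vC(3) by auto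
  have ch: "card (hedra k G') = Suc (card (hedra k G))"
    unfolding h using vn[of "insert v C"] G by (subst card_insert_disjoint) (auto simp: finite_cliques)
  have f: "fronts k G' = fronts k G \<union> (\<lambda>u. insert v (C - {u})) ` C"
    using fronts_attach[OF conjunct1[OF G] L vC(2) step.prems] vC(3) by auto
  have "v \<notin> C" "finite C" "card C = k" using vn[OF vC(2)] vC(2) by (auto simp: cliques_iff)
  hence "card ((\<lambda>u. insert v (C - {u})) ` C) = k"
    by (subst card_image) (auto simp: inj_on_def)
  moreover have "fronts k G \<inter> (\<lambda>u. insert v (C - {u})) ` C = {}" using vn by fastforce
  ultimately have cf: "card (fronts k G') = card (fronts k G) + k"
    unfolding f using G \<open>finite C\<close> by (subst card_Un_disjoint) (auto simp: finite_cliques)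
  show ?case using step ch cf vC G by simp
qed

lemma ktree_attach:
  assumes "ktree k G" "C \<in> cliques k G" "finite L" "L \<inter> fst G = {}"
  shows "ktree k (attach G C L)"
  using assms(3,4)
proof (induction L rule: finite_induct)
  case (insert v L)
  have "attach G C (insert v L) = attach (attach G C L) C {v}" using attach_Un[of G C L "{v}"] by simp
  moreover have "ktree_step k (attach G C L) (attach (attach G C L) C {v})"
    unfolding ktree_step_iff using insert.hyps insert.prems cliques_attach_mono[OF assms(2), of C L]
    by (intro exI[of _ v] exI[of _ C]) auto
  moreover have "ktree k (attach G C L)" using insert by auto
  ultimately show ?case using ktree.step by metis
qed (use assms in simp)

text \<open>\<open>ext k H F G\<close>: the graph \<open>G\<close> arises from \<open>H\<close> by adding vertices one at a time, where every
  new vertex is attached to a front from \<open>F\<close> or to a front with a vertex outside \<open>H\<close>. It says that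
  the part of \<open>G\<close> outside of \<open>H\<close> hangs at the fronts in \<open>F\<close>.\<close>

inductive ext :: "nat \<Rightarrow> 'a graph \<Rightarrow> 'a set set \<Rightarrow> 'a graph \<Rightarrow> bool" for k H F where
  ext_refl: "ext k H F H"
| ext_step: "ext k H F G \<Longrightarrow> v \<notin> fst G \<Longrightarrow> C \<in> cliques k G \<Longrightarrow> C \<in> F \<or> \<not> C \<subseteq> fst H
     \<Longrightarrow> ext k H F (attach G C {v})"

lemma ext_induced:
  assumes "ext k H F G" "simple_graph H"
  shows "simple_graph G \<and> fst H \<subseteq> fst G \<and> (\<forall>x\<in>fst H. \<forall>y\<in>fst H. {x, y} \<in> snd G \<longleftrightarrow> {x, y} \<in> snd H)"
  using assms
proof (induction rule: ext.induct)
  case (ext_step G v C)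
  have IH: "simple_graph G" "fst H \<subseteq> fst G" "\<forall>x\<in>fst H. \<forall>y\<in>fst H. {x, y} \<in> snd G \<longleftrightarrow> {x, y} \<in> snd H"
    using ext_step by auto
  have "simple_graph (attach G C {v})"
    using IH ext_step.hyps by (intro simple_attach) (auto simp: cliques_iff)
  moreover have "{x, y} \<in> snd (attach G C {v}) \<longleftrightarrow> {x, y} \<in> snd H" if "x \<in> fst H" "y \<in> fst H" for x y
    using that IH ext_step.hyps unfolding edge_attach_iff by auto
  ultimately show ?case using IH by auto
qed auto

lemma ext_finite: "ext k H F G \<Longrightarrow> finite (fst H) \<Longrightarrow> finite (fst G)"
  by (induction rule: ext.induct) auto

lemma cliques_induced:
  assumes "ext k H F G" "simple_graph H" "C \<subseteq> fst H"
  shows "C \<in> cliques m G \<longleftrightarrow> C \<in> cliques m H"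
  using ext_induced[OF assms(1,2)] assms(3) unfolding cliques_iff by (auto simp: subset_iff)

text \<open>A vertex can be added before rather than after a series of other additions that do not involve
  it.\<close>

lemma ext_attach:
  assumes "ext k H F G" "w \<notin> fst G" "C \<in> cliques k H"
  shows "ext k (attach H C {w}) (F \<union> S) (attach G C {w})"
  using assms
proof (induction rule: ext.induct)
  case (ext_step G v B)
  have "ext k (attach H C {w}) (F \<union> S) (attach (attach G C {w}) B {v})"
  proof (rule ext.ext_step)
    show "ext k (attach H C {w}) (F \<union> S) (attach G C {w})" using ext_step by auto
    show "v \<notin> fst (attach G C {w})" using ext_step by auto
    show "B \<in> cliques k (attach G C {w})" using ext_step by (intro cliques_attach_mono)
    have "w \<notin> B" using ext_step by (auto simp: cliques_iff)
    thus "B \<in> F \<union> S \<or> \<not> B \<subseteq> fst (attach H C {w})" using ext_step by auto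
  qed
  thus ?case by (simp add: attach_commute)
qed (auto intro: ext.ext_refl)

text \<open>After all vertices hanging at \<open>C\<close> have been added, the rest of the
  graph hangs at the other fronts and at the fronts that came into being. A front of \<open>G\<close> that uses
  one of these new vertices and lies inside the enlarged part is one of the new fronts, because
  no two of the new vertices are adjacent.\<close>

lemma ext_process:
  assumes "ext k H F G" "simple_graph H" "C \<in> cliques k H" "k \<ge> 1"
  shows "ext k (attach H C (nbrs G C - fst H))
    ((F - {C}) \<union> {insert v (C - {u}) | v u. v \<in> nbrs G C - fst H \<and> u \<in> C}) G"
  using assms
proof (induction rule: ext.induct)
  case ext_refl
  have D: "nbrs H C - fst H = {}" by (auto simp: nbrs_def)
  hence eq: "(F - {C}) \<union> {insert v (C - {u}) | v u. v \<in> nbrs H C - fst H \<and> u \<in> C} = F - {C}" by blast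
  show ?case unfolding eq unfolding D attach_empty by (rule ext.ext_refl)
next
  case (ext_step G w B)
  let ?D = "nbrs G C - fst H"
  have IH: "ext k (attach H C ?D) ((F - {C}) \<union> {insert v (C - {u}) | v u. v \<in> ?D \<and> u \<in> C}) G"
    using ext_step by auto
  have ind: "simple_graph G \<and> fst H \<subseteq> fst G" using ext_induced[OF ext_step.hyps(1) ext_step.prems(1)] by auto
  have CG: "C \<in> cliques k G"
    using cliques_induced[OF ext_step.hyps(1) ext_step.prems(1), of C k] ext_step.prems(2) by (auto simp: cliques_iff)
  have w: "{w} \<inter> fst G = {}" using ext_step by auto
  show ?case
  proof (cases "B = C")
    case True
    have D': "nbrs (attach G B {w}) C - fst H = ?D \<union> {w}"
      using nbrs_attach_self[OF conjunct1[OF ind] w CG] True ind ext_step.hyps by auto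
    have "ext k (attach (attach H C ?D) C {w})
       (((F - {C}) \<union> {insert v (C - {u}) | v u. v \<in> ?D \<and> u \<in> C}) \<union> {insert w (C - {u}) | u. u \<in> C}) (attach G C {w})"
      using ext_step.hyps(2) ext_step.prems(2) by (intro ext_attach[OF IH] cliques_attach_mono)
    moreover have "((F - {C}) \<union> {insert v (C - {u}) | v u. v \<in> ?D \<and> u \<in> C}) \<union> {insert w (C - {u}) | u. u \<in> C}
       = (F - {C}) \<union> {insert v (C - {u}) | v u. v \<in> ?D \<union> {w} \<and> u \<in> C}" by auto
    ultimately have "ext k (attach H C (?D \<union> {w}))
       ((F - {C}) \<union> {insert v (C - {u}) | v u. v \<in> ?D \<union> {w} \<and> u \<in> C}) (attach G C {w})"
      by (simp only: attach_Un)
    thus ?thesis using D' True by (simp only:)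
  next
    case False
    have D': "nbrs (attach G B {w}) C = nbrs G C"
      using nbrs_attach_other[OF conjunct1[OF ind] w ext_step.hyps(3) CG] False by auto
    have CH: "C \<subseteq> fst H" using ext_step.prems by (auto simp: cliques_iff)
    have sH: "simple_graph (attach H C ?D)" using ext_step.prems CH by (intro simple_attach) auto
    have "B \<in> (F - {C}) \<union> {insert v (C - {u}) | v u. v \<in> ?D \<and> u \<in> C} \<or> \<not> B \<subseteq> fst (attach H C ?D)"
    proof (cases "B \<subseteq> fst (attach H C ?D)")
      case True
      hence "B \<in> cliques k (attach H C ?D)" using cliques_induced[OF IH sH] ext_step.hyps by auto
      moreover have "cliques k (attach H C ?D) = cliques k H \<union> {insert v (C - {u}) | v u. v \<in> ?D \<and> u \<in> C}"
        by (rule fronts_attach) (use ext_step.prems in auto)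
      ultimately show ?thesis using ext_step.hyps False by (auto simp: cliques_iff)
    qed auto
    thus ?thesis unfolding D' using IH ext_step.hyps by (intro ext.ext_step) auto
  qed
qed

lemma ext_no_fronts: "ext k H {} G \<Longrightarrow> G = H"
  by (induction rule: ext.induct) (auto simp: cliques_iff)

lemma attach_complete:
  "v \<notin> C \<Longrightarrow> attach (C, complete_edges C) C {v} = (insert v C, complete_edges (insert v C))"
proof -
  assume v: "v \<notin> C"
  have "complete_edges (insert v C) = complete_edges C \<union> {{v, u} | u. u \<in> C}"
    (is "?A = ?B")
  proof (intro equalityI subsetI)
    fix e assume "e \<in> ?A"
    then obtain a b where e: "e = {a, b}" "a \<in> insert v C" "b \<in> insert v C" "a \<noteq> b"
      unfolding complete_edges_def by blast
    show "e \<in> ?B"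
    proof (cases "a = v")
      case True thus ?thesis using e by auto
    next
      case False
      show ?thesis
      proof (cases "b = v")
        case True
        hence "e = {v, a}" using e by (simp add: insert_commute)
        thus ?thesis using e False by auto
      next
        case False
        thus ?thesis using e \<open>a \<noteq> v\<close> unfolding complete_edges_def by blast
      qed
    qed
  next
    fix e assume "e \<in> ?B"
    thus "e \<in> ?A" using v unfolding complete_edges_def by blast
  qed
  thus ?thesis by (simp add: attach_def)
qed

text \<open>The first hedron \<open>C + v\<close> is the same whether \<open>v\<close> is added to \<open>C\<close> or \<open>u\<close> is added to \<open>C - u + v\<close>; the
  rest of the construction is not affected.\<close>

lemma ext_move_root:
  assumes "ext k (C, complete_edges C) {C} G" "v \<notin> fst G" "u \<in> C" "finite C" "card C = k"
  defines "R \<equiv> insert v (C - {u})"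
  shows "ext k (R, complete_edges R) {R} (attach G C {v})"
  using assms(1-5)
proof (induction rule: ext.induct)
  case ext_refl
  have "insert v C = insert u R" "v \<notin> C" "u \<notin> R" using ext_refl by (auto simp: R_def)
  hence eq: "attach (C, complete_edges C) C {v} = attach (R, complete_edges R) R {u}"
    by (simp add: attach_complete)
  have "v \<noteq> u" using ext_refl by auto
  moreover have "card C > 0" using ext_refl by (auto simp: card_gt_0_iff)
  ultimately have "finite R" "card R = k" "u \<notin> R" using ext_refl by (auto simp: R_def card_insert_if)
  hence "ext k (R, complete_edges R) {R} (attach (R, complete_edges R) R {u})"
    by (intro ext.ext_step ext.ext_refl) (auto simp: cliques_complete)
  thus ?case by (simp add: eq)
next
  case (ext_step G w B)
  have fin: "finite R" "card R = k"
  proof -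
    have "card C > 0" using ext_step by (auto simp: card_gt_0_iff)
    moreover have "C \<subseteq> fst G" using ext_induced[OF ext_step.hyps(1)] by (auto simp: simple_graph_def)
    ultimately show "finite R" "card R = k" using ext_step by (auto simp: R_def card_insert_if)
  qed
  have "ext k (R, complete_edges R) {R} (attach (attach G C {v}) B {w})"
  proof (rule ext.ext_step)
    show B: "B \<in> cliques k (attach G C {v})" using ext_step by (intro cliques_attach_mono)
    show "B \<in> {R} \<or> \<not> B \<subseteq> fst (R, complete_edges R)" 
      using fin B card_subset_eq[of R B] by (auto simp: cliques_iff)
  qed (use ext_step in auto)
  thus ?case by (simp add: attach_commute)
qed

text \<open>By induction on the construction: a front of the smaller k-tree is treated by the induction
  hypothesis, and a front with the last vertex is treated by the previous lemma.\<close>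

lemma ktree_ext_front:
  assumes "ktree k G" "k \<ge> 1" "R \<in> cliques k G"
  shows "ext k (R, complete_edges R) {R} G"
  using assms
proof (induction arbitrary: R rule: ktree.induct)
  case (base K)
  thus ?case using cliques_complete[of K k] by (auto intro: ext.ext_refl)
next
  case (step G G')
  then obtain v C where vC: "v \<notin> fst G" "C \<in> cliques k G" "G' = attach G C {v}" by (auto simp: ktree_step_iff)
  have fr: "cliques k G' = cliques k G \<union> {insert v' (C - {u}) | v' u. v' \<in> {v} \<and> u \<in> C}"
    unfolding vC(3)
    by (rule fronts_attach) (use vC step.prems ktree_simple[OF step.hyps(1)] in auto)
  have C: "finite C" "card C = k" using vC by (auto simp: cliques_iff)
  show ?case
  proof (cases "R \<in> cliques k G")
    case True
    have "C \<in> {R} \<or> \<not> C \<subseteq> fst (R, complete_edges R)"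
      using True C card_subset_eq[of R C] by (auto simp: cliques_iff)
    thus ?thesis unfolding vC(3) using step True vC by (intro ext.ext_step) auto
  next
    case False
    then obtain u where u: "u \<in> C" "R = insert v (C - {u})" using step.prems fr by auto
    have "ext k (C, complete_edges C) {C} G" using step vC by auto
    thus ?thesis unfolding vC(3) u(2) using ext_move_root[of k C G v u] u C vC by auto
  qed
qed

section \<open>Exploring a front-rooted k-tree\<close>

text \<open>A state consists of the explored vertices with their distances from the root, of the explored edges,
  and of the active fronts, that is, those whose further hedra have not been looked for. Fronts are
  lists, so that the children of a front come in an order that is compatible with relabelling, and
  each vertex in them carries its distance. The active fronts are sorted by their least distance
  \<open>lev\<close>, so that fronts near the root are explored first.\<close>

type_synonym 'a state = "('a \<times> nat) set \<times> 'a set set \<times> ('a \<times> nat) list list"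

abbreviation act :: "'a state \<Rightarrow> ('a \<times> nat) list list" where "act s \<equiv> snd (snd s)"

definition gr :: "'a state \<Rightarrow> 'a graph" where "gr s = (fst ` fst s, fst (snd s))"

definition vs :: "('a \<times> nat) list \<Rightarrow> 'a set" where "vs C = fst ` set C"

definition lev :: "('a \<times> nat) list \<Rightarrow> nat" where "lev C = Min (snd ` set C)"

definition kids :: "('a \<times> nat) list \<Rightarrow> 'a list \<Rightarrow> ('a \<times> nat) list list" where
  "kids C L = concat (map (\<lambda>v. map (\<lambda>i. C[i := (v, Suc (lev C))]) [0..<length C]) L)"

text \<open>The first active front is explored, and \<open>L\<close> lists the new vertices that are attached to it. Their
  distance from the root is one more than the least distance in the front.\<close>

fun grow :: "'a state \<Rightarrow> 'a list \<Rightarrow> 'a state" where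
  "grow (D, E, C # Q) L =
     (D \<union> (\<lambda>v. (v, Suc (lev C))) ` set L, E \<union> {{v, u} | v u. v \<in> set L \<and> u \<in> vs C},
      foldr (insort_key lev) (kids C L) Q)"
| "grow (D, E, []) L = (D, E, [])"

definition run :: "'a state \<Rightarrow> 'a list list \<Rightarrow> 'a state" where "run s ls = foldl grow s ls"

definition root_state :: "'a list \<Rightarrow> 'a state" where
  "root_state rs = ((\<lambda>v. (v, 0)) ` set rs, complete_edges (set rs), [map (\<lambda>v. (v, 0)) rs])"

lemma run_Nil [simp]: "run s [] = s"
  by (simp add: run_def)

lemma run_Cons [simp]: "run s (L # ls) = run (grow s L) ls"
  by (simp add: run_def)

lemma run_append: "run s (ls @ ls') = run (run s ls) ls'"
  by (simp add: run_def)

lemma gr_grow: "gr (grow (D, E, C # Q) L) = attach (gr (D, E, C # Q)) (vs C) (set L)"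
  by (simp add: gr_def attach_def image_Un image_image)

lemma mset_foldr_insort: "mset (foldr (insort_key f) xs ys) = mset xs + mset ys"
  by (induction xs) auto

lemma sorted_foldr_insort: "sorted (map f ys) \<Longrightarrow> sorted (map f (foldr (insort_key f) xs ys))"
  by (induction xs) (auto simp: sorted_insort_key)

lemma set_foldr_insort: "set (foldr (insort_key f) xs ys) = set xs \<union> set ys"
  by (metis mset_foldr_insort set_mset_mset set_mset_union)

lemma length_foldr_insort: "length (foldr (insort_key f) xs ys) = length xs + length ys"
  by (metis mset_foldr_insort size_mset size_union)

lemma length_kids: "length (kids C L) = length C * length L"
  unfolding kids_def by (induction L) auto

lemma set_kids: "set (kids C L) = {C[i := (v, Suc (lev C))] | v i. v \<in> set L \<and> i < length C}"
  unfolding kids_def by fastforce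

lemma vs_update:
  assumes "distinct (map fst C)" "i < length C"
  shows "vs (C[i := (v, m)]) = insert v (vs C - {fst (C ! i)})"
proof -
  have "vs (C[i := (v, m)]) = set ((map fst C)[i := v])"
    by (simp add: vs_def map_update flip: set_map)
  also have "\<dots> = insert v (set (map fst C) - {map fst C ! i})"
    by (rule set_update_distinct) (use assms in auto)
  finally show ?thesis using assms by (simp add: vs_def)
qed

lemma vs_kids:
  assumes "distinct (map fst C)"
  shows "vs ` set (kids C L) = {insert v (vs C - {u}) | v u. v \<in> set L \<and> u \<in> vs C}"
proof -
  have "vs C = (\<lambda>i. fst (C ! i)) ` {..<length C}"
    by (auto simp: vs_def image_image set_conv_nth)
  thus ?thesis unfolding set_kids using vs_update[OF assms] by (auto simp: image_iff) blast+
qed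

lemma distinct_vs_kids:
  assumes C: "distinct (map fst C)" and L: "distinct L" "set L \<inter> vs C = {}"
  shows "distinct (map vs (kids C L))"
  using L
proof (induction L)
  case (Cons v L)
  let ?m = "Suc (lev C)"
  have e: "map vs (kids C (v # L)) = map (\<lambda>i. vs (C[i := (v, ?m)])) [0..<length C] @ map vs (kids C L)"
    by (simp add: kids_def comp_def)
  have "inj_on (\<lambda>i. vs (C[i := (v, ?m)])) {0..<length C}"
  proof (rule inj_onI)
    fix i j assume ij: "i \<in> {0..<length C}" "j \<in> {0..<length C}" "vs (C[i := (v, ?m)]) = vs (C[j := (v, ?m)])"
    have "fst (C ! i) \<in> vs C" "fst (C ! j) \<in> vs C" using ij by (auto simp: vs_def)
    moreover have "insert v (vs C - {fst (C ! i)}) = insert v (vs C - {fst (C ! j)})"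
      using ij vs_update[OF C] by simp
    moreover have "v \<notin> vs C" using Cons.prems by simp
    ultimately have "fst (C ! i) = fst (C ! j)" by (metis Diff_iff insertCI insertE singletonD)
    thus "i = j" using C ij by (metis atLeastLessThan_iff distinct_conv_nth length_map nth_map)
  qed
  hence d1: "distinct (map (\<lambda>i. vs (C[i := (v, ?m)])) [0..<length C])"
    by (simp add: distinct_map)
  have "v \<notin> F" if "F \<in> vs ` set (kids C L)" for F
    using that Cons.prems unfolding vs_kids[OF C] by auto
  moreover have "v \<in> vs (C[i := (v, ?m)])" if "i < length C" for i
    using vs_update[OF C that] by auto
  ultimately have "set (map (\<lambda>i. vs (C[i := (v, ?m)])) [0..<length C]) \<inter> set (map vs (kids C L)) = {}"
    by fastforce
  thus ?case unfolding e distinct_append using d1 Cons by auto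
qed (simp add: kids_def)

lemma distinct_map_mset: "mset xs = mset ys \<Longrightarrow> distinct (map f xs) \<longleftrightarrow> distinct (map f ys)"
  by (metis mset_eq_imp_distinct_iff mset_map)

text \<open>The conditions on the pairs in the first component characterise their numbers as distances from \<open>R\<close>;
  see \<open>metric_ball\<close> below.\<close>

definition exploration_inv :: "nat \<Rightarrow> 'a set \<Rightarrow> 'a state \<Rightarrow> bool" where
  "exploration_inv k R s \<longleftrightarrow> finite (fst s) \<and> inj_on fst (fst s) \<and> ktree k (gr s) \<and>
     (\<forall>v. (v, 0) \<in> fst s \<longleftrightarrow> v \<in> R) \<and>
     (\<forall>v m. (v, Suc m) \<in> fst s \<longrightarrow> (\<exists>u. (u, m) \<in> fst s \<and> {u, v} \<in> fst (snd s))) \<and>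
     (\<forall>u a v b. (u, a) \<in> fst s \<and> (v, b) \<in> fst s \<and> {u, v} \<in> fst (snd s) \<longrightarrow> b \<le> Suc a) \<and>
     (\<forall>C\<in>set (act s). length C = k \<and> distinct (map fst C) \<and> set C \<subseteq> fst s \<and> vs C \<in> cliques k (gr s)) \<and>
     distinct (map vs (act s)) \<and> sorted (map lev (act s))"

lemma invI:
  assumes "finite D" "inj_on fst D" "ktree k (gr (D, E, Q))" "\<And>v. (v, 0) \<in> D \<longleftrightarrow> v \<in> R"
    "\<And>v m. (v, Suc m) \<in> D \<Longrightarrow> \<exists>u. (u, m) \<in> D \<and> {u, v} \<in> E"
    "\<And>u a v b. (u, a) \<in> D \<Longrightarrow> (v, b) \<in> D \<Longrightarrow> {u, v} \<in> E \<Longrightarrow> b \<le> Suc a"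
    "\<And>C. C \<in> set Q \<Longrightarrow> length C = k \<and> distinct (map fst C) \<and> set C \<subseteq> D \<and> vs C \<in> cliques k (gr (D, E, Q))"
    "distinct (map vs Q)" "sorted (map lev Q)"
  shows "exploration_inv k R (D, E, Q)"
  using assms unfolding exploration_inv_def by auto

text \<open>An active front is known to lie in \<open>c\<close> hedra: \<open>c = 0\<close> at the beginning, when it is the root front,
  and \<open>c = 1\<close> later, since each other front is born together with one hedron. All other fronts have
  reached their final number of hedra.\<close>

definition degs :: "nat set \<Rightarrow> nat \<Rightarrow> nat \<Rightarrow> 'a state \<Rightarrow> bool" where
  "degs \<Omega> k c s \<longleftrightarrow> (\<forall>F\<in>cliques k (gr s). if F \<in> vs ` set (act s)
      then card (nbrs (gr s) F) = c else card (nbrs (gr s) F) \<in> \<Omega>)"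

lemma finite_nbrs: "finite (fst G) \<Longrightarrow> finite (nbrs G F)"
  by (simp add: nbrs_def)

lemma inv_root:
  assumes "distinct rs" "length rs = k"
  shows "exploration_inv k (set rs) (root_state rs)"
proof -
  have g: "gr (root_state rs) = (set rs, complete_edges (set rs))"
    by (simp add: gr_def root_state_def image_image)
  have "vs (map (\<lambda>v. (v, 0::nat)) rs) = set rs" by (simp add: vs_def image_image)
  moreover have "card (set rs) = k" using assms distinct_card by blast
  ultimately show ?thesis unfolding exploration_inv_def g
    by (auto simp: root_state_def cliques_complete inj_on_def comp_def assms intro!: ktree.base)
qed

lemma lev_le: "(u, b) \<in> set C \<Longrightarrow> lev C \<le> b"
  unfolding lev_def by (rule Min_le) force+

lemma lev_attained: "C \<noteq> [] \<Longrightarrow> \<exists>u. (u, lev C) \<in> set C"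
proof -
  assume "C \<noteq> []"
  hence "lev C \<in> snd ` set C" unfolding lev_def by (intro Min_in) auto
  thus ?thesis by force
qed

text \<open>The vertices of the explored front are at distance \<open>lev C\<close> or \<open>lev C + 1\<close>, as they are all adjacent to
  one at distance \<open>lev C\<close>; this makes the distance of the new vertices consistent.\<close>

lemma inv_grow:
  assumes I: "exploration_inv k R (D, E, C # Q)" and k: "k \<ge> 1"
    and L: "distinct L" "set L \<inter> fst ` D = {}"
  shows "exploration_inv k R (grow (D, E, C # Q) L)"
proof -
  let ?s = "(D, E, C # Q)" and ?l = "Suc (lev C)"
  let ?D = "D \<union> (\<lambda>v. (v, ?l)) ` set L"
  let ?E = "E \<union> {{v, u} | v u. v \<in> set L \<and> u \<in> vs C}"
  let ?G = "gr ?s"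
  have fin: "finite D" and injD: "inj_on fst D" and kt: "ktree k ?G"
    and d0: "\<And>v. (v, 0) \<in> D \<longleftrightarrow> v \<in> R"
    and d1: "\<And>v m. (v, Suc m) \<in> D \<Longrightarrow> \<exists>u. (u, m) \<in> D \<and> {u, v} \<in> E"
    and d2: "\<And>u a v b. (u, a) \<in> D \<Longrightarrow> (v, b) \<in> D \<Longrightarrow> {u, v} \<in> E \<Longrightarrow> b \<le> Suc a"
    and cl: "\<And>C'. C' \<in> set (C # Q) \<Longrightarrow> length C' = k \<and> distinct (map fst C') \<and> set C' \<subseteq> D \<and> vs C' \<in> cliques k ?G"
    and dist: "distinct (map vs (C # Q))" and srt: "sorted (map lev (C # Q))"
    using I unfolding exploration_inv_def by auto
  have simple: "simple_graph ?G" using ktree_simple[OF kt] by auto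
  have G: "fst ?G = fst ` D" "snd ?G = E" by (auto simp: gr_def)
  have C: "length C = k" "distinct (map fst C)" "set C \<subseteq> D" "vs C \<in> cliques k ?G" using cl by auto
  have CD: "vs C \<subseteq> fst ` D" using C by (auto simp: vs_def)
  have Ld: "set L \<inter> fst ?G = {}" using L G by simp
  have ne: "C \<noteq> []" using C k by auto
  then obtain u0 where u0: "(u0, lev C) \<in> set C" using lev_attained by blast
  have newE: "{u, v} \<in> ?E \<longleftrightarrow> {u, v} \<in> E \<or> (u \<in> set L \<and> v \<in> vs C) \<or> (v \<in> set L \<and> u \<in> vs C)" for u v
    by (auto simp: doubleton_eq_iff)
  have EV: "u \<in> fst ` D \<and> v \<in> fst ` D" if "{u, v} \<in> E" for u v
    using simple_edgeD[OF simple, of u v] that G by auto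
  have Cb: "lev C \<le> b \<and> b \<le> ?l" if ub0: "u \<in> vs C" "(u, b) \<in> D" for u b
  proof -
    obtain b' where b': "(u, b') \<in> set C" using ub0(1) unfolding vs_def image_iff by (metis prod.collapse)
    hence "b' = b" using that injD C by (metis fst_conv inj_onD snd_conv subsetD)
    hence ub: "(u, b) \<in> set C" using b' by simp
    show ?thesis
    proof (cases "u = u0")
      case True
      hence "b = lev C" using injD that u0 C by (metis fst_conv inj_onD snd_conv subsetD)
      thus ?thesis by simp
    next
      case False
      have "{u0, u} \<in> E" using C(4) u0 that False G unfolding cliques_iff vs_def by force
      thus ?thesis using d2[of u0 "lev C" u b] u0 C that lev_le[OF ub] by auto
    qed
  qed
  have noL: "(v, b) \<in> D \<Longrightarrow> v \<notin> set L" for v b using L by force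
  have k1: "ktree k (gr (grow ?s L))"
    unfolding gr_grow by (rule ktree_attach[OF kt C(4) _ Ld]) simp
  have kidsV: "C' \<in> set (kids C L) \<Longrightarrow> length C' = k \<and> distinct (map fst C') \<and> set C' \<subseteq> ?D" for C'
  proof -
    assume "C' \<in> set (kids C L)"
    then obtain v i where vi: "C' = C[i := (v, ?l)]" "v \<in> set L" "i < length C" by (auto simp: set_kids)
    have "set (map fst C) = vs C" by (simp add: vs_def)
    hence "v \<notin> set (map fst C)" using vi(2) L(2) CD by blast
    hence "distinct ((map fst C)[i := v])" using C by (intro distinct_list_update) auto
    moreover have "set C' \<subseteq> insert (v, ?l) (set C)" unfolding vi by (rule set_update_subset_insert)
    ultimately show ?thesis using vi C by (auto simp: map_update)
  qed
  have kidsc: "vs ` set (kids C L) \<subseteq> cliques k (gr (grow ?s L))"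
    unfolding gr_grow fronts_attach[OF simple Ld C(4) k] vs_kids[OF C(2)] by auto
  have oldc: "F \<in> cliques k ?G \<Longrightarrow> F \<in> cliques k (gr (grow ?s L))" for F
    unfolding gr_grow by (rule cliques_attach_mono)
  have cl': "length C' = k \<and> distinct (map fst C') \<and> set C' \<subseteq> ?D \<and> vs C' \<in> cliques k (gr (grow ?s L))"
    if "C' \<in> set (act (grow ?s L))" for C'
  proof -
    have "C' \<in> set (kids C L) \<or> C' \<in> set Q" using that by (simp add: set_foldr_insort)
    thus ?thesis using kidsV[of C'] kidsc cl[of C'] oldc[of "vs C'"] by auto
  qed
  have "vs C' \<noteq> vs C''" if "C' \<in> set (kids C L)" "C'' \<in> set Q" for C' C''
  proof -
    have "vs C' \<in> vs ` set (kids C L)" using that by auto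
    then obtain v where "v \<in> vs C'" "v \<in> set L" unfolding vs_kids[OF C(2)] by blast
    moreover have "vs C'' \<subseteq> fst ` D" using cl[of C''] that by (auto simp: vs_def)
    ultimately show ?thesis using L by auto
  qed
  hence "distinct (map vs (kids C L @ Q))"
    using distinct_vs_kids[OF C(2) L(1)] dist L CD by fastforce
  hence dist': "distinct (map vs (act (grow ?s L)))"
    using distinct_map_mset[of "foldr (insort_key lev) (kids C L) Q" "kids C L @ Q" vs]
    by (simp add: mset_foldr_insort)
  have srt': "sorted (map lev (act (grow ?s L)))" using srt by (simp add: sorted_foldr_insort)
  have inj': "inj_on fst ?D" using injD noL by (auto simp: inj_on_def)
  have e1: "\<exists>u. (u, m) \<in> ?D \<and> {u, v} \<in> ?E" if "(v, Suc m) \<in> ?D" for v m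
  proof (cases "(v, Suc m) \<in> D")
    case True
    then obtain u where "(u, m) \<in> D" "{u, v} \<in> E" using d1 by blast
    thus ?thesis by blast
  next
    case False
    hence "v \<in> set L" "m = lev C" using that by auto
    moreover have "u0 \<in> vs C" using u0 by (force simp: vs_def)
    ultimately show ?thesis using u0 C(3) newE[of u0 v] by blast
  qed
  have e2: "b \<le> Suc a" if uv: "(u, a) \<in> ?D" "(v, b) \<in> ?D" "{u, v} \<in> ?E" for u a v b
  proof -
    consider "{u, v} \<in> E" | "u \<in> set L" "v \<in> vs C" | "v \<in> set L" "u \<in> vs C" using uv(3) newE by blast
    thus ?thesis
    proof cases
      case 1
      hence "u \<notin> set L" "v \<notin> set L" using EV L by blast+
      thus ?thesis using uv d2 1 by blast
    next
      case 2
      hence "v \<notin> set L" using CD L by auto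
      hence "(v, b) \<in> D" "a = ?l" using uv 2 noL by auto
      thus ?thesis using Cb[of v b] 2 by auto
    next
      case 3
      hence "u \<notin> set L" using CD L by auto
      hence "(u, a) \<in> D" "b = ?l" using uv 3 noL by auto
      thus ?thesis using Cb[of u a] 3 by auto
    qed
  qed
  have e0: "(v, 0) \<in> ?D \<longleftrightarrow> v \<in> R" for v using d0[of v] by auto
  show ?thesis unfolding grow.simps
    by (rule invI[OF _ inj' k1[unfolded grow.simps] e0 e1 e2 cl'[unfolded grow.simps snd_conv]
          dist'[unfolded grow.simps snd_conv] srt'[unfolded grow.simps snd_conv]]) (use fin in simp_all)
qed

lemma degs_grow:
  assumes I: "exploration_inv k R (D, E, C # Q)" and k: "k \<ge> 1"
    and L: "distinct L" "set L \<inter> fst ` D = {}"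
    and dg: "degs \<Omega> k c (D, E, C # Q)" and c: "c = 1 \<or> Q = []" "c + length L \<in> \<Omega>"
  shows "degs \<Omega> k 1 (grow (D, E, C # Q) L)"
proof -
  let ?s = "(D, E, C # Q)" let ?G = "gr ?s"
  have kt: "ktree k ?G" and C: "distinct (map fst C)" "vs C \<in> cliques k ?G" 
    and dist: "distinct (map vs (C # Q))" using I unfolding exploration_inv_def by auto
  have s: "simple_graph ?G" "finite (fst ?G)" using ktree_simple[OF kt] by auto
  have Ld: "set L \<inter> fst ?G = {}" using L by (simp add: gr_def)
  have actv: "vs ` set (act (grow ?s L)) = {insert v (vs C - {u}) | v u. v \<in> set L \<and> u \<in> vs C} \<union> vs ` set Q"
    by (simp add: set_foldr_insort image_Un vs_kids[OF C(1)])
  have new: "F \<notin> cliques k ?G" if "F = insert v (vs C - {u})" "v \<in> set L" for F v u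
    using that Ld by (auto simp: cliques_iff)
  show ?thesis unfolding degs_def
  proof
    fix F assume "F \<in> cliques k (gr (grow ?s L))"
    hence "F \<in> cliques k ?G \<union> {insert v (vs C - {u}) | v u. v \<in> set L \<and> u \<in> vs C}"
      unfolding gr_grow using fronts_attach[OF s(1) Ld C(2) k] by simp
    then consider v u where "F = insert v (vs C - {u})" "v \<in> set L" "u \<in> vs C"
      | "F = vs C" | "F \<in> cliques k ?G" "F \<noteq> vs C" by blast
    thus "if F \<in> vs ` set (act (grow ?s L)) then card (nbrs (gr (grow ?s L)) F) = 1
      else card (nbrs (gr (grow ?s L)) F) \<in> \<Omega>"
    proof cases
      case 1
      thus ?thesis unfolding gr_grow actv using nbrs_attach_new[OF s(1) Ld C(2), of v u] by auto
    next
      case 2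
      have "F \<notin> vs ` set (act (grow ?s L))" unfolding actv 2 using new[of "vs C"] C(2) dist by auto
      moreover have "card (nbrs (gr (grow ?s L)) F) = card (nbrs ?G F) + card (set L)"
        unfolding gr_grow 2 nbrs_attach_self[OF s(1) Ld C(2)]
        by (rule card_Un_disjoint) (use s finite_nbrs Ld in \<open>auto simp: nbrs_def\<close>)
      moreover have "card (nbrs ?G F) = c" using dg C 2 unfolding degs_def by auto
      ultimately show ?thesis using c L by (simp add: distinct_card)
    next
      case 3
      have "nbrs (gr (grow ?s L)) F = nbrs ?G F"
        unfolding gr_grow by (rule nbrs_attach_other[OF s(1) Ld C(2) 3])
      moreover have "F \<in> vs ` set (act (grow ?s L)) \<longleftrightarrow> F \<in> vs ` set Q" unfolding actv using 3 new by blast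
      moreover have "if F \<in> vs ` set (C # Q) then card (nbrs ?G F) = c else card (nbrs ?G F) \<in> \<Omega>"
        using dg 3 unfolding degs_def by auto
      ultimately show ?thesis using c 3 by auto
    qed
  qed
qed

lemma nbrs_complete: "nbrs (K, complete_edges K) K = {}"
  by (auto simp: nbrs_def)

lemma degs_root:
  assumes "distinct rs" "length rs = k"
  shows "degs \<Omega> k 0 (root_state rs)"
proof -
  have g: "gr (root_state rs) = (set rs, complete_edges (set rs))"
    by (simp add: gr_def root_state_def image_image)
  have "vs (map (\<lambda>v. (v, 0::nat)) rs) = set rs" by (simp add: vs_def image_image)
  moreover have "cliques k (gr (root_state rs)) = {set rs}"
    unfolding g using assms distinct_card by (intro cliques_complete) auto
  ultimately show ?thesis unfolding degs_def g by (auto simp: root_state_def nbrs_complete)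
qed

section \<open>Every front-rooted k-tree is explored with total weight one\<close>

fun valid :: "'a state \<Rightarrow> 'a list list \<Rightarrow> bool" where
  "valid s [] \<longleftrightarrow> act s = []"
| "valid s (L # ls) \<longleftrightarrow> act s \<noteq> [] \<and> distinct L \<and> set L \<inter> fst ` fst s = {} \<and> valid (grow s L) ls"

text \<open>Later vertices are attached to fronts that are active now or created later, hence never to \<open>F\<close>.\<close>

lemma final_nbrs:
  assumes "valid s ls" "exploration_inv k R s" "k \<ge> 1" "F \<in> cliques k (gr s)" "F \<notin> vs ` set (act s)"
  shows "nbrs (gr (run s ls)) F = nbrs (gr s) F"
  using assms
proof (induction ls arbitrary: s)
  case (Cons L ls)
  obtain D E C Q where s: "s = (D, E, C # Q)" using Cons.prems(1)
    by (metis list.exhaust prod.collapse valid.simps(2))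
  have I: "exploration_inv k R (D, E, C # Q)" using Cons s by auto
  have L: "distinct L" "set L \<inter> fst ` D = {}" using Cons.prems s by auto
  have kt: "ktree k (gr s)" and C: "distinct (map fst C)" "vs C \<in> cliques k (gr s)" 
    using I s unfolding exploration_inv_def by auto
  have sg: "simple_graph (gr s)" using ktree_simple[OF kt] by auto
  have Ld: "set L \<inter> fst (gr s) = {}" using L s by (simp add: gr_def)
  have g: "gr (grow s L) = attach (gr s) (vs C) (set L)" using s gr_grow by metis
  have "F \<in> cliques k (gr (grow s L))" unfolding g using Cons.prems by (intro cliques_attach_mono)
  moreover have "F \<notin> vs ` set (act (grow s L))"
  proof -
    have "F \<inter> set L = {}" using Cons.prems(4) Ld by (auto simp: cliques_iff)
    hence "F \<notin> vs ` set (kids C L)" unfolding vs_kids[OF C(1)] by blast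
    thus ?thesis using Cons.prems(5) s by (auto simp: set_foldr_insort)
  qed
  moreover have "exploration_inv k R (grow s L)" unfolding s by (rule inv_grow[OF I Cons.prems(3) L])
  ultimately have "nbrs (gr (run (grow s L) ls)) F = nbrs (gr (grow s L)) F"
    using Cons by auto
  also have "\<dots> = nbrs (gr s) F" unfolding g
    by (rule nbrs_attach_other[OF sg Ld C(2)]) (use Cons.prems s in auto)
  finally show ?case by simp
qed auto

definition weight :: "nat set \<Rightarrow> nat \<Rightarrow> real" where
  "weight \<Omega> d = (if d \<in> \<Omega> then 1 / fact d else 0)"

definition completions :: "'a state \<Rightarrow> 'a graph \<Rightarrow> 'a list list set" where
  "completions s G = {ls. valid s ls \<and> gr (run s ls) = G}"

text \<open>A front other than the root front lies in one hedron before it is explored, hence the shift in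
  comparison with \<open>weight\<close>.\<close>

definition branch_weight :: "nat set \<Rightarrow> nat \<Rightarrow> real" where
  "branch_weight \<Omega> d = (if Suc d \<in> \<Omega> then 1 / fact d else 0)"

text \<open>An explored front receives no further neighbours, so in an exploration of \<open>G\<close> the new vertices at
  the first active front are exactly its common neighbours in \<open>G\<close> that have not been met; only their
  order is free.\<close>

lemma completions_Cons:
  assumes I: "exploration_inv k R (D, E, C # Q)" and k: "k \<ge> 1"
    and e: "ext k (gr (D, E, C # Q)) (vs ` set (C # Q)) G"
  defines "N \<equiv> nbrs G (vs C) - fst ` D"
  shows "completions (D, E, C # Q) G =
    (\<Union>L\<in>permutations_of_set N. (#) L ` completions (grow (D, E, C # Q) L) G)" (is "?A = ?B")
proof (intro equalityI subsetI)
  fix ls assume ls: "ls \<in> ?A"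
  hence v: "valid (D, E, C # Q) ls" "gr (run (D, E, C # Q) ls) = G" by (auto simp: completions_def)
  then obtain L ls' where ls': "ls = L # ls'" by (cases ls) auto
  let ?s = "(D, E, C # Q)"
  have L: "distinct L" "set L \<inter> fst ` D = {}" using v ls' by auto
  have kt: "ktree k (gr ?s)" and C: "distinct (map fst C)" "vs C \<in> cliques k (gr ?s)"
    and dist: "distinct (map vs (C # Q))" using I unfolding exploration_inv_def by auto
  have sg: "simple_graph (gr ?s)" using ktree_simple[OF kt] by auto
  have Ld: "set L \<inter> fst (gr ?s) = {}" using L by (simp add: gr_def)
  have "nbrs (gr (run (grow ?s L) ls')) (vs C) = nbrs (gr (grow ?s L)) (vs C)"
  proof (rule final_nbrs)
    show "valid (grow ?s L) ls'" using v ls' by auto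
    show "exploration_inv k R (grow ?s L)" by (rule inv_grow[OF I k L])
    show "vs C \<in> cliques k (gr (grow ?s L))" unfolding gr_grow using C by (intro cliques_attach_mono)
    have "vs C \<inter> set L = {}" using C(2) Ld by (auto simp: cliques_iff)
    hence "vs C \<notin> vs ` set (kids C L)" unfolding vs_kids[OF C(1)] by blast
    thus "vs C \<notin> vs ` set (act (grow ?s L))" using dist by (auto simp: set_foldr_insort)
  qed (rule k)
  hence "nbrs G (vs C) = nbrs (gr ?s) (vs C) \<union> set L"
    using v ls' gr_grow nbrs_attach_self[OF sg Ld C(2)] by (metis run_Cons)
  moreover have "nbrs (gr ?s) (vs C) \<subseteq> fst ` D" by (auto simp: nbrs_def gr_def)
  ultimately have "set L = N" using L unfolding N_def by auto
  thus "ls \<in> ?B" using v ls' L by (auto simp: completions_def permutations_of_set_def)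
next
  fix ls assume "ls \<in> ?B"
  thus "ls \<in> ?A" by (auto simp: completions_def permutations_of_set_def N_def)
qed

lemma ext_grow:
  assumes I: "exploration_inv k R (D, E, C # Q)" and k: "k \<ge> 1"
    and e: "ext k (gr (D, E, C # Q)) (vs ` set (C # Q)) G"
    and L: "L \<in> permutations_of_set (nbrs G (vs C) - fst ` D)"
  shows "ext k (gr (grow (D, E, C # Q) L)) (vs ` set (act (grow (D, E, C # Q) L))) G"
proof -
  let ?s = "(D, E, C # Q)"
  have kt: "ktree k (gr ?s)" and C: "distinct (map fst C)" "vs C \<in> cliques k (gr ?s)"
    and dist: "distinct (map vs (C # Q))" using I unfolding exploration_inv_def by auto
  have sg: "simple_graph (gr ?s)" using ktree_simple[OF kt] by auto
  have sL: "set L = nbrs G (vs C) - fst ` D" using L by (auto simp: permutations_of_set_def)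
  have V: "fst (gr ?s) = fst ` D" by (simp add: gr_def)
  have "ext k (attach (gr ?s) (vs C) (set L)) ((vs ` set (C # Q) - {vs C}) \<union>
      {insert v (vs C - {u}) | v u. v \<in> set L \<and> u \<in> vs C}) G"
    using ext_process[OF e sg C(2) k] unfolding V sL .
  moreover have "(vs ` set (C # Q) - {vs C}) = vs ` set Q" using dist by auto
  ultimately show ?thesis unfolding gr_grow by (simp add: set_foldr_insort image_Un vs_kids[OF C(1)] Un_commute)
qed

lemma new_nbrs_count:
  assumes I: "exploration_inv k R (D, E, C # Q)" and e: "ext k (gr (D, E, C # Q)) F G"
  shows "card (nbrs G (vs C)) = card (nbrs (gr (D, E, C # Q)) (vs C)) + card (nbrs G (vs C) - fst ` D)"
    "finite (nbrs G (vs C))"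
proof -
  let ?s = "(D, E, C # Q)"
  have kt: "ktree k (gr ?s)" and C: "vs C \<in> cliques k (gr ?s)" using I unfolding exploration_inv_def by auto
  have sg: "simple_graph (gr ?s)" "finite (fst (gr ?s))" using ktree_simple[OF kt] by auto
  have ind: "fst (gr ?s) \<subseteq> fst G" "\<And>x y. x \<in> fst (gr ?s) \<Longrightarrow> y \<in> fst (gr ?s) \<Longrightarrow> {x, y} \<in> snd G \<longleftrightarrow> {x, y} \<in> snd (gr ?s)"
    using ext_induced[OF e sg(1)] by auto
  have V: "fst (gr ?s) = fst ` D" by (simp add: gr_def)
  have "nbrs G (vs C) \<inter> fst ` D = nbrs (gr ?s) (vs C)"
    unfolding V[symmetric] nbrs_def using ind C by (auto simp: cliques_iff subset_iff)
  moreover have "finite (fst G)" using ext_finite[OF e sg(2)] .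
  ultimately show "card (nbrs G (vs C)) = card (nbrs (gr ?s) (vs C)) + card (nbrs G (vs C) - fst ` D)"
    "finite (nbrs G (vs C))"
    using card_Int_Diff[of "nbrs G (vs C)" "fst ` D"] finite_nbrs by metis+
qed

text \<open>At each front, the \<open>d\<close> new vertices are prescribed by \<open>G\<close> up to their \<open>d!\<close> orders, each of which
  carries the factor \<open>1 / d!\<close>.\<close>

lemma completions_weight:
  assumes "exploration_inv k R s" "k \<ge> 1" "degs \<Omega> k 1 s" "ext k (gr s) (vs ` set (act s)) G" "hedra_condition \<Omega> k G"
  shows "finite (completions s G) \<and>
    (\<Sum>ls\<in>completions s G. prod_list (map (\<lambda>L. branch_weight \<Omega> (length L)) ls)) = 1"
  using assms
proof (induction "Suc k * (card (fst G) - card (fst (gr s))) + length (act s)" arbitrary: s rule: less_induct)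
  case less
  show ?case
  proof (cases "act s")
    case Nil
    hence "G = gr s" using less.prems ext_no_fronts by (metis image_empty list.set(1))
    hence "completions s G = {[]}"
      using Nil unfolding completions_def by (auto, metis list.exhaust valid.simps(2))
    thus ?thesis by simp
  next
    case (Cons C Q)
    obtain D E where s: "s = (D, E, C # Q)" using Cons by (metis prod.collapse)
    let ?N = "nbrs G (vs C) - fst ` D"
    let ?w = "\<lambda>ls::'a list list. prod_list (map (\<lambda>L. branch_weight \<Omega> (length L)) ls)"
    have I: "exploration_inv k R (D, E, C # Q)" and k: "k \<ge> 1"
      and e: "ext k (gr (D, E, C # Q)) (vs ` set (C # Q)) G"
      using less.prems s by auto
    have kt: "ktree k (gr s)" and C: "vs C \<in> cliques k (gr s)" "length C = k" using I s unfolding exploration_inv_def by auto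
    have sg: "simple_graph (gr s)" "finite (fst (gr s))" using ktree_simple[OF kt] by auto
    have cN: "card (nbrs G (vs C)) = 1 + card ?N" "finite ?N"
      using new_nbrs_count[OF I e] less.prems(3) C s unfolding degs_def by auto
    have "vs C \<in> cliques k G"
      using cliques_induced[OF e, of "vs C" k] sg s C by (auto simp: cliques_iff)
    hence \<Omega>: "Suc (card ?N) \<in> \<Omega>" using less.prems(5) cN unfolding hedra_condition_iff by auto
    have IH: "finite (completions (grow s L) G) \<and> (\<Sum>ls\<in>completions (grow s L) G. ?w ls) = 1"
      if L: "L \<in> permutations_of_set ?N" for L
    proof (rule less.hyps)
      have L': "distinct L" "set L = ?N" "set L \<inter> fst ` D = {}" using L by (auto simp: permutations_of_set_def)
      show "exploration_inv k R (grow s L)" unfolding s by (rule inv_grow[OF I k L'(1,3)])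
      show "degs \<Omega> k 1 (grow s L)" unfolding s
        by (rule degs_grow[OF I k L'(1,3)]) (use less.prems s \<Omega> L' distinct_card[of L] in auto)
      show ee: "ext k (gr (grow s L)) (vs ` set (act (grow s L))) G" unfolding s by (rule ext_grow[OF I k e L])
      have V: "fst (gr (grow s L)) = fst ` D \<union> set L" unfolding s gr_grow by (simp add: gr_def)
      have fD: "finite D" using I by (simp add: exploration_inv_def)
      have c1: "card (fst (gr (grow s L))) = card (fst (gr s)) + length L"
        unfolding V using L' fD cN(2) distinct_card[OF L'(1)] by (subst card_Un_disjoint) (auto simp: s gr_def)
      have "simple_graph (gr (grow s L))"
        using \<open>exploration_inv k R (grow s L)\<close> ktree_simple unfolding exploration_inv_def by blast
      hence "card (fst (gr (grow s L))) \<le> card (fst G)"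
        using ext_induced[OF ee] ext_finite[OF e] sg s by (intro card_mono) auto
      then obtain r where r: "card (fst G) = card (fst (gr s)) + length L + r" using c1 by (metis le_Suc_ex)
      have "length (act (grow s L)) = k * length L + length Q"
        unfolding s using C by (simp add: length_foldr_insort length_kids)
      thus "Suc k * (card (fst G) - card (fst (gr (grow s L)))) + length (act (grow s L))
          < Suc k * (card (fst G) - card (fst (gr s))) + length (act s)"
        unfolding c1 r by (simp add: s algebra_simps)
    qed (use less.prems in auto)
    have cs: "completions s G = (\<Union>L\<in>permutations_of_set ?N. (#) L ` completions (grow s L) G)"
      unfolding s by (rule completions_Cons[OF I k e])
    have "(\<Sum>ls\<in>completions s G. ?w ls) =
        (\<Sum>L\<in>permutations_of_set ?N. \<Sum>ls\<in>(#) L ` completions (grow s L) G. ?w ls)"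
      unfolding cs by (rule sum.UNION_disjoint) (use IH cN in auto)
    also have "\<dots> = (\<Sum>L\<in>permutations_of_set ?N. 1 / fact (card ?N))"
    proof (rule sum.cong[OF refl])
      fix L assume L: "L \<in> permutations_of_set ?N"
      have lL: "length L = card ?N" using L distinct_card[of L] by (auto simp: permutations_of_set_def)
      have "(\<Sum>ls\<in>(#) L ` completions (grow s L) G. ?w ls) = (\<Sum>ls\<in>completions (grow s L) G. ?w (L # ls))"
        by (rule sum.reindex_cong[of "(#) L"]) auto
      also have "\<dots> = branch_weight \<Omega> (length L)" using IH[OF L] by (simp flip: sum_distrib_left)
      finally show "(\<Sum>ls\<in>(#) L ` completions (grow s L) G. ?w ls) = 1 / fact (card ?N)"
        using lL \<Omega> by (simp add: branch_weight_def)
    qed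
    also have "\<dots> = 1" using cN by (simp add: card_permutations_of_set)
    finally show ?thesis unfolding cs using IH cN by auto
  qed
qed

section \<open>Counting rooted k-trees by exploration words\<close>

text \<open>The word \<open>ds\<close> explores all fronts, starting with \<open>q\<close> active ones and never running out of them before
  its end.\<close>

fun complete_word :: "nat \<Rightarrow> nat \<Rightarrow> nat list \<Rightarrow> bool" where
  "complete_word k q [] \<longleftrightarrow> q = 0"
| "complete_word k q (d # ds) \<longleftrightarrow> q > 0 \<and> complete_word k (q - 1 + k * d) ds"

definition word_weight :: "nat set \<Rightarrow> nat list \<Rightarrow> real" where
  "word_weight \<Omega> ds = (case ds of [] \<Rightarrow> 1 | d # ds' \<Rightarrow>
     weight \<Omega> d * prod_list (map (branch_weight \<Omega>) ds'))"

lemma state_Cons_cases: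
  assumes "act s \<noteq> []"
  obtains D E C Q where "s = (D, E, C # Q)"
  using assms by (metis list.exhaust prod.collapse)

lemma act_grow_lengths:
  assumes "\<forall>C\<in>set (act s). length C = k" "act s \<noteq> []"
  shows "\<forall>C\<in>set (act (grow s L)). length C = k"
    and "length (act (grow s L)) = length (act s) - 1 + k * length L"
proof -
  obtain D E C Q where s: "s = (D, E, C # Q)" using state_Cons_cases[OF assms(2)] .
  show "\<forall>C\<in>set (act (grow s L)). length C = k"
    using assms s by (auto simp: set_foldr_insort set_kids)
  show "length (act (grow s L)) = length (act s) - 1 + k * length L"
    using assms s by (simp add: length_foldr_insort length_kids)
qed

lemma vertices_grow:
  "act s \<noteq> [] \<Longrightarrow> fst ` fst (grow s L) = fst ` fst s \<union> set L"
  by (erule state_Cons_cases) (simp add: image_Un image_image)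

lemma valid_iff:
  assumes "\<forall>C\<in>set (act s). length C = k"
  shows "valid s ls \<longleftrightarrow> complete_word k (length (act s)) (map length ls) \<and>
    distinct (concat ls) \<and> set (concat ls) \<inter> fst ` fst s = {}"
  using assms
proof (induction ls arbitrary: s)
  case (Cons L ls)
  show ?case
  proof (cases "act s = []")
    case False
    note g = act_grow_lengths[OF Cons.prems False, of L]
    show ?thesis using Cons.IH[OF g(1)] False vertices_grow[OF False, of L] unfolding g(2) by auto
  qed auto
qed auto

lemma vertices_run: "valid s ls \<Longrightarrow> fst ` fst (run s ls) = fst ` fst s \<union> set (concat ls)"
proof (induction ls arbitrary: s)
  case (Cons L ls)
  thus ?case using vertices_grow[of s L] by auto
qed auto

lemma gr_root_state: "gr (root_state rs) = (set rs, complete_edges (set rs))"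
  by (simp add: gr_def root_state_def image_image)

lemma vs_root: "vs (map (\<lambda>v. (v, 0::nat)) rs) = set rs"
  by (simp add: vs_def image_image)

lemma root_state_eq: "root_state rs = ((\<lambda>v. (v, 0)) ` set rs, complete_edges (set rs), [map (\<lambda>v. (v, 0)) rs])"
  by (simp add: root_state_def)

lemma inv_run:
  assumes "exploration_inv k R s" "valid s ls" "k \<ge> 1"
  shows "exploration_inv k R (run s ls) \<and> act (run s ls) = []"
  using assms
proof (induction ls arbitrary: s)
  case (Cons L ls)
  obtain D E C Q where s: "s = (D, E, C # Q)" using Cons.prems state_Cons_cases by (metis valid.simps(2))
  have "exploration_inv k R (grow s L)" unfolding s by (rule inv_grow) (use Cons.prems s in auto)
  thus ?case using Cons by auto
qed auto

lemma degs_run: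
  assumes "exploration_inv k R s" "valid s ls" "k \<ge> 1" "degs \<Omega> k 1 s" "\<forall>L\<in>set ls. Suc (length L) \<in> \<Omega>"
  shows "degs \<Omega> k 1 (run s ls)"
  using assms
proof (induction ls arbitrary: s)
  case (Cons L ls)
  obtain D E C Q where s: "s = (D, E, C # Q)" using Cons.prems state_Cons_cases by (metis valid.simps(2))
  have "exploration_inv k R (grow s L)" unfolding s by (rule inv_grow) (use Cons.prems s in auto)
  moreover have "degs \<Omega> k 1 (grow s L)" unfolding s
    by (rule degs_grow[where c = 1 and R = R]) (use Cons.prems s in auto)
  ultimately show ?case using Cons by auto
qed auto

lemma root_completions_weight:
  assumes G: "ktree k G" "hedra_condition \<Omega> k G" and k: "k \<ge> 1"
    and R: "R \<in> cliques k G" and rs: "rs \<in> permutations_of_set R"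
  shows "finite (completions (root_state rs) G) \<and>
    (\<Sum>ls\<in>completions (root_state rs) G. word_weight \<Omega> (map length ls)) = 1"
proof -
  let ?C = "map (\<lambda>v. (v, 0::nat)) rs"
  let ?N = "nbrs G (vs ?C) - fst ` (\<lambda>v. (v, 0::nat)) ` set rs"
  note s = root_state_eq[of rs]
  have rs': "distinct rs" "set rs = R" using rs by (auto simp: permutations_of_set_def)
  have lk: "length rs = k" using rs' R distinct_card[of rs] by (auto simp: cliques_iff)
  have I: "exploration_inv k (set rs) (root_state rs)" by (rule inv_root[OF rs'(1) lk])
  have e: "ext k (gr (root_state rs)) (vs ` set [?C]) G"
    unfolding gr_root_state using ktree_ext_front[OF G(1) k R] by (simp add: vs_root rs')
  have N: "?N = nbrs G R" by (auto simp: vs_root rs' nbrs_def image_image)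
  have fN: "finite (nbrs G R)" using ktree_simple[OF G(1)] finite_nbrs by blast
  have \<Omega>: "card (nbrs G R) \<in> \<Omega>" using G(2) R unfolding hedra_condition_iff by auto
  have cs: "completions (root_state rs) G =
      (\<Union>L\<in>permutations_of_set (nbrs G R). (#) L ` completions (grow (root_state rs) L) G)"
    using completions_Cons[OF I[unfolded s] k e[unfolded s]] unfolding N unfolding s .
  let ?w = "\<lambda>ls::'a list list. prod_list (map (\<lambda>L. branch_weight \<Omega> (length L)) ls)"
  have C: "finite (completions (grow (root_state rs) L) G) \<and> (\<Sum>ls\<in>completions (grow (root_state rs) L) G. ?w ls) = 1"
    if L: "L \<in> permutations_of_set (nbrs G R)" for L
  proof (rule completions_weight[OF _ k])
    have L': "distinct L" "set L \<inter> fst ` (\<lambda>v. (v, 0::nat)) ` set rs = {}" "length L = card (nbrs G R)"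
      using L N distinct_card[of L] by (auto simp: permutations_of_set_def)
    show "exploration_inv k (set rs) (grow (root_state rs) L)"
      unfolding s by (rule inv_grow[OF I[unfolded s] k L'(1,2)])
    show "degs \<Omega> k 1 (grow (root_state rs) L)"
      unfolding s by (rule degs_grow[OF I[unfolded s] k L'(1,2) degs_root[OF rs'(1) lk, unfolded s]])
        (use \<Omega> L' in auto)
    show "ext k (gr (grow (root_state rs) L)) (vs ` set (act (grow (root_state rs) L))) G"
      unfolding s by (rule ext_grow[OF I[unfolded s] k e[unfolded s]]) (use L N in simp)
  qed (rule G(2))
  have "(\<Sum>ls\<in>completions (root_state rs) G. word_weight \<Omega> (map length ls)) =
      (\<Sum>L\<in>permutations_of_set (nbrs G R). \<Sum>ls\<in>(#) L ` completions (grow (root_state rs) L) G. word_weight \<Omega> (map length ls))"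
    unfolding cs by (rule sum.UNION_disjoint) (use C fN in auto)
  also have "\<dots> = (\<Sum>L\<in>permutations_of_set (nbrs G R). 1 / fact (card (nbrs G R)))"
  proof (rule sum.cong[OF refl])
    fix L assume L: "L \<in> permutations_of_set (nbrs G R)"
    have lL: "length L = card (nbrs G R)" using L distinct_card[of L] by (auto simp: permutations_of_set_def)
    have "(\<Sum>ls\<in>(#) L ` completions (grow (root_state rs) L) G. word_weight \<Omega> (map length ls))
       = (\<Sum>ls\<in>completions (grow (root_state rs) L) G. weight \<Omega> (length L) * ?w ls)"
      by (rule sum.reindex_cong[of "(#) L"]) (auto simp: word_weight_def comp_def)
    also have "\<dots> = weight \<Omega> (length L)" using C[OF L] by (simp flip: sum_distrib_left)
    finally show "(\<Sum>ls\<in>(#) L ` completions (grow (root_state rs) L) G. word_weight \<Omega> (map length ls))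
        = 1 / fact (card (nbrs G R))"
      using lL \<Omega> by (simp add: weight_def)
  qed
  also have "\<dots> = 1" using fN by (simp add: card_permutations_of_set)
  finally show ?thesis unfolding cs using C fN by auto
qed

text \<open>A labelled word lists the root front and the new vertices at each explored front.\<close>

definition labelled_words :: "nat \<Rightarrow> nat \<Rightarrow> (nat list \<times> nat list list) set" where
  "labelled_words k n = {(rs, ls). length rs = k \<and> distinct (rs @ concat ls) \<and>
     set (rs @ concat ls) = {1..n + k} \<and> complete_word k 1 (map length ls)}"

definition word_graph :: "'a list \<times> 'a list list \<Rightarrow> 'a rooted_graph" where
  "word_graph w = (gr (run (root_state (fst w)) (snd w)), set (fst w))"

definition rooted_Omega_ktrees :: "nat set \<Rightarrow> nat \<Rightarrow> nat \<Rightarrow> nat rooted_graph set" where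
  "rooted_Omega_ktrees \<Omega> k n = Sigma (labelled_Omega_ktrees \<Omega> k n) (fronts k)"

lemma root_valid_iff:
  assumes "length rs = k" "distinct rs"
  shows "valid (root_state rs) ls \<longleftrightarrow> complete_word k 1 (map length ls) \<and> distinct (rs @ concat ls)"
proof -
  have "valid (root_state rs) ls \<longleftrightarrow> complete_word k (length (act (root_state rs))) (map length ls) \<and>
    distinct (concat ls) \<and> set (concat ls) \<inter> fst ` fst (root_state rs) = {}"
    by (rule valid_iff) (use assms in \<open>simp add: root_state_def\<close>)
  thus ?thesis using assms by (auto simp: root_state_def image_image)
qed

lemma labelled_words_iff:
  "(rs, ls) \<in> labelled_words k n \<longleftrightarrow> length rs = k \<and> distinct rs \<and> valid (root_state rs) ls \<and>
     fst (gr (run (root_state rs) ls)) = {1..n + k}"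
proof (cases "length rs = k \<and> distinct rs \<and> valid (root_state rs) ls")
  case True
  hence "fst ` fst (run (root_state rs) ls) = set (rs @ concat ls)"
    using vertices_run[of "root_state rs" ls] by (simp add: root_state_def image_image)
  thus ?thesis using True root_valid_iff[of rs k ls] unfolding labelled_words_def gr_def by auto
next
  case False
  thus ?thesis using root_valid_iff[of rs k ls] unfolding labelled_words_def by auto
qed

lemma word_graph_in:
  assumes w: "(rs, ls) \<in> labelled_words k n" and k: "k \<ge> 1"
    and ww: "word_weight \<Omega> (map length ls) \<noteq> 0"
  shows "word_graph (rs, ls) \<in> rooted_Omega_ktrees \<Omega> k n"
proof -
  let ?s = "root_state rs" let ?t = "run ?s ls"
  have rs: "length rs = k" "distinct rs" and v: "valid ?s ls" and V: "fst (gr ?t) = {1..n + k}"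
    using w by (auto simp: labelled_words_iff)
  have "complete_word k 1 (map length ls)" using v root_valid_iff[OF rs] by auto
  then obtain L ls' where ls: "ls = L # ls'" by (cases ls) auto
  have \<Omega>: "length L \<in> \<Omega>" "\<forall>L\<in>set ls'. Suc (length L) \<in> \<Omega>"
    using ww unfolding ls by (auto simp: word_weight_def weight_def branch_weight_def prod_list_zero_iff split: if_splits)
  have I: "exploration_inv k (set rs) ?s" by (rule inv_root[OF rs(2,1)])
  have L: "distinct L" "set L \<inter> fst ` fst ?s = {}" and v': "valid (grow ?s L) ls'" using v ls by auto
  have I': "exploration_inv k (set rs) (grow ?s L)"
    using I L unfolding root_state_eq by (intro inv_grow k) auto
  have "degs \<Omega> k 1 (grow ?s L)"
    using degs_grow[OF I[unfolded root_state_eq] k _ _ degs_root[OF rs(2,1), unfolded root_state_eq]] L \<Omega>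
    unfolding root_state_eq by auto
  hence dg: "degs \<Omega> k 1 ?t" using degs_run[OF I' v' k _ \<Omega>(2)] by (simp add: ls)
  have It: "exploration_inv k (set rs) ?t" "act ?t = []" using inv_run[OF I v k] by auto
  have kt: "ktree k (gr ?t)" using It by (simp add: exploration_inv_def)
  have hc: "hedra_condition \<Omega> k (gr ?t)"
    unfolding hedra_condition_iff using dg It finite_nbrs[OF conjunct2[OF ktree_simple[OF kt]]] unfolding degs_def by auto
  have "card (hedra k (gr ?t)) = n" using ktree_counts[OF kt k] V by simp
  moreover have "set rs \<in> cliques k (gr ?t)"
  proof -
    have mono: "F \<in> cliques k (gr s) \<Longrightarrow> valid s ls'' \<Longrightarrow> F \<in> cliques k (gr (run s ls''))" for F and s :: "nat state" and ls''
    proof (induction ls'' arbitrary: s)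
      case (Cons M ls'')
      obtain D E C Q where s: "s = (D, E, C # Q)" using Cons.prems state_Cons_cases by (metis valid.simps(2))
      have "F \<in> cliques k (gr (grow s M))" using Cons.prems unfolding s gr_grow by (intro cliques_attach_mono)
      thus ?case using Cons by auto
    qed auto
    have "set rs \<in> cliques k (gr ?s)" unfolding gr_root_state using rs distinct_card[of rs] by (simp add: cliques_complete)
    thus ?thesis using mono v by blast
  qed
  ultimately show ?thesis using kt hc V
    unfolding word_graph_def rooted_Omega_ktrees_def labelled_Omega_ktrees_def Omega_ktree_def by auto
qed

lemma finite_labelled_Omega_ktrees: "finite (labelled_Omega_ktrees \<Omega> k n)"
proof (rule finite_subset)
  show "labelled_Omega_ktrees \<Omega> k n \<subseteq> {{1..n + k}} \<times> Pow (Pow {1..n + k})"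
  proof
    fix G assume "G \<in> labelled_Omega_ktrees \<Omega> k n"
    hence "fst G = {1..n + k}" "ktree k G" by (auto simp: labelled_Omega_ktrees_def Omega_ktree_def)
    moreover from this have "simple_graph G" using ktree_simple by blast
    ultimately have "fst G = {1..n + k}" "simple_graph G" by auto
    thus "G \<in> {{1..n + k}} \<times> Pow (Pow {1..n + k})"
      by (cases G) (auto simp: simple_graph_def complete_edges_def)
  qed
qed auto

lemma finite_rooted_Omega_ktrees: "finite (rooted_Omega_ktrees \<Omega> k n)"
  unfolding rooted_Omega_ktrees_def
  by (intro finite_SigmaI finite_labelled_Omega_ktrees finite_cliques) (auto simp: labelled_Omega_ktrees_def)

lemma length_complete: "complete_word k q ds \<Longrightarrow> length ds = q + k * sum_list ds"
  by (induction ds arbitrary: q) (auto simp: algebra_simps)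

lemma finite_complete: "finite {ds. complete_word k q ds \<and> sum_list ds = m}"
proof (rule finite_subset)
  show "{ds. complete_word k q ds \<and> sum_list ds = m} \<subseteq> {ds. set ds \<subseteq> {..m} \<and> length ds = q + k * m}"
    using length_complete member_le_sum_list by fastforce
qed (rule finite_lists_length_eq, simp)

text \<open>The canonical labelling numbers the vertices in the order of their discovery.\<close>

fun labels :: "nat \<Rightarrow> nat list \<Rightarrow> nat list list" where
  "labels h [] = []"
| "labels h (d # ds) = [h..<h + d] # labels (h + d) ds"

lemma map_length_labels [simp]: "map length (labels h ds) = ds"
  by (induction ds arbitrary: h) auto

lemma concat_labels: "concat (labels h ds) = [h..<h + sum_list ds]"
proof (induction ds arbitrary: h)
  case (Cons d ds)
  show ?case using upt_add_eq_append[of h "h + d" "sum_list ds"] by (simp add: Cons add.assoc)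
qed simp

lemma labels_append: "labels h (ds @ es) = labels h ds @ labels (h + sum_list ds) es"
  by (induction ds arbitrary: h) (auto simp: add.assoc)

lemma lists_eq_map_labels:
  assumes "length zs = h + sum_list ds" "concat ls = drop h zs" "map length ls = ds"
  shows "ls = map (map (\<lambda>i. zs ! i)) (labels h ds)"
  using assms
proof (induction ds arbitrary: h ls)
  case (Cons d ds)
  then obtain L ls' where ls: "ls = L # ls'" "length L = d" "map length ls' = ds" by (cases ls) auto
  have "L @ concat ls' = drop h zs" using Cons.prems ls by simp
  hence L: "L = take d (drop h zs)" and c: "concat ls' = drop d (drop h zs)" using ls(2) by (auto simp: append_eq_conv_conj)
  have "L = map (\<lambda>i. zs ! i) [h..<h + d]"
    unfolding L using Cons.prems(1) by (intro nth_equalityI) auto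
  moreover have "ls' = map (map (\<lambda>i. zs ! i)) (labels (h + d) ds)"
    by (rule Cons.IH) (use Cons.prems ls c in \<open>auto simp: add.commute\<close>)
  ultimately show ?case by (simp add: ls)
qed auto

text \<open>Exploration commutes with renaming the vertices, because the order of the active fronts
  depends only on distances and on positions in lists.\<close>

definition relabel :: "('a \<Rightarrow> 'b) \<Rightarrow> 'a state \<Rightarrow> 'b state" where
  "relabel g s = (apfst g ` fst s, (`) g ` fst (snd s), map (map (apfst g)) (act s))"

lemma map_insort_key: 
  assumes "\<And>y. f' (h y) = f y"
  shows "map h (insort_key f x xs) = insort_key f' (h x) (map h xs)"
  by (induction xs) (simp_all add: assms)

lemma map_foldr_insort_key:
  assumes "\<And>y. f' (h y) = f y"
  shows "map h (foldr (insort_key f) xs ys) = foldr (insort_key f') (map h xs) (map h ys)"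
  by (induction xs) (simp_all add: map_insort_key[of f' h f] assms)

lemma lev_relabel: "lev (map (apfst g) C) = lev C"
  by (simp add: lev_def image_image)

lemma kids_relabel: "kids (map (apfst g) C) (map g L) = map (map (apfst g)) (kids C L)"
  by (simp add: kids_def map_concat comp_def lev_relabel map_update)

lemma vs_relabel: "vs (map (apfst g) C) = g ` vs C"
  by (simp add: vs_def image_image)

lemma grow_relabel: "grow (relabel g s) (map g L) = relabel g (grow s L)"
proof (cases "act s = []")
  case True
  thus ?thesis by (cases s) (auto simp: relabel_def)
next
  case False
  then obtain D E C Q where s: "s = (D, E, C # Q)" by (rule state_Cons_cases)
  have "(`) g ` {{v, u} | v u. v \<in> set L \<and> u \<in> vs C} = {{v, u} | v u. v \<in> g ` set L \<and> u \<in> g ` vs C}"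
    (is "?A = ?B")
  proof (intro equalityI subsetI)
    fix e assume "e \<in> ?A"
    thus "e \<in> ?B" by auto
  next
    fix e assume "e \<in> ?B"
    then obtain v u where "e = g ` {v, u}" "v \<in> set L" "u \<in> vs C" by auto
    thus "e \<in> ?A" by blast
  qed
  thus ?thesis unfolding s relabel_def
    by (simp add: image_Un image_image lev_relabel vs_relabel kids_relabel
        map_foldr_insort_key[where f' = lev and f = lev and h = "map (apfst g)"])
qed

lemma run_relabel: "run (relabel g s) (map (map g) ls) = relabel g (run s ls)"
  by (induction ls arbitrary: s) (auto simp: grow_relabel)

lemma complete_edges_image:
  assumes "inj_on g V" shows "complete_edges (g ` V) = (`) g ` complete_edges V"
proof (intro equalityI subsetI)
  fix e assume "e \<in> complete_edges (g ` V)"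
  then obtain u v where "u \<in> V" "v \<in> V" "g u \<noteq> g v" "e = {g u, g v}" unfolding complete_edges_def by blast
  hence "{u, v} \<in> complete_edges V" "e = g ` {u, v}" by (auto simp: edge_complete_iff)
  thus "e \<in> (`) g ` complete_edges V" by blast
next
  fix e assume "e \<in> (`) g ` complete_edges V"
  then obtain u v where "u \<in> V" "v \<in> V" "u \<noteq> v" "e = g ` {u, v}" unfolding complete_edges_def by blast
  moreover from this have "g u \<noteq> g v" using assms by (auto simp: inj_on_def)
  ultimately show "e \<in> complete_edges (g ` V)" by (auto simp: edge_complete_iff)
qed

lemma root_state_relabel: "inj_on g (set rs) \<Longrightarrow> root_state (map g rs) = relabel g (root_state rs)"
  by (simp add: root_state_def relabel_def image_image comp_def complete_edges_image)

definition canonical :: "nat \<Rightarrow> nat list \<Rightarrow> nat state" where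
  "canonical k ds = run (root_state [0..<k]) (labels k ds)"

lemma labelled_word_relabel:
  assumes w: "(rs, ls) \<in> labelled_words k n"
  defines "g \<equiv> (\<lambda>i. (rs @ concat ls) ! i)"
  shows "inj_on g {0..<n + k}" "run (root_state rs) ls = relabel g (canonical k (map length ls))"
    "set rs = g ` {0..<k}" "sum_list (map length ls) = n"
proof -
  let ?zs = "rs @ concat ls"
  have w': "length rs = k" "distinct ?zs" "set ?zs = {1..n + k}" using w by (auto simp: labelled_words_def)
  have l: "length ?zs = n + k" using w' distinct_card[of ?zs] by simp
  show sn: "sum_list (map length ls) = n" using l w' by (simp add: length_concat)
  show inj: "inj_on g {0..<n + k}" unfolding g_def using w'(2) l by (auto simp: inj_on_def nth_eq_iff_index_eq)
  have rs: "rs = map g [0..<k]" unfolding g_def using w' by (intro nth_equalityI) (auto simp: nth_append)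
  have "ls = map (map (\<lambda>i. ?zs ! i)) (labels k (map length ls))"
    by (rule lists_eq_map_labels) (use l sn w' in auto)
  hence ls: "ls = map (map g) (labels k (map length ls))" unfolding g_def .
  have "run (root_state rs) ls = run (relabel g (root_state [0..<k])) (map (map g) (labels k (map length ls)))"
    using rs ls root_state_relabel[of g "[0..<k]"] inj by (metis atLeastLessThan_iff inj_on_subset le_add2 less_le_trans set_upt subsetI)
  thus "run (root_state rs) ls = relabel g (canonical k (map length ls))" 
    unfolding canonical_def run_relabel .
  have "set rs = set (map g [0..<k])" using rs by argo
  thus "set rs = g ` {0..<k}" by simp
qed

section \<open>Balls around the root\<close>

definition metric :: "'a set \<Rightarrow> ('a \<times> nat) set \<Rightarrow> 'a set set \<Rightarrow> bool" where
  "metric R D E \<longleftrightarrow> inj_on fst D \<and> simple_graph (fst ` D, E) \<and> (\<forall>v. (v, 0) \<in> D \<longleftrightarrow> v \<in> R) \<and>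
     (\<forall>v m. (v, Suc m) \<in> D \<longrightarrow> (\<exists>u. (u, m) \<in> D \<and> {u, v} \<in> E)) \<and>
     (\<forall>u a v b. (u, a) \<in> D \<and> (v, b) \<in> D \<and> {u, v} \<in> E \<longrightarrow> b \<le> Suc a)"

lemma inv_metric: "exploration_inv k R s \<Longrightarrow> metric R (fst s) (fst (snd s))"
  unfolding exploration_inv_def metric_def using ktree_simple unfolding gr_def by blast

lemma graph_dist_le_iff:
  "graph_dist G u v \<le> enat l \<longleftrightarrow> (\<exists>m\<le>l. (u, v) \<in> {(x, y). {x, y} \<in> snd G} ^^ m)" (is "_ \<longleftrightarrow> ?R")
proof
  assume le: "graph_dist G u v \<le> enat l"
  show ?R
  proof (rule ccontr)
    assume "\<not> ?R"
    hence "enat (Suc l) \<le> graph_dist G u v"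
      unfolding graph_dist_def by (intro INF_greatest) (auto simp: not_le Suc_le_eq)
    hence "enat (Suc l) \<le> enat l" using le by (rule order_trans)
    thus False by simp
  qed
next
  assume ?R
  then obtain m where "m \<le> l" "(u, v) \<in> {(x, y). {x, y} \<in> snd G} ^^ m" by auto
  thus "graph_dist G u v \<le> enat l" unfolding graph_dist_def by (intro INF_lower2[of m]) auto
qed

text \<open>Distances grow by at most one along an edge, and a vertex at positive distance has a neighbour that
  is closer by one.\<close>

lemma metric_ball:
  assumes M: "metric R D E"
  shows "ball_vertices l ((fst ` D, E), R) = fst ` {p \<in> D. snd p \<le> l}"
proof -
  let ?r = "{(x, y). {x, y} \<in> E}"
  have sg: "simple_graph (fst ` D, E)" using M by (simp add: metric_def)
  have up: "(v, b) \<in> D \<Longrightarrow> b \<le> a + m" if "(u, v) \<in> ?r ^^ m" "(u, a) \<in> D" for u v m a b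
    using that
  proof (induction m arbitrary: v b)
    case 0
    have "inj_on fst D" using M by (simp add: metric_def)
    hence "(v, b) = (u, a)" using 0 by (intro inj_onD[of fst D]) auto
    thus ?case by simp
  next
    case (Suc m)
    then obtain w where w: "(u, w) \<in> ?r ^^ m" "{w, v} \<in> E" by auto
    then obtain c where c: "(w, c) \<in> D" using simple_edgeD[OF sg, of w v] by auto
    have "c \<le> a + m" using Suc.IH[OF c w(1) Suc.prems(3)] .
    moreover have "b \<le> Suc c" using M c Suc.prems w unfolding metric_def by blast
    ultimately show ?case by simp
  qed
  have down: "\<exists>u\<in>R. (u, v) \<in> ?r ^^ m" if "(v, m) \<in> D" for v m
    using that
  proof (induction m arbitrary: v)
    case 0
    thus ?case using M by (auto simp: metric_def)
  next
    case (Suc m)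
    then obtain w where w: "(w, m) \<in> D" "{w, v} \<in> E" using M unfolding metric_def by blast
    then obtain u where "u \<in> R" "(u, w) \<in> ?r ^^ m" using Suc.IH by blast
    thus ?case using w by (intro bexI[of _ u] relpow_Suc_I[of u w]) auto
  qed
  show ?thesis
  proof (intro equalityI subsetI)
    fix v assume "v \<in> ball_vertices l ((fst ` D, E), R)"
    then obtain u b m where v: "(v, b) \<in> D" "u \<in> R" "m \<le> l" "(u, v) \<in> ?r ^^ m"
      unfolding ball_vertices_def graph_dist_le_iff by auto
    hence "(u, 0) \<in> D" using M by (simp add: metric_def)
    hence "b \<le> l" using up[of u v m 0 b] v by auto
    thus "v \<in> fst ` {p \<in> D. snd p \<le> l}" using v(1) by force
  next
    fix v assume "v \<in> fst ` {p \<in> D. snd p \<le> l}"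
    then obtain b where "(v, b) \<in> D" "b \<le> l" by auto
    thus "v \<in> ball_vertices l ((fst ` D, E), R)"
      unfolding ball_vertices_def graph_dist_le_iff using down[of v b] by force
  qed
qed

lemma rooted_iso_sym:
  assumes "G \<simeq> H" "snd G \<subseteq> fst (fst G)" shows "H \<simeq> G"
proof -
  obtain f where f: "bij_betw f (fst (fst G)) (fst (fst H))" "f ` snd G = snd H"
    and e: "\<And>u v. u \<in> fst (fst G) \<Longrightarrow> v \<in> fst (fst G) \<Longrightarrow> {u, v} \<in> snd (fst G) \<longleftrightarrow> {f u, f v} \<in> snd (fst H)"
    using assms(1) unfolding rooted_iso_def by blast
  define g where "g = the_inv_into (fst (fst G)) f"
  have g: "bij_betw g (fst (fst H)) (fst (fst G))" unfolding g_def by (rule bij_betw_the_inv_into[OF f(1)])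
  have gf: "g (f u) = u" if "u \<in> fst (fst G)" for u
    unfolding g_def using f(1) that by (simp add: bij_betw_def the_inv_into_f_f)
  have fg: "f (g u) = u" if "u \<in> fst (fst H)" for u
    unfolding g_def using f(1) that by (simp add: bij_betw_def f_the_inv_into_f)
  have "g ` snd H = snd G" using gf assms(2) unfolding f(2)[symmetric] by (force simp: image_iff)
  moreover have "{u, v} \<in> snd (fst H) \<longleftrightarrow> {g u, g v} \<in> snd (fst G)" if "u \<in> fst (fst H)" "v \<in> fst (fst H)" for u v
    using e[of "g u" "g v"] fg that bij_betwE[OF g] by auto
  ultimately show ?thesis unfolding rooted_iso_def using g by blast
qed

lemma rooted_iso_trans:
  assumes "G \<simeq> H" "H \<simeq> K" shows "G \<simeq> K"
proof -
  obtain f where f: "bij_betw f (fst (fst G)) (fst (fst H))" "f ` snd G = snd H"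
    and e: "\<And>u v. u \<in> fst (fst G) \<Longrightarrow> v \<in> fst (fst G) \<Longrightarrow> {u, v} \<in> snd (fst G) \<longleftrightarrow> {f u, f v} \<in> snd (fst H)"
    using assms(1) unfolding rooted_iso_def by blast
  obtain g where g: "bij_betw g (fst (fst H)) (fst (fst K))" "g ` snd H = snd K"
    and e': "\<And>u v. u \<in> fst (fst H) \<Longrightarrow> v \<in> fst (fst H) \<Longrightarrow> {u, v} \<in> snd (fst H) \<longleftrightarrow> {g u, g v} \<in> snd (fst K)"
    using assms(2) unfolding rooted_iso_def by blast
  have "bij_betw (g \<circ> f) (fst (fst G)) (fst (fst K))" using f g bij_betw_trans by blast
  moreover have "(g \<circ> f) ` snd G = snd K" by (simp only: image_comp[symmetric] f g)
  moreover have "{u, v} \<in> snd (fst G) \<longleftrightarrow> {(g \<circ> f) u, (g \<circ> f) v} \<in> snd (fst K)"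
    if "u \<in> fst (fst G)" "v \<in> fst (fst G)" for u v
    using e[OF that] e'[of "f u" "f v"] that bij_betwE[OF f(1)] by auto
  ultimately show ?thesis unfolding rooted_iso_def by blast
qed

lemma doubleton_image_iff:
  assumes "inj_on g V" "\<forall>e\<in>E. e \<subseteq> V" "u \<in> V" "v \<in> V"
  shows "{g u, g v} \<in> (`) g ` E \<longleftrightarrow> {u, v} \<in> E"
proof
  assume "{g u, g v} \<in> (`) g ` E"
  then obtain e where e: "e \<in> E" "g ` {u, v} = g ` e" by auto
  hence "{u, v} = e" using inj_on_image_eq_iff[OF assms(1), of "{u, v}" e] assms by blast
  thus "{u, v} \<in> E" using e by simp
qed (metis image_empty image_eqI image_insert)

lemma metric_relabel:
  assumes M: "metric R D E" and g: "inj_on g (fst ` D)" and R: "R \<subseteq> fst ` D"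
  shows "metric (g ` R) (apfst g ` D) ((`) g ` E)"
proof -
  have sg: "simple_graph (fst ` D, E)" using M by (simp add: metric_def)
  have E: "\<forall>e\<in>E. e \<subseteq> fst ` D" using sg unfolding simple_graph_def complete_edges_def by auto
  have mem: "(g v, m) \<in> apfst g ` D \<longleftrightarrow> (v, m) \<in> D" if "v \<in> fst ` D" for v m
    using that g unfolding inj_on_def by (force simp: image_iff apfst_def map_prod_def)
  have V: "fst ` apfst g ` D = g ` fst ` D" by (simp add: image_image)
  have edge: "{g u, g v} \<in> (`) g ` E \<longleftrightarrow> {u, v} \<in> E" if "u \<in> fst ` D" "v \<in> fst ` D" for u v
    by (rule doubleton_image_iff[OF g E that])
  have 1: "inj_on fst (apfst g ` D)"
  proof (rule inj_onI)
    fix p q assume "p \<in> apfst g ` D" "q \<in> apfst g ` D" "fst p = fst q"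
    then obtain p' q' where pq: "p = apfst g p'" "q = apfst g q'" "p' \<in> D" "q' \<in> D" "g (fst p') = g (fst q')" by auto
    hence "fst p' = fst q'" using g by (auto simp: inj_on_def)
    thus "p = q" using pq M by (auto simp: metric_def inj_on_def)
  qed
  have 2: "simple_graph (fst ` apfst g ` D, (`) g ` E)"
    unfolding V simple_graph_def fst_conv snd_conv complete_edges_image[OF g]
    using sg unfolding simple_graph_def by auto
  have 3: "(v, 0) \<in> apfst g ` D \<longleftrightarrow> v \<in> g ` R" for v
  proof
    assume "(v, 0) \<in> apfst g ` D"
    then obtain w where "(w, 0) \<in> D" "v = g w" by auto
    thus "v \<in> g ` R" using M by (auto simp: metric_def)
  next
    assume "v \<in> g ` R"
    then obtain w where "w \<in> R" "v = g w" by auto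
    moreover from this have "(w, 0) \<in> D" using M by (auto simp: metric_def)
    ultimately show "(v, 0) \<in> apfst g ` D" by force
  qed
  have 4: "\<exists>u. (u, m) \<in> apfst g ` D \<and> {u, v} \<in> (`) g ` E" if vm: "(v, Suc m) \<in> apfst g ` D" for v m
  proof -
    obtain w where w: "(w, Suc m) \<in> D" "v = g w" using vm by auto
    then obtain u where u: "(u, m) \<in> D" "{u, w} \<in> E" using M unfolding metric_def by blast
    hence "u \<in> fst ` D" "w \<in> fst ` D" using w by force+
    thus ?thesis using u w edge[of u w] mem[of u m] by blast
  qed
  have 5: "b \<le> Suc a" if uv: "(u, a) \<in> apfst g ` D" "(v, b) \<in> apfst g ` D" "{u, v} \<in> (`) g ` E" for u a v b
  proof -
    obtain u' v' where u': "(u', a) \<in> D" "u = g u'" and v': "(v', b) \<in> D" "v = g v'" using uv by auto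
    have "u' \<in> fst ` D" "v' \<in> fst ` D" using u' v' by force+
    hence "{u', v'} \<in> E" using uv(3) edge u' v' by blast
    thus ?thesis using M u' v' unfolding metric_def by blast
  qed
  show ?thesis unfolding metric_def
    by (intro conjI allI impI 1 2 3 4) (assumption, elim conjE, erule (2) 5)
qed

lemma U_relabel:
  assumes M: "metric R D E" and g: "inj_on g (fst ` D)" and R: "R \<subseteq> fst ` D"
  shows "U l ((fst ` D, E), R) \<simeq> U l ((g ` fst ` D, (`) g ` E), g ` R)"
proof -
  let ?B = "fst ` {p \<in> D. snd p \<le> l}"
  have E: "\<forall>e\<in>E. e \<subseteq> fst ` D" using M unfolding metric_def simple_graph_def complete_edges_def by auto
  have "fst ` {p \<in> apfst g ` D. snd p \<le> l} = g ` ?B" by (force simp: image_iff)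
  hence b2: "ball_vertices l ((g ` fst ` D, (`) g ` E), g ` R) = g ` ?B"
    using metric_ball[OF metric_relabel[OF M g R], of l] by (simp add: image_image)
  have b1: "ball_vertices l ((fst ` D, E), R) = ?B" by (rule metric_ball[OF M])
  have sub: "?B \<subseteq> fst ` D" by auto
  have "bij_betw g ?B (g ` ?B)" using inj_on_subset[OF g sub] by (simp add: bij_betw_def)
  moreover have "{u, v} \<in> E \<and> {u, v} \<subseteq> ?B \<longleftrightarrow> {g u, g v} \<in> (`) g ` E \<and> {g u, g v} \<subseteq> g ` ?B"
    if "u \<in> ?B" "v \<in> ?B" for u v
    using doubleton_image_iff[OF g E, of u v] that sub by auto
  ultimately show ?thesis unfolding rooted_iso_def U_def b1 b2 by (intro exI[of _ g]) auto
qed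

section \<open>From labelled words to words of numbers\<close>

definition words :: "nat \<Rightarrow> nat \<Rightarrow> nat list set" where
  "words k n = {ds. complete_word k 1 ds \<and> sum_list ds = n}"

lemma finite_words: "finite (words k n)"
  unfolding words_def by (rule finite_complete)

text \<open>A labelled word is an arrangement of all labels that is cut into blocks of prescribed lengths.\<close>

lemma labelled_words_bij:
  "bij_betw (\<lambda>w. (map length (snd w), fst w @ concat (snd w))) (labelled_words k n)
     (words k n \<times> permutations_of_set {1..n + k})" (is "bij_betw ?b ?A ?B")
  unfolding bij_betw_def
proof (intro conjI equalityI subsetI)
  show "inj_on ?b ?A"
  proof (rule inj_onI)
    fix w w' assume w: "w \<in> ?A" "w' \<in> ?A" "?b w = ?b w'"
    obtain rs ls rs' ls' where ww: "w = (rs, ls)" "w' = (rs', ls')" by fastforce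
    have l: "length rs = k" "length rs' = k" using w ww by (auto simp: labelled_words_def)
    have e: "map length ls = map length ls'" "rs @ concat ls = rs' @ concat ls'" using w(3) ww by auto
    hence "rs = rs'" "concat ls = concat ls'" using l by auto
    moreover have "\<forall>(x, y)\<in>set (zip ls ls'). length x = length y"
    proof -
      have "length (ls ! i) = length (ls' ! i)" if "i < length ls" "i < length ls'" for i
        using e(1) that by (metis nth_map)
      thus ?thesis by (auto simp: in_set_zip)
    qed
    moreover have "length ls = length ls'" using e(1) by (rule map_eq_imp_length_eq)
    ultimately show "w = w'" using ww concat_injective[of ls ls'] by simp
  qed
next
  fix x assume "x \<in> ?b ` ?A"
  then obtain rs ls where w: "(rs, ls) \<in> ?A" "x = ?b (rs, ls)" by auto
  thus "x \<in> ?B" using labelled_word_relabel(4)[OF w(1)]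
    by (auto simp: labelled_words_def words_def permutations_of_set_def)
next
  fix x assume "x \<in> ?B"
  then obtain ds xs where x: "x = (ds, xs)" "complete_word k 1 ds" "sum_list ds = n" "distinct xs" "set xs = {1..n + k}"
    by (auto simp: words_def permutations_of_set_def)
  have l: "length xs = n + k" using x distinct_card[of xs] by simp
  define g where "g = (\<lambda>i. xs ! i)"
  define ls where "ls = map (map g) (labels k ds)"
  have lm: "map length ls = ds" unfolding ls_def by (simp add: comp_def)
  have "map g ([0..<k] @ [k..<k + n]) = xs"
    unfolding g_def using l by (intro nth_equalityI) (auto simp: nth_append)
  moreover have "concat ls = map g [k..<k + n]"
    unfolding ls_def using concat_labels[of k ds] x(3) by (simp flip: map_concat)
  ultimately have c: "map g [0..<k] @ concat ls = xs" by simp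
  have m: "(map g [0..<k], ls) \<in> ?A" unfolding labelled_words_def
    by (simp only: mem_Collect_eq case_prod_conv c lm) (use x in simp)
  have "x = ?b (map g [0..<k], ls)" by (simp only: c lm x fst_conv snd_conv)
  thus "x \<in> ?b ` ?A" by (rule image_eqI[OF _ m])
qed

lemma finite_labelled_words: "finite (labelled_words k n)"
  using bij_betw_finite[OF labelled_words_bij[of k n]] finite_words by simp

text \<open>Double counting: the labelled words of a given rooted k-tree have total weight one for each of the
  \<open>k!\<close> orders of its root front.\<close>

lemma rooted_count_labelled:
  fixes P :: "nat rooted_graph \<Rightarrow> bool"
  assumes k: "k \<ge> 1"
  shows "fact k * real (card {x \<in> rooted_Omega_ktrees \<Omega> k n. P x}) =
    (\<Sum>w | w \<in> labelled_words k n \<and> P (word_graph w). word_weight \<Omega> (map length (snd w)))"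
proof -
  let ?ww = "\<lambda>w::nat list \<times> nat list list. word_weight \<Omega> (map length (snd w))"
  let ?S = "{w \<in> labelled_words k n. ?ww w \<noteq> 0 \<and> P (word_graph w)}"
  let ?T = "{x \<in> rooted_Omega_ktrees \<Omega> k n. P x}"
  have fib: "(\<Sum>w | w \<in> ?S \<and> word_graph w = x. ?ww w) = fact k" if x: "x \<in> ?T" for x
  proof -
    obtain G R where GR: "x = (G, R)" by (rule prod.exhaust)
    have G: "ktree k G" "hedra_condition \<Omega> k G" "fst G = {1..n + k}" "R \<in> cliques k G"
      using x GR by (auto simp: rooted_Omega_ktrees_def labelled_Omega_ktrees_def Omega_ktree_def)
    have fR: "finite R" "card R = k" using G(4) by (auto simp: cliques_iff)
    have eq: "{w \<in> labelled_words k n. word_graph w = x} =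
       Sigma (permutations_of_set R) (\<lambda>rs. completions (root_state rs) G)"
    proof (intro equalityI subsetI)
      fix w assume "w \<in> {w \<in> labelled_words k n. word_graph w = x}"
      thus "w \<in> Sigma (permutations_of_set R) (\<lambda>rs. completions (root_state rs) G)"
        by (cases w) (auto simp: labelled_words_iff word_graph_def GR permutations_of_set_def completions_def)
    next
      fix w assume "w \<in> Sigma (permutations_of_set R) (\<lambda>rs. completions (root_state rs) G)"
      then obtain rs ls where w: "w = (rs, ls)" "distinct rs" "set rs = R" "ls \<in> completions (root_state rs) G"
        by (auto simp: permutations_of_set_def)
      have "length rs = k" using w fR distinct_card[of rs] by simp
      thus "w \<in> {w \<in> labelled_words k n. word_graph w = x}"
        using w G by (auto simp: labelled_words_iff word_graph_def GR completions_def)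
    qed
    have "(\<Sum>w | w \<in> ?S \<and> word_graph w = x. ?ww w) = (\<Sum>w | w \<in> labelled_words k n \<and> word_graph w = x. ?ww w)"
      by (rule sum.mono_neutral_left) (use finite_labelled_words x in auto)
    also have "\<dots> = (\<Sum>rs\<in>permutations_of_set R. \<Sum>ls\<in>completions (root_state rs) G. word_weight \<Omega> (map length ls))"
      unfolding eq using root_completions_weight[OF G(1,2) k G(4)] fR
      by (subst sum.Sigma) (auto simp: case_prod_unfold)
    also have "\<dots> = (\<Sum>rs\<in>permutations_of_set R. 1)"
      using root_completions_weight[OF G(1,2) k G(4)] by (intro sum.cong) auto
    also have "\<dots> = fact k" using fR by simp
    finally show ?thesis .
  qed
  have "word_graph w \<in> ?T" if "w \<in> ?S" for w
    using that word_graph_in[of "fst w" "snd w" k n \<Omega>] k by auto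
  hence sub: "word_graph ` ?S \<subseteq> ?T" by blast
  have "fact k * real (card ?T) = (\<Sum>x\<in>?T. fact k)" by simp
  also have "\<dots> = (\<Sum>x\<in>?T. \<Sum>w | w \<in> ?S \<and> word_graph w = x. ?ww w)" using fib by (intro sum.cong) auto
  also have "\<dots> = (\<Sum>w\<in>?S. ?ww w)"
    by (rule sum.group) (use finite_labelled_words finite_rooted_Omega_ktrees sub in auto)
  also have "\<dots> = (\<Sum>w | w \<in> labelled_words k n \<and> P (word_graph w). ?ww w)"
    by (rule sum.mono_neutral_left) (use finite_labelled_words in auto)
  finally show ?thesis .
qed

section \<open>The canonical exploration\<close>

definition root_graph :: "nat \<Rightarrow> nat list \<Rightarrow> nat rooted_graph" where
  "root_graph k ds = (gr (canonical k ds), {0..<k})"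

lemma canonical_Nil: "canonical k [] = root_state [0..<k]"
  by (simp add: canonical_def)

lemma canonical_snoc:
  "canonical k (ds @ [d]) = grow (canonical k ds) [k + sum_list ds..<k + sum_list ds + d]"
  by (simp add: canonical_def labels_append run_append)

lemma grow_stuck: "act s = [] \<Longrightarrow> grow s L = s"
  by (cases s) auto

lemma inv_canonical:
  assumes "k \<ge> 1"
  shows "exploration_inv k {0..<k} (canonical k ds) \<and> fst ` fst (canonical k ds) \<subseteq> {0..<k + sum_list ds}"
proof (induction ds rule: rev_induct)
  case Nil
  have "exploration_inv k (set [0..<k]) (root_state [0..<k])" by (rule inv_root) auto
  thus ?case by (simp add: canonical_Nil root_state_def image_image)
next
  case (snoc d ds)
  show ?case
  proof (cases "act (canonical k ds) = []")
    case True
    thus ?thesis using snoc unfolding canonical_snoc grow_stuck[OF True] by auto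
  next
    case False
    let ?L = "[k + sum_list ds..<k + sum_list ds + d]"
    obtain D E C Q where s: "canonical k ds = (D, E, C # Q)" using state_Cons_cases[OF False] .
    have "exploration_inv k {0..<k} (grow (canonical k ds) ?L)"
      unfolding s by (rule inv_grow) (use snoc s assms in auto)
    moreover have "fst ` fst (grow (canonical k ds) ?L) = fst ` fst (canonical k ds) \<union> set ?L"
      by (rule vertices_grow[OF False])
    ultimately show ?thesis unfolding canonical_snoc using snoc by auto
  qed
qed

lemma length_act_snoc:
  assumes "k \<ge> 1"
  shows "length (act (canonical k (ds @ [d]))) = (if act (canonical k ds) = [] then 0
    else length (act (canonical k ds)) - 1 + k * d)"
proof (cases "act (canonical k ds) = []")
  case True
  thus ?thesis by (simp add: canonical_snoc grow_stuck)
next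
  case False
  have "\<forall>C\<in>set (act (canonical k ds)). length C = k" using inv_canonical[OF assms, of ds] by (auto simp: exploration_inv_def)
  thus ?thesis using act_grow_lengths(2)[OF _ False, of k "[k + sum_list ds..<k + sum_list ds + d]"] False
    by (simp add: canonical_snoc)
qed

lemma metric_canonical:
  "k \<ge> 1 \<Longrightarrow> metric {0..<k} (fst (canonical k ds)) (fst (snd (canonical k ds)))"
  using inv_canonical inv_metric by blast

lemma root_sub:
  assumes "k \<ge> 1" shows "{0..<k} \<subseteq> fst ` fst (canonical k ds)"
proof
  fix v assume "v \<in> {0..<k}"
  hence "(v, 0) \<in> fst (canonical k ds)" using metric_canonical[OF assms, of ds] by (simp add: metric_def)
  thus "v \<in> fst ` fst (canonical k ds)" by force
qed

lemma rooted_iso_cong_left: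
  assumes "G \<simeq> H" "snd G \<subseteq> fst (fst G)"
  shows "H \<simeq> X \<longleftrightarrow> G \<simeq> X"
proof
  show "G \<simeq> X" if "H \<simeq> X" by (rule rooted_iso_trans[OF assms(1) that])
  show "H \<simeq> X" if "G \<simeq> X" by (rule rooted_iso_trans[OF rooted_iso_sym[OF assms] that])
qed

lemma word_graph_U:
  assumes w: "w \<in> labelled_words k n" and k: "k \<ge> 1"
  shows "U l (word_graph w) \<simeq> X \<longleftrightarrow> U l (root_graph k (map length (snd w))) \<simeq> X"
proof (cases w)
  case (Pair rs ls)
  define g where "g = (\<lambda>i. (rs @ concat ls) ! i)"
  let ?c = "canonical k (map length ls)"
  note r = labelled_word_relabel[OF w[unfolded Pair], folded g_def]
  note M = metric_canonical[OF k, of "map length ls"]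
  have V: "fst ` fst ?c \<subseteq> {0..<n + k}" using inv_canonical[OF k, of "map length ls"] r(4) by (simp add: add.commute)
  have "U l ((fst ` fst ?c, fst (snd ?c)), {0..<k}) \<simeq> U l ((g ` fst ` fst ?c, (`) g ` fst (snd ?c)), g ` {0..<k})"
    by (rule U_relabel[OF M inj_on_subset[OF r(1) V] root_sub[OF k]])
  hence "U l (root_graph k (map length ls)) \<simeq> U l (word_graph w)"
    unfolding root_graph_def word_graph_def Pair gr_def using r(2,3)
    by (simp add: relabel_def image_image)
  moreover have "{0..<k} \<subseteq> ball_vertices l (root_graph k (map length ls))"
  proof
    fix v assume "v \<in> {0..<k}"
    hence "(v, 0) \<in> fst ?c" using M by (simp add: metric_def)
    thus "v \<in> ball_vertices l (root_graph k (map length ls))"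
      unfolding root_graph_def gr_def metric_ball[OF M] by force
  qed
  ultimately show ?thesis unfolding Pair snd_conv
    by (intro rooted_iso_cong_left) (auto simp: U_def root_graph_def)
qed

lemma rooted_count:
  assumes k: "k \<ge> 1"
  shows "fact k * real (card {x \<in> rooted_Omega_ktrees \<Omega> k n. U l x \<simeq> X}) =
    fact (n + k) * (\<Sum>ds | ds \<in> words k n \<and> U l (root_graph k ds) \<simeq> X. word_weight \<Omega> ds)"
proof -
  let ?b = "\<lambda>w::nat list \<times> nat list list. (map length (snd w), fst w @ concat (snd w))"
  let ?h = "\<lambda>ds. if U l (root_graph k ds) \<simeq> X then word_weight \<Omega> ds else 0"
  have "fact k * real (card {x \<in> rooted_Omega_ktrees \<Omega> k n. U l x \<simeq> X}) =
      (\<Sum>w | w \<in> labelled_words k n \<and> U l (word_graph w) \<simeq> X. word_weight \<Omega> (map length (snd w)))"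
    by (rule rooted_count_labelled[OF k])
  also have "\<dots> = (\<Sum>w\<in>labelled_words k n. ?h (fst (?b w)))"
  proof (rule sum.mono_neutral_cong_left[OF finite_labelled_words])
    show "\<forall>w\<in>labelled_words k n - {w. w \<in> labelled_words k n \<and> U l (word_graph w) \<simeq> X}. ?h (fst (?b w)) = 0"
    proof
      fix w assume w: "w \<in> labelled_words k n - {w. w \<in> labelled_words k n \<and> U l (word_graph w) \<simeq> X}"
      hence "w \<in> labelled_words k n" by simp
      from word_graph_U[OF this k, of l X] w show "?h (fst (?b w)) = 0" by simp
    qed
    fix w assume w: "w \<in> {w. w \<in> labelled_words k n \<and> U l (word_graph w) \<simeq> X}"
    hence "w \<in> labelled_words k n" by simp
    from word_graph_U[OF this k, of l X] w show "word_weight \<Omega> (map length (snd w)) = ?h (fst (?b w))" by simp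
  qed auto
  also have "\<dots> = (\<Sum>p\<in>words k n \<times> permutations_of_set {1..n + k}. ?h (fst p))"
    by (rule sum.reindex_bij_betw[OF labelled_words_bij])
  also have "\<dots> = (\<Sum>ds\<in>words k n. \<Sum>xs\<in>permutations_of_set {1..n + k}. ?h ds)"
    by (subst sum.cartesian_product) (simp add: case_prod_unfold)
  also have "\<dots> = fact (n + k) * (\<Sum>ds\<in>words k n. ?h ds)"
    by (simp add: sum_distrib_left)
  also have "(\<Sum>ds\<in>words k n. ?h ds) = (\<Sum>ds | ds \<in> words k n \<and> U l (root_graph k ds) \<simeq> X. word_weight \<Omega> ds)"
    using finite_words by (intro sum.mono_neutral_cong_right) auto
  finally show ?thesis .
qed

definition total_weight :: "nat set \<Rightarrow> nat \<Rightarrow> nat \<Rightarrow> real" where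
  "total_weight \<Omega> k n = (\<Sum>ds\<in>words k n. word_weight \<Omega> ds)"

lemma rooted_count_total:
  assumes k: "k \<ge> 1"
  shows "fact k * real (card (rooted_Omega_ktrees \<Omega> k n)) = fact (n + k) * total_weight \<Omega> k n"
proof -
  let ?b = "\<lambda>w::nat list \<times> nat list list. (map length (snd w), fst w @ concat (snd w))"
  have "fact k * real (card (rooted_Omega_ktrees \<Omega> k n)) =
      (\<Sum>w\<in>labelled_words k n. word_weight \<Omega> (map length (snd w)))"
    using rooted_count_labelled[OF k, of \<Omega> n "\<lambda>_. True"] by simp
  also have "\<dots> = (\<Sum>w\<in>labelled_words k n. word_weight \<Omega> (fst (?b w)))" by simp
  also have "\<dots> = (\<Sum>p\<in>words k n \<times> permutations_of_set {1..n + k}. word_weight \<Omega> (fst p))"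
    by (rule sum.reindex_bij_betw[OF labelled_words_bij])
  also have "\<dots> = (\<Sum>ds\<in>words k n. \<Sum>xs\<in>permutations_of_set {1..n + k}. word_weight \<Omega> ds)"
    by (subst sum.cartesian_product) (simp add: case_prod_unfold)
  also have "\<dots> = fact (n + k) * total_weight \<Omega> k n"
    by (simp add: sum_distrib_left total_weight_def)
  finally show ?thesis .
qed

lemma rooted_prob:
  assumes k: "k \<ge> 1" and ne: "labelled_Omega_ktrees \<Omega> k n \<noteq> {}"
  shows "total_weight \<Omega> k n > 0"
    and "measure_pmf.prob (random_rooted_Omega_ktree \<Omega> k n) {H. U l H \<simeq> X} =
     (\<Sum>ds | ds \<in> words k n \<and> U l (root_graph k ds) \<simeq> X. word_weight \<Omega> ds) / total_weight \<Omega> k n"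
proof -
  let ?L = "labelled_Omega_ktrees \<Omega> k n" and ?S = "rooted_Omega_ktrees \<Omega> k n"
  let ?A = "{H. U l H \<simeq> X}"
  have fL: "finite ?L" by (rule finite_labelled_Omega_ktrees)
  have fr: "finite (fronts k G)" "card (fronts k G) = k * n + 1" if "G \<in> ?L" for G
  proof -
    have "ktree k G" "card (hedra k G) = n" using that by (auto simp: labelled_Omega_ktrees_def Omega_ktree_def)
    thus "finite (fronts k G)" "card (fronts k G) = k * n + 1"
      using ktree_counts[of k G] k ktree_simple[of k G] finite_cliques[of G k] by auto
  qed
  have frne: "fronts k G \<noteq> {}" if "G \<in> ?L" for G using fr(2)[OF that] by force
  have cS: "card ?S = card ?L * (k * n + 1)"
    unfolding rooted_Omega_ktrees_def using fL fr by (subst card_SigmaI) auto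
  hence "card ?S > 0" using ne fL by (simp add: card_gt_0_iff)
  moreover have "fact (n + k) * total_weight \<Omega> k n = fact k * real (card ?S)" using rooted_count_total[OF k] by simp
  ultimately show pos: "total_weight \<Omega> k n > 0"
    by (metis fact_gt_zero mult_pos_pos of_nat_0_less_iff zero_less_mult_pos)
  have "measure_pmf.prob (random_rooted_Omega_ktree \<Omega> k n) ?A =
     measure_pmf.expectation (random_rooted_Omega_ktree \<Omega> k n) (indicator ?A)" by simp
  also have "\<dots> = (\<Sum>G\<in>?L. measure_pmf.expectation (map_pmf (\<lambda>R. (G, R)) (pmf_of_set (fronts k G))) (indicator ?A) /\<^sub>R real (card ?L))"
    unfolding random_rooted_Omega_ktree_def
    by (rule pmf_expectation_bind_pmf_of_set[OF ne fL]) (use fr frne in \<open>auto simp: set_pmf_of_set\<close>)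
  also have "\<dots> = (\<Sum>G\<in>?L. real (card {R \<in> fronts k G. U l (G, R) \<simeq> X}) / real (card ?S))"
  proof (rule sum.cong[OF refl])
    fix G assume G: "G \<in> ?L"
    have "measure_pmf.expectation (map_pmf (\<lambda>R. (G, R)) (pmf_of_set (fronts k G))) (indicator ?A :: _ \<Rightarrow> real)
      = measure_pmf.prob (pmf_of_set (fronts k G)) ((\<lambda>R. (G, R)) -` ?A)" by simp
    also have "\<dots> = real (card (fronts k G \<inter> (\<lambda>R. (G, R)) -` ?A)) / real (card (fronts k G))"
      by (rule measure_pmf_of_set[OF frne[OF G] fr(1)[OF G]])
    also have "fronts k G \<inter> (\<lambda>R. (G, R)) -` ?A = {R \<in> fronts k G. U l (G, R) \<simeq> X}" by auto
    finally have e: "measure_pmf.expectation (map_pmf (\<lambda>R. (G, R)) (pmf_of_set (fronts k G))) (indicator ?A :: _ \<Rightarrow> real)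
      = real (card {R \<in> fronts k G. U l (G, R) \<simeq> X}) / real (card (fronts k G))" .
    show "measure_pmf.expectation (map_pmf (\<lambda>R. (G, R)) (pmf_of_set (fronts k G))) (indicator ?A) /\<^sub>R real (card ?L)
       = real (card {R \<in> fronts k G. U l (G, R) \<simeq> X}) / real (card ?S)"
      unfolding e cS fr(2)[OF G]
      by (simp only: real_scaleR_def divide_inverse of_nat_mult inverse_mult_distrib mult_ac)
  qed
  also have "\<dots> = real (card {x \<in> ?S. U l x \<simeq> X}) / real (card ?S)"
  proof -
    have e: "{x \<in> ?S. U l x \<simeq> X} = Sigma ?L (\<lambda>G. {R \<in> fronts k G. U l (G, R) \<simeq> X})"
      unfolding rooted_Omega_ktrees_def by auto
    have "card {x \<in> ?S. U l x \<simeq> X} = (\<Sum>G\<in>?L. card {R \<in> fronts k G. U l (G, R) \<simeq> X})"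
      unfolding e using fL fr by (subst card_SigmaI) auto
    thus ?thesis by (simp add: sum_divide_distrib)
  qed
  also have "\<dots> = (fact k * real (card {x \<in> ?S. U l x \<simeq> X})) / (fact k * real (card ?S))" by simp
  also have "\<dots> = (\<Sum>ds | ds \<in> words k n \<and> U l (root_graph k ds) \<simeq> X. word_weight \<Omega> ds) / total_weight \<Omega> k n"
    unfolding rooted_count[OF k] rooted_count_total[OF k] by simp
  finally show "measure_pmf.prob (random_rooted_Omega_ktree \<Omega> k n) ?A =
     (\<Sum>ds | ds \<in> words k n \<and> U l (root_graph k ds) \<simeq> X. word_weight \<Omega> ds) / total_weight \<Omega> k n" .
qed

section \<open>Completed levels\<close>

text \<open>From such a state on, all new vertices have distance more than \<open>l\<close> from the root, so the ball of
  radius \<open>l\<close> does not change.\<close>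

definition stopped :: "nat \<Rightarrow> 'a state \<Rightarrow> bool" where
  "stopped l s \<longleftrightarrow> (\<forall>C\<in>set (act s). l \<le> lev C)"

lemma lev_kid:
  assumes "C' \<in> set (kids C L)" shows "lev C \<le> lev C'"
proof -
  obtain v i where C': "C' = C[i := (v, Suc (lev C))]" "i < length C" using assms by (auto simp: set_kids)
  hence "C' \<noteq> []" by auto
  then obtain u where u: "(u, lev C') \<in> set C'" using lev_attained by blast
  have "set C' \<subseteq> insert (v, Suc (lev C)) (set C)" unfolding C' by (rule set_update_subset_insert)
  hence "(u, lev C') = (v, Suc (lev C)) \<or> (u, lev C') \<in> set C" using u by blast
  thus ?thesis using lev_le[of u "lev C'" C] by auto
qed

text \<open>A new front contains vertices of the explored front and a vertex that is farther away, so it is not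
  closer to the root.\<close>

lemma stopped_grow:
  assumes "stopped l s" shows "stopped l (grow s L)"
proof (cases "act s = []")
  case True thus ?thesis using assms grow_stuck by metis
next
  case False
  then obtain D E C Q where s: "s = (D, E, C # Q)" by (rule state_Cons_cases)
  show ?thesis using assms lev_kid[of _ C L] unfolding s stopped_def
    by (auto simp: set_foldr_insort intro: order_trans)
qed

lemma grow_extends:
  assumes "set L \<inter> fst ` fst s = {}" "simple_graph (gr s)"
  shows "fst s \<subseteq> fst (grow s L)"
    and "{e \<in> fst (snd (grow s L)). e \<subseteq> fst ` fst s} = {e \<in> fst (snd s). e \<subseteq> fst ` fst s}"
    and "fst (snd s) \<subseteq> fst (snd (grow s L))"
    and "stopped l s \<Longrightarrow> p \<in> fst (grow s L) \<Longrightarrow> p \<in> fst s \<or> l < snd p"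
proof -
  have "fst s \<subseteq> fst (grow s L) \<and> {e \<in> fst (snd (grow s L)). e \<subseteq> fst ` fst s} = {e \<in> fst (snd s). e \<subseteq> fst ` fst s}
    \<and> fst (snd s) \<subseteq> fst (snd (grow s L)) \<and> (stopped l s \<longrightarrow> p \<in> fst (grow s L) \<longrightarrow> p \<in> fst s \<or> l < snd p)"
  proof (cases "act s = []")
    case False
    then obtain D E C Q where s: "s = (D, E, C # Q)" by (rule state_Cons_cases)
    show ?thesis using assms unfolding s stopped_def by auto
  qed (auto simp: grow_stuck)
  thus "fst s \<subseteq> fst (grow s L)"
    and "{e \<in> fst (snd (grow s L)). e \<subseteq> fst ` fst s} = {e \<in> fst (snd s). e \<subseteq> fst ` fst s}"
    and "fst (snd s) \<subseteq> fst (snd (grow s L))"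
    and "stopped l s \<Longrightarrow> p \<in> fst (grow s L) \<Longrightarrow> p \<in> fst s \<or> l < snd p" by auto
qed

lemma restrict_trans:
  assumes "A \<subseteq> B" "{e \<in> E2. e \<subseteq> B} = {e \<in> E1. e \<subseteq> B}" "{e \<in> E1. e \<subseteq> A} = {e \<in> E0. e \<subseteq> A}"
  shows "{e \<in> E2. e \<subseteq> A} = {e \<in> E0. e \<subseteq> A}"
proof -
  have "{e \<in> E2. e \<subseteq> A} = {e \<in> {e \<in> E2. e \<subseteq> B}. e \<subseteq> A}" using assms(1) by auto
  also have "\<dots> = {e \<in> E1. e \<subseteq> A}" unfolding assms(2) using assms(1) by auto
  finally show ?thesis using assms(3) by simp
qed

lemma canonical_extends:
  assumes k: "k \<ge> 1"
  shows "fst (canonical k ds) \<subseteq> fst (canonical k (ds @ es))"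
    and "{e \<in> fst (snd (canonical k (ds @ es))). e \<subseteq> fst ` fst (canonical k ds)} =
         {e \<in> fst (snd (canonical k ds)). e \<subseteq> fst ` fst (canonical k ds)}"
    and "fst (snd (canonical k ds)) \<subseteq> fst (snd (canonical k (ds @ es)))"
    and "stopped l (canonical k ds) \<Longrightarrow> stopped l (canonical k (ds @ es))"
    and "stopped l (canonical k ds) \<Longrightarrow> p \<in> fst (canonical k (ds @ es)) \<Longrightarrow> p \<in> fst (canonical k ds) \<or> l < snd p"
proof -
  let ?c = "canonical k"
  have "fst (?c ds) \<subseteq> fst (?c (ds @ es)) \<and>
    {e \<in> fst (snd (?c (ds @ es))). e \<subseteq> fst ` fst (?c ds)} = {e \<in> fst (snd (?c ds)). e \<subseteq> fst ` fst (?c ds)} \<and>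
    fst (snd (?c ds)) \<subseteq> fst (snd (?c (ds @ es))) \<and>
    (stopped l (?c ds) \<longrightarrow> stopped l (?c (ds @ es)) \<and> (p \<in> fst (?c (ds @ es)) \<longrightarrow> p \<in> fst (?c ds) \<or> l < snd p))"
  proof (induction es rule: rev_induct)
    case (snoc d es)
    let ?L = "[k + sum_list (ds @ es)..<k + sum_list (ds @ es) + d]"
    have c: "?c (ds @ es @ [d]) = grow (?c (ds @ es)) ?L" using canonical_snoc[of k "ds @ es" d] by simp
    have "ktree k (gr (?c (ds @ es)))" using inv_canonical[OF k, of "ds @ es"] by (simp add: exploration_inv_def)
    hence sg: "simple_graph (gr (?c (ds @ es)))" using ktree_simple by blast
    have "fst ` fst (?c (ds @ es)) \<subseteq> {0..<k + sum_list (ds @ es)}" using inv_canonical[OF k, of "ds @ es"] by blast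
    hence fresh: "set ?L \<inter> fst ` fst (?c (ds @ es)) = {}" by fastforce
    note g = grow_extends[OF fresh sg]
    have 1: "fst (?c ds) \<subseteq> fst (?c (ds @ es @ [d]))" using snoc g(1) unfolding c by blast
    have 3: "fst (snd (?c ds)) \<subseteq> fst (snd (?c (ds @ es @ [d])))" using snoc g(3) unfolding c by blast
    have "fst ` fst (?c ds) \<subseteq> fst ` fst (?c (ds @ es))" using snoc by blast
    hence 2: "{e \<in> fst (snd (?c (ds @ es @ [d]))). e \<subseteq> fst ` fst (?c ds)} = {e \<in> fst (snd (?c ds)). e \<subseteq> fst ` fst (?c ds)}"
      by (rule restrict_trans[OF _ g(2)[folded c]]) (use snoc in simp)
    have 4: "stopped l (?c ds) \<longrightarrow> stopped l (?c (ds @ es @ [d])) \<and> (p \<in> fst (?c (ds @ es @ [d])) \<longrightarrow> p \<in> fst (?c ds) \<or> l < snd p)"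
    proof (intro impI conjI)
      assume st: "stopped l (?c ds)"
      hence st': "stopped l (?c (ds @ es))" using snoc by simp
      show "stopped l (?c (ds @ es @ [d]))" unfolding c by (rule stopped_grow[OF st'])
      assume "p \<in> fst (?c (ds @ es @ [d]))"
      hence "p \<in> fst (?c (ds @ es)) \<or> l < snd p" unfolding c by (rule g(4)[OF st'])
      thus "p \<in> fst (?c ds) \<or> l < snd p" using snoc st by blast
    qed
    show ?case using 1 2 3 4 by blast
  qed auto
  thus "fst (?c ds) \<subseteq> fst (?c (ds @ es))"
    and "{e \<in> fst (snd (?c (ds @ es))). e \<subseteq> fst ` fst (?c ds)} = {e \<in> fst (snd (?c ds)). e \<subseteq> fst ` fst (?c ds)}"
    and "fst (snd (?c ds)) \<subseteq> fst (snd (?c (ds @ es)))"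
    and "stopped l (?c ds) \<Longrightarrow> stopped l (?c (ds @ es))"
    and "stopped l (?c ds) \<Longrightarrow> p \<in> fst (?c (ds @ es)) \<Longrightarrow> p \<in> fst (?c ds) \<or> l < snd p" by auto
qed

lemma U_agree:
  assumes M: "metric R D E" "metric R D' E'" and DD: "D \<subseteq> D'"
    and l: "\<And>p. p \<in> D' \<Longrightarrow> p \<in> D \<or> l < snd p"
    and E: "{e \<in> E'. e \<subseteq> fst ` D} = {e \<in> E. e \<subseteq> fst ` D}"
  shows "U l ((fst ` D', E'), R) = U l ((fst ` D, E), R)"
proof -
  have "{p \<in> D'. snd p \<le> l} = {p \<in> D. snd p \<le> l}" using DD l by fastforce
  hence b: "ball_vertices l ((fst ` D', E'), R) = ball_vertices l ((fst ` D, E), R)"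
    unfolding metric_ball[OF M(1)] metric_ball[OF M(2)] by simp
  have "ball_vertices l ((fst ` D, E), R) \<subseteq> fst ` D" unfolding metric_ball[OF M(1)] by auto
  hence "{e \<in> E'. e \<subseteq> ball_vertices l ((fst ` D, E), R)} = {e \<in> E. e \<subseteq> ball_vertices l ((fst ` D, E), R)}"
    using E by blast
  thus ?thesis unfolding U_def b by simp
qed

lemma U_root_graph_append:
  assumes k: "k \<ge> 1" and st: "stopped l (canonical k ds)"
  shows "U l (root_graph k (ds @ es)) = U l (root_graph k ds)"
  unfolding root_graph_def gr_def
  by (rule U_agree[OF metric_canonical[OF k] metric_canonical[OF k] canonical_extends(1)[OF k]
        canonical_extends(5)[OF k st] canonical_extends(2)[OF k]])

section \<open>Weights of completions\<close>

definition branch_fps :: "nat set \<Rightarrow> real fps" where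
  "branch_fps \<Omega> = Abs_fps (branch_weight \<Omega>)"

lemma branch_weight_nonneg [simp]: "branch_weight \<Omega> d \<ge> 0"
  by (simp add: branch_weight_def)

lemma word_weight_nonneg: "word_weight \<Omega> p \<ge> 0"
proof -
  have "prod_list (map (branch_weight \<Omega>) ds) \<ge> 0" for ds by (induction ds) auto
  thus ?thesis by (cases p) (auto simp: word_weight_def weight_def)
qed

lemma fps_power_nonneg:
  fixes f :: "real fps"
  assumes "\<And>i. fps_nth f i \<ge> 0" shows "fps_nth (f ^ n) m \<ge> 0"
proof (induction n arbitrary: m)
  case (Suc n)
  thus ?case using assms by (auto simp: fps_mult_nth intro!: sum_nonneg)
qed simp

lemma branch_nth [simp]: "fps_nth (branch_fps \<Omega>) d = branch_weight \<Omega> d"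
  by (simp add: branch_fps_def)

lemma branch_power_nonneg [simp]: "fps_nth (branch_fps \<Omega> ^ n) m \<ge> 0"
  by (rule fps_power_nonneg) simp

lemma infinite_radius_if_le_fact:
  fixes f :: "real fps"
  assumes "\<And>d. \<bar>fps_nth f d\<bar> \<le> 1 / fact d"
  shows "fps_conv_radius f = \<infinity>"
  unfolding fps_conv_radius_def
proof (rule conv_radius_inftyI'')
  fix z :: real
  have "summable (\<lambda>n. \<bar>z\<bar> ^ n /\<^sub>R fact n)" by (rule sums_summable[OF exp_converges])
  thus "summable (\<lambda>n. fps_nth f n * z ^ n)"
  proof (rule summable_comparison_test'[where N = 0])
    fix n
    have "\<bar>fps_nth f n\<bar> * \<bar>z\<bar> ^ n \<le> 1 / fact n * \<bar>z\<bar> ^ n" by (intro mult_right_mono assms) simp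
    thus "norm (fps_nth f n * z ^ n) \<le> \<bar>z\<bar> ^ n /\<^sub>R fact n"
      by (simp add: abs_mult power_abs divide_simps)
  qed
qed

lemma branch_radius [simp]: "fps_conv_radius (branch_fps \<Omega>) = \<infinity>"
  by (rule infinite_radius_if_le_fact) (simp add: branch_weight_def)

lemma branch_power_sums:
  "(\<lambda>m. fps_nth (branch_fps \<Omega> ^ n) m * x ^ m) sums (eval_fps (branch_fps \<Omega>) x ^ n)"
proof -
  have "fps_conv_radius (branch_fps \<Omega> ^ n) = \<infinity>"
    using fps_conv_radius_power[of "branch_fps \<Omega>" n] by simp
  hence "(\<lambda>m. fps_nth (branch_fps \<Omega> ^ n) m * x ^ m) sums eval_fps (branch_fps \<Omega> ^ n) x"
    by (intro sums_eval_fps) simp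
  thus ?thesis by (simp add: eval_fps_power)
qed

text \<open>The cycle lemma in analytic form: the total weight of the forests with \<open>q\<close> active fronts and
  \<open>m\<close> further hedra is the fraction \<open>q / (q + k m)\<close> of the total weight of all sequences of
  \<open>q + k m\<close> numbers with sum \<open>m\<close>.\<close>

definition forest_weight :: "nat set \<Rightarrow> nat \<Rightarrow> nat \<Rightarrow> nat \<Rightarrow> real" where
  "forest_weight \<Omega> k q m = (if q = 0 then (if m = 0 then 1 else 0)
     else real q / real (q + k * m) * fps_nth (branch_fps \<Omega> ^ (q + k * m)) m)"

text \<open>This compares coefficients in \<open>(\<phi>^N)' = N \<phi>' \<phi>^(N - 1)\<close>.\<close>

lemma weighted_convolution:
  assumes "N \<ge> 1"
  shows "(\<Sum>d\<le>m. real d * branch_weight \<Omega> d * fps_nth (branch_fps \<Omega> ^ (N - 1)) (m - d))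
    = real m / real N * fps_nth (branch_fps \<Omega> ^ N) m"
proof (cases m)
  case (Suc m')
  let ?f = "branch_fps \<Omega>"
  have "real m * fps_nth (?f ^ N) m = fps_nth (fps_deriv (?f ^ N)) m'" using Suc by simp
  also have "\<dots> = real N * fps_nth (fps_deriv ?f * ?f ^ (N - 1)) m'"
    by (simp add: fps_deriv_power mult.assoc)
  also have "fps_nth (fps_deriv ?f * ?f ^ (N - 1)) m' =
      (\<Sum>d=0..m'. real (Suc d) * branch_weight \<Omega> (Suc d) * fps_nth (?f ^ (N - 1)) (m' - d))"
    by (simp add: fps_mult_nth)
  also have "\<dots> = (\<Sum>d\<le>m. real d * branch_weight \<Omega> d * fps_nth (?f ^ (N - 1)) (m - d))"
    unfolding Suc sum.atMost_Suc_shift by (simp add: atLeast0AtMost)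
  finally show ?thesis using assms by (simp add: field_simps)
qed simp

lemma convolution:
  assumes "N \<ge> 1"
  shows "(\<Sum>d\<le>m. branch_weight \<Omega> d * fps_nth (branch_fps \<Omega> ^ (N - 1)) (m - d)) = fps_nth (branch_fps \<Omega> ^ N) m"
proof -
  have "branch_fps \<Omega> ^ N = branch_fps \<Omega> * branch_fps \<Omega> ^ (N - 1)" using assms by (cases N) auto
  thus ?thesis by (simp add: fps_mult_nth atLeast0AtMost)
qed

text \<open>With \<open>N = q + k m\<close>, the sum over the value at the first active front is
  \<open>((q - 1) + k (m / N)) / (N - 1)\<close> times the coefficient of \<open>\<phi>^N\<close>, by the two convolution identities, and
  this factor equals \<open>q / N\<close>.\<close>

lemma forest_weight_rec:
  assumes "q > 0"
  shows "forest_weight \<Omega> k q m = (\<Sum>d\<le>m. branch_weight \<Omega> d * forest_weight \<Omega> k (q - 1 + k * d) (m - d))"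
proof -
  let ?N = "q + k * m" let ?c = "\<lambda>N m. fps_nth (branch_fps \<Omega> ^ N) m"
  show ?thesis
  proof (cases "?N = 1")
    case True
    hence q: "q = 1" and km: "k * m = 0" using assms by linarith+
    show ?thesis
    proof (cases "m = 0")
      case True thus ?thesis using q by (simp add: forest_weight_def)
    next
      case False
      hence k0: "k = 0" using km by (metis mult_eq_0_iff)
      have "(\<Sum>d\<le>m. branch_weight \<Omega> d * forest_weight \<Omega> k (q - 1 + k * d) (m - d)) = (\<Sum>d\<le>m. if d = m then branch_weight \<Omega> d else 0)"
        by (intro sum.cong) (auto simp: forest_weight_def q k0)
      also have "\<dots> = branch_weight \<Omega> m" by (simp add: sum.delta)
      finally show ?thesis by (simp add: forest_weight_def q k0)
    qed
  next
    case False
    hence N: "?N \<ge> 2" using assms by simp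
    hence N1: "?N \<ge> 1" by simp
    have e: "forest_weight \<Omega> k (q - 1 + k * d) (m - d) =
       (real (q - 1) + real k * real d) / (real ?N - 1) * ?c (?N - 1) (m - d)" if "d \<le> m" for d
    proof -
      obtain r where r: "m = d + r" using \<open>d \<le> m\<close> by (metis le_Suc_ex)
      have n: "(q - 1 + k * d) + k * (m - d) = ?N - 1" using assms unfolding r by (simp add: algebra_simps)
      have rn: "real (?N - 1) = real ?N - 1" using N by simp
      show ?thesis
      proof (cases "q - 1 + k * d = 0")
        case True
        hence "real (q - 1) + real k * real d = 0" by (metis of_nat_0 of_nat_add of_nat_mult)
        moreover have "m - d \<noteq> 0" using True n N by auto
        ultimately show ?thesis using True by (simp add: forest_weight_def)
      next
        case False
        hence "forest_weight \<Omega> k (q - 1 + k * d) (m - d) =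
            real (q - 1 + k * d) / real (?N - 1) * ?c (?N - 1) (m - d)"
          by (simp only: forest_weight_def if_False n)
        thus ?thesis by (simp only: rn of_nat_add of_nat_mult)
      qed
    qed
    have "(\<Sum>d\<le>m. branch_weight \<Omega> d * forest_weight \<Omega> k (q - 1 + k * d) (m - d))
       = (\<Sum>d\<le>m. branch_weight \<Omega> d * ((real (q - 1) + real k * real d) / (real ?N - 1) * ?c (?N - 1) (m - d)))"
      using e by (intro sum.cong) auto
    also have "\<dots> = (\<Sum>d\<le>m. real (q - 1) / (real ?N - 1) * (branch_weight \<Omega> d * ?c (?N - 1) (m - d)) +
        real k / (real ?N - 1) * (real d * branch_weight \<Omega> d * ?c (?N - 1) (m - d)))"
      by (intro sum.cong refl) (simp add: divide_inverse algebra_simps)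
    also have "\<dots> = real (q - 1) / (real ?N - 1) * ?c ?N m + real k / (real ?N - 1) * (real m / real ?N * ?c ?N m)"
      unfolding sum.distrib sum_distrib_left[symmetric] convolution[OF N1] weighted_convolution[OF N1] ..
    also have "\<dots> = (real (q - 1) / (real ?N - 1) + real k / (real ?N - 1) * (real m / real ?N)) * ?c ?N m"
      by (simp add: algebra_simps)
    also have "real (q - 1) / (real ?N - 1) + real k / (real ?N - 1) * (real m / real ?N) = real q / real ?N"
    proof -
      define n where "n = real ?N"
      have "2 \<le> n" unfolding n_def using of_nat_mono[OF N, where ?'a = real] by (simp only: of_nat_numeral)
      hence n: "n > 1" "real k * real m = n - real q" by (auto simp: n_def)
      have "real (q - 1) / (n - 1) + real k / (n - 1) * (real m / n) = ((real q - 1) * n + real k * real m) / ((n - 1) * n)"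
      proof -
        have gen: "A / (n - 1) + K / (n - 1) * (M / n) = (A * n + K * M) / ((n - 1) * n)" for A K M
          using n(1) by (simp add: add_divide_distrib)
        have "real (q - 1) = real q - 1" using assms by (simp add: of_nat_diff)
        thus ?thesis by (simp only: gen)
      qed
      also have "\<dots> = real q * (n - 1) / ((n - 1) * n)" unfolding n(2) by (simp add: algebra_simps)
      also have "\<dots> = real q / n" using n by simp
      finally show ?thesis unfolding n_def .
    qed
    finally show ?thesis using assms by (simp add: forest_weight_def)
  qed
qed

lemma forest_weight_sum:
  assumes "k \<ge> 1"
  shows "(\<Sum>ds | complete_word k q ds \<and> sum_list ds = m. prod_list (map (branch_weight \<Omega>) ds)) = forest_weight \<Omega> k q m"
proof (induction "q + k * m" arbitrary: q m rule: less_induct)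
  case less
  show ?case
  proof (cases "q = 0")
    case True
    have eq: "complete_word k q ds \<longleftrightarrow> ds = []" for ds using True by (cases ds) auto
    have "{ds. complete_word k q ds \<and> sum_list ds = m} = (if m = 0 then {[]} else {})" unfolding eq by auto
    thus ?thesis using True by (simp add: forest_weight_def)
  next
    case False
    let ?S = "\<lambda>q m. {ds. complete_word k q ds \<and> sum_list ds = m}"
    let ?w = "\<lambda>ds. prod_list (map (branch_weight \<Omega>) ds)"
    have un: "?S q m = (\<Union>d\<in>{..m}. (#) d ` ?S (q - 1 + k * d) (m - d))"
    proof (intro equalityI subsetI)
      fix ds assume "ds \<in> ?S q m"
      then obtain d es where "ds = d # es" "complete_word k (q - 1 + k * d) es" "d + sum_list es = m"
        using False by (cases ds) auto
      thus "ds \<in> (\<Union>d\<in>{..m}. (#) d ` ?S (q - 1 + k * d) (m - d))" by (intro UN_I[of d] imageI) auto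
    next
      fix ds assume "ds \<in> (\<Union>d\<in>{..m}. (#) d ` ?S (q - 1 + k * d) (m - d))"
      thus "ds \<in> ?S q m" using False by auto
    qed
    have "(\<Sum>ds\<in>?S q m. ?w ds) = (\<Sum>d\<le>m. \<Sum>ds\<in>(#) d ` ?S (q - 1 + k * d) (m - d). ?w ds)"
      unfolding un by (rule sum.UNION_disjoint) (auto simp: finite_complete)
    also have "\<dots> = (\<Sum>d\<le>m. branch_weight \<Omega> d * forest_weight \<Omega> k (q - 1 + k * d) (m - d))"
    proof (rule sum.cong[OF refl])
      fix d assume d: "d \<in> {..m}"
      then obtain r where r: "m = d + r" by (metis atMost_iff le_Suc_ex)
      have "(\<Sum>ds\<in>(#) d ` ?S (q - 1 + k * d) (m - d). ?w ds) = (\<Sum>ds\<in>?S (q - 1 + k * d) (m - d). branch_weight \<Omega> d * ?w ds)"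
        by (rule sum.reindex_cong[of "(#) d"]) auto
      also have "\<dots> = branch_weight \<Omega> d * (\<Sum>ds\<in>?S (q - 1 + k * d) (m - d). ?w ds)"
        by (simp add: sum_distrib_left)
      also have "(\<Sum>ds\<in>?S (q - 1 + k * d) (m - d). ?w ds) = forest_weight \<Omega> k (q - 1 + k * d) (m - d)"
        by (rule less) (use False r in \<open>simp add: algebra_simps\<close>)
      finally show "(\<Sum>ds\<in>(#) d ` ?S (q - 1 + k * d) (m - d). ?w ds) = branch_weight \<Omega> d * forest_weight \<Omega> k (q - 1 + k * d) (m - d)" .
    qed
    finally show ?thesis using forest_weight_rec[of q \<Omega> k m] False by simp
  qed
qed

fun legal :: "nat \<Rightarrow> nat \<Rightarrow> nat list \<Rightarrow> bool" where
  "legal k q [] \<longleftrightarrow> True"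
| "legal k q (d # ds) \<longleftrightarrow> q > 0 \<and> legal k (q - 1 + k * d) ds"

fun after :: "nat \<Rightarrow> nat \<Rightarrow> nat list \<Rightarrow> nat" where
  "after k q [] = q"
| "after k q (d # ds) = after k (q - 1 + k * d) ds"

lemma complete_append: "complete_word k q (ds @ es) \<longleftrightarrow> legal k q ds \<and> complete_word k (after k q ds) es"
  by (induction ds arbitrary: q) auto

lemma legal_append: "legal k q (ds @ es) \<longleftrightarrow> legal k q ds \<and> legal k (after k q ds) es"
  by (induction ds arbitrary: q) auto

lemma after_append: "after k q (ds @ es) = after k (after k q ds) es"
  by (induction ds arbitrary: q) auto

lemma legal_after: "legal k q ds \<Longrightarrow> after k q ds + length ds = q + k * sum_list ds"
proof (induction ds arbitrary: q)
  case (Cons d ds)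
  obtain q' where q: "q = Suc q'" using Cons.prems by (cases q) auto
  have "after k (q' + k * d) ds + length ds = (q' + k * d) + k * sum_list ds"
    using Cons.IH[of "q' + k * d"] Cons.prems q by simp
  thus ?case using q by (simp add: algebra_simps)
qed simp

lemma length_act_canonical:
  assumes "k \<ge> 1" "legal k 1 ds"
  shows "length (act (canonical k ds)) = after k 1 ds"
  using assms(2)
proof (induction ds rule: rev_induct)
  case Nil
  show ?case by (simp add: canonical_Nil root_state_def)
next
  case (snoc d ds)
  hence l: "legal k 1 ds" "after k 1 ds > 0" by (auto simp: legal_append)
  thus ?case using snoc length_act_snoc[OF assms(1), of ds d] by (auto simp: after_append)
qed

lemma word_weight_append: "p \<noteq> [] \<Longrightarrow> word_weight \<Omega> (p @ es) = word_weight \<Omega> p * prod_list (map (branch_weight \<Omega>) es)"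
  by (cases p) (auto simp: word_weight_def)

lemma prefix_weight:
  assumes "k \<ge> 1" "p \<noteq> []" "legal k 1 p" "sum_list p \<le> n"
  shows "(\<Sum>ds | ds \<in> words k n \<and> (\<exists>es. ds = p @ es). word_weight \<Omega> ds) =
    word_weight \<Omega> p * forest_weight \<Omega> k (after k 1 p) (n - sum_list p)"
proof -
  have "{ds. ds \<in> words k n \<and> (\<exists>es. ds = p @ es)} =
      (@) p ` {es. complete_word k (after k 1 p) es \<and> sum_list es = n - sum_list p}"
    using assms(3,4) by (auto simp: words_def complete_append image_iff)
  hence "(\<Sum>ds | ds \<in> words k n \<and> (\<exists>es. ds = p @ es). word_weight \<Omega> ds) =
      (\<Sum>es | complete_word k (after k 1 p) es \<and> sum_list es = n - sum_list p. word_weight \<Omega> (p @ es))"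
    by (simp add: sum.reindex inj_on_def)
  also have "\<dots> = word_weight \<Omega> p * forest_weight \<Omega> k (after k 1 p) (n - sum_list p)"
    using forest_weight_sum[OF assms(1), of \<Omega> "after k 1 p" "n - sum_list p"]
    by (simp add: word_weight_append[OF assms(2)] flip: sum_distrib_left)
  finally show ?thesis .
qed

text \<open>The factor \<open>k d\<close> in the weight of the forest after a root front with \<open>d\<close> hedra turns the weight
  \<open>1 / d!\<close> of the root front into \<open>1 / (d - 1)!\<close>, the weight of any other front with \<open>d - 1\<close> new hedra.\<close>

lemma total_weight_eq:
  assumes k: "k \<ge> 1" and n: "n \<ge> 1"
  shows "total_weight \<Omega> k n = fps_nth (branch_fps \<Omega> ^ (k * n + 1)) (n - 1) / real n"
proof -
  let ?c = "\<lambda>N m. fps_nth (branch_fps \<Omega> ^ N) m"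
  let ?S = "\<lambda>q m. {ds. complete_word k q ds \<and> sum_list ds = m}"
  have un: "words k n = (\<Union>d\<in>{..n}. (#) d ` ?S (k * d) (n - d))"
  proof (intro equalityI subsetI)
    fix ds assume "ds \<in> words k n"
    then obtain d es where "ds = d # es" "complete_word k (k * d) es" "d + sum_list es = n"
      by (cases ds) (auto simp: words_def)
    thus "ds \<in> (\<Union>d\<in>{..n}. (#) d ` ?S (k * d) (n - d))" by (intro UN_I[of d] imageI) auto
  next
    fix ds assume "ds \<in> (\<Union>d\<in>{..n}. (#) d ` ?S (k * d) (n - d))"
    thus "ds \<in> words k n" by (auto simp: words_def)
  qed
  have "total_weight \<Omega> k n = (\<Sum>d\<le>n. \<Sum>ds\<in>(#) d ` ?S (k * d) (n - d). word_weight \<Omega> ds)"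
    unfolding total_weight_def un by (rule sum.UNION_disjoint) (auto simp: finite_complete)
  also have "\<dots> = (\<Sum>d\<le>n. weight \<Omega> d * forest_weight \<Omega> k (k * d) (n - d))"
  proof (rule sum.cong[OF refl])
    fix d assume d: "d \<in> {..n}"
    have "(\<Sum>ds\<in>(#) d ` ?S (k * d) (n - d). word_weight \<Omega> ds) =
        (\<Sum>ds\<in>?S (k * d) (n - d). weight \<Omega> d * prod_list (map (branch_weight \<Omega>) ds))"
      by (rule sum.reindex_cong[of "(#) d"]) (auto simp: word_weight_def)
    thus "(\<Sum>ds\<in>(#) d ` ?S (k * d) (n - d). word_weight \<Omega> ds) = weight \<Omega> d * forest_weight \<Omega> k (k * d) (n - d)"
      using forest_weight_sum[OF k, of \<Omega> "k * d" "n - d"] by (simp flip: sum_distrib_left)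
  qed
  also have "\<dots> = (\<Sum>d\<le>n. weight \<Omega> d * (real d / real n) * ?c (k * n) (n - d))"
  proof (rule sum.cong[OF refl])
    fix d assume d: "d \<in> {..n}"
    then obtain r where r: "n = d + r" by (metis atMost_iff le_Suc_ex)
    have e: "k * d + k * (n - d) = k * n" unfolding r by (simp add: algebra_simps)
    show "weight \<Omega> d * forest_weight \<Omega> k (k * d) (n - d) = weight \<Omega> d * (real d / real n) * ?c (k * n) (n - d)"
    proof (cases "d = 0")
      case True
      thus ?thesis using n by (simp add: forest_weight_def)
    next
      case False
      thus ?thesis unfolding forest_weight_def e using k n by simp
    qed
  qed
  also have "\<dots> = (\<Sum>d\<le>n - 1. branch_weight \<Omega> d * ?c (k * n) (n - 1 - d)) / real n"
  proof -
    obtain n' where n': "n = Suc n'" using n by (cases n) auto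
    have "weight \<Omega> (Suc d) * (real (Suc d) / real n) = branch_weight \<Omega> d / real n" for d
      by (simp add: weight_def branch_weight_def field_simps del: of_nat_Suc)
    thus ?thesis unfolding n' sum.atMost_Suc_shift by (simp add: sum_divide_distrib del: of_nat_Suc)
  qed
  also have "(\<Sum>d\<le>n - 1. branch_weight \<Omega> d * ?c (k * n) (n - 1 - d)) = ?c (k * n + 1) (n - 1)"
    using convolution[of "k * n + 1" \<Omega> "n - 1"] by simp
  finally show ?thesis .
qed

section \<open>Ratio limits for coefficients of large powers\<close>

lemma binomial_mean:
  fixes A B :: "'a :: comm_ring_1"
  shows "(\<Sum>j\<le>N. of_nat j * (of_nat (N choose j) * A ^ j * B ^ (N - j))) = of_nat N * A * (A + B) ^ (N - 1)"
proof (cases N)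
  case (Suc n)
  have "(\<Sum>j\<le>N. of_nat j * (of_nat (N choose j) * A ^ j * B ^ (N - j))) =
      (\<Sum>j\<le>n. of_nat (Suc j * (Suc n choose Suc j)) * A ^ Suc j * B ^ (n - j))"
    unfolding Suc sum.atMost_Suc_shift
    by (simp only: of_nat_0 mult_zero_left add_0 diff_Suc_Suc of_nat_mult mult.assoc)
  also have "\<dots> = (\<Sum>j\<le>n. of_nat N * A * (of_nat (n choose j) * A ^ j * B ^ (n - j)))"
    unfolding Suc_times_binomial Suc by (intro sum.cong refl) (simp add: algebra_simps)
  also have "\<dots> = of_nat N * A * (A + B) ^ n"
    unfolding binomial_ring[of A B n] sum_distrib_left ..
  finally show ?thesis using Suc by simp
qed simp

lemma coeff_le_eval:
  fixes f :: "real fps"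
  assumes "\<And>d. fps_nth f d \<ge> 0" "fps_conv_radius f = \<infinity>" "x \<ge> 0"
  shows "fps_nth f m * x ^ m \<le> eval_fps f x"
proof -
  have s: "(\<lambda>m. fps_nth f m * x ^ m) sums eval_fps f x" using assms by (intro sums_eval_fps) simp
  have "sum (\<lambda>m. fps_nth f m * x ^ m) {m} \<le> (\<Sum>m. fps_nth f m * x ^ m)"
    by (rule sum_le_suminf) (use s assms in \<open>auto simp: sums_iff\<close>)
  thus ?thesis using s by (simp add: sums_iff)
qed

text \<open>Under \<open>\<tau>\<close>, the numbers \<open>prob d\<close> below form a distribution with mean \<open>1 / k\<close>. The number \<open>b\<close> is a value
  of positive probability that lies strictly above this mean, and \<open>0\<close> is one below it.\<close>

locale critical =
  fixes \<Omega> :: "nat set" and k :: nat and \<tau> :: real and b :: nat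
  assumes k: "k \<ge> 1" and one: "1 \<in> \<Omega>" and b: "Suc b \<in> \<Omega>" "k * b \<ge> 2"
    and \<tau>: "\<tau> > 0" "real k * \<tau> * eval_fps (fps_deriv (branch_fps \<Omega>)) \<tau> = eval_fps (branch_fps \<Omega>) \<tau>"
begin

abbreviation "coef N m \<equiv> fps_nth (branch_fps \<Omega> ^ N) m"

definition F :: "real \<Rightarrow> real" where "F = eval_fps (branch_fps \<Omega>)"

text \<open>The probability that \<open>N\<close> independent random numbers with distribution \<open>prob\<close> have sum \<open>m\<close>.\<close>

definition \<beta> :: "nat \<Rightarrow> nat \<Rightarrow> real" where "\<beta> N m = coef N m * \<tau> ^ m / F \<tau> ^ N"

definition prob :: "nat \<Rightarrow> real" where "prob a = branch_weight \<Omega> a * \<tau> ^ a / F \<tau>"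

lemma F_sums: "(\<lambda>d. branch_weight \<Omega> d * x ^ d) sums F x"
  using branch_power_sums[of \<Omega> 1 x] by (simp add: F_def)

lemma power_sums: "(\<lambda>m. coef N m * x ^ m) sums (F x ^ N)"
  using branch_power_sums by (simp add: F_def)

lemma branch_0: "branch_weight \<Omega> 0 = 1"
  using one by (simp add: branch_weight_def)

lemma F_pos: "x \<ge> 0 \<Longrightarrow> F x > 0"
proof -
  assume x: "x \<ge> 0"
  have "sum (\<lambda>d. branch_weight \<Omega> d * x ^ d) {0} \<le> (\<Sum>d. branch_weight \<Omega> d * x ^ d)"
    by (rule sum_le_suminf) (use F_sums[of x] x in \<open>auto simp: sums_iff\<close>)
  thus ?thesis using F_sums[of x] branch_0 by (simp add: sums_iff)
qed

lemma F_\<tau>: "F \<tau> > 0"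
  using F_pos \<tau> by simp

lemma F_deriv: "(F has_field_derivative eval_fps (fps_deriv (branch_fps \<Omega>)) x) (at x)"
  unfolding F_def by (rule has_field_derivative_eval_fps) simp

text \<open>The derivative at the critical parameter, in exponential coordinates: the derivative of
  \<open>\<theta> \<mapsto> E exp (\<theta> (u \<xi> - v))\<close> at \<open>0\<close> is \<open>u / k - v\<close>.\<close>

lemma tilt_deriv:
  "((\<lambda>\<theta>. F (\<tau> * exp (u * \<theta>)) * exp (- v * \<theta>)) has_real_derivative (u / real k - v) * F \<tau>) (at 0)"
proof -
  define F' where "F' = eval_fps (fps_deriv (branch_fps \<Omega>)) \<tau>"
  have d: "(F has_field_derivative F') (at (\<tau> * exp (u * 0)))"
    using F_deriv[of \<tau>] by (simp add: F'_def)
  have "((\<lambda>\<theta>. F (\<tau> * exp (u * \<theta>))) has_real_derivative F' * (\<tau> * u)) (at 0)"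
    by (rule DERIV_chain2[where f = F and g = "\<lambda>\<theta>. \<tau> * exp (u * \<theta>)", OF d]) (auto intro!: derivative_eq_intros)
  hence "((\<lambda>\<theta>. F (\<tau> * exp (u * \<theta>)) * exp (- v * \<theta>)) has_real_derivative F' * (\<tau> * u) - v * F \<tau>) (at 0)"
    by (auto intro!: derivative_eq_intros)
  moreover have "F' * \<tau> = F \<tau> / real k" using \<tau>(2) k by (simp add: F'_def F_def field_simps)
  hence "F' * (\<tau> * u) = u / real k * F \<tau>" by (simp add: mult.assoc[symmetric])
  ultimately show ?thesis by (simp add: algebra_simps)
qed

lemma \<beta>_nonneg: "\<beta> N m \<ge> 0"
  unfolding \<beta>_def using \<tau> F_\<tau> by (simp add: divide_nonneg_pos)

lemma \<beta>_pos_iff: "\<beta> N m > 0 \<longleftrightarrow> coef N m > 0"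
  unfolding \<beta>_def using \<tau> F_\<tau> by (simp add: zero_less_divide_iff zero_less_mult_iff not_less)

lemma \<beta>_mult: "\<beta> N m * \<beta> N' m' \<le> \<beta> (N + N') (m + m')"
proof -
  have "coef N m * coef N' m' \<le> (\<Sum>i=0..m + m'. coef N i * coef N' (m + m' - i))"
    using member_le_sum[of m "{0..m + m'}" "\<lambda>i. coef N i * coef N' (m + m' - i)"] by simp
  also have "\<dots> = coef (N + N') (m + m')" by (simp add: power_add fps_mult_nth)
  finally have "coef N m * coef N' m' * \<tau> ^ (m + m') / F \<tau> ^ (N + N') \<le> coef (N + N') (m + m') * \<tau> ^ (m + m') / F \<tau> ^ (N + N')"
    using \<tau> F_\<tau> by (intro divide_right_mono mult_right_mono) auto
  moreover have "\<beta> N m * \<beta> N' m' = coef N m * coef N' m' * \<tau> ^ (m + m') / F \<tau> ^ (N + N')"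
    by (simp add: \<beta>_def power_add mult_ac)
  ultimately show ?thesis by (simp only: \<beta>_def)
qed

lemma \<beta>_power: "\<beta> N m ^ j \<le> \<beta> (j * N) (j * m)"
proof (induction j)
  case 0
  show ?case by (simp add: \<beta>_def)
next
  case (Suc j)
  have "\<beta> N m ^ Suc j \<le> \<beta> N m * \<beta> (j * N) (j * m)" using Suc \<beta>_nonneg by (simp add: mult_left_mono)
  also have "\<dots> \<le> \<beta> (N + j * N) (m + j * m)" by (rule \<beta>_mult)
  finally show ?case by simp
qed

lemma \<beta>_sums: "\<beta> N sums 1"
  unfolding \<beta>_def using sums_divide[OF power_sums[of N \<tau>], of "F \<tau> ^ N"] F_\<tau> by simp

lemma \<beta>_finite_sum: "finite A \<Longrightarrow> sum (\<beta> N) A \<le> 1"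
  using sum_le_suminf[of "\<beta> N" A] \<beta>_sums[of N] \<beta>_nonneg by (auto simp: sums_iff)

text \<open>The Chernoff bound: \<open>\<theta> > 0\<close> bounds the upper tail and \<open>\<theta> < 0\<close> the lower tail.\<close>

lemma chernoff:
  assumes "finite A" "\<And>m. m \<in> A \<Longrightarrow> \<theta> * (real k * real m - v * real N) \<ge> 0"
  shows "sum (\<beta> N) A \<le> (F (\<tau> * exp (real k * \<theta>)) * exp (- v * \<theta>) / F \<tau>) ^ N"
proof -
  let ?x = "\<tau> * exp (real k * \<theta>)"
  have "sum (\<beta> N) A \<le> (\<Sum>m\<in>A. coef N m * ?x ^ m * exp (- v * \<theta>) ^ N / F \<tau> ^ N)"
  proof (rule sum_mono)
    fix m assume m: "m \<in> A"
    have "exp (real k * \<theta>) ^ m * exp (- v * \<theta>) ^ N = exp (\<theta> * (real k * real m - v * real N))"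
      by (simp add: exp_of_nat_mult[symmetric] exp_add[symmetric] algebra_simps)
    hence "1 \<le> exp (real k * \<theta>) ^ m * exp (- v * \<theta>) ^ N" using assms(2)[OF m] by simp
    hence "coef N m * \<tau> ^ m * 1 \<le> coef N m * \<tau> ^ m * (exp (real k * \<theta>) ^ m * exp (- v * \<theta>) ^ N)"
      using \<tau> by (intro mult_left_mono) auto
    thus "\<beta> N m \<le> coef N m * ?x ^ m * exp (- v * \<theta>) ^ N / F \<tau> ^ N"
      unfolding \<beta>_def using F_\<tau> by (intro divide_right_mono) (auto simp: power_mult_distrib mult_ac)
  qed
  also have "\<dots> = (\<Sum>m\<in>A. coef N m * ?x ^ m) * (exp (- v * \<theta>) ^ N / F \<tau> ^ N)"
    by (subst sum_distrib_right) (simp only: times_divide_eq_right)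
  also have "\<dots> \<le> F ?x ^ N * (exp (- v * \<theta>) ^ N / F \<tau> ^ N)"
  proof (rule mult_right_mono)
    have "(\<Sum>m\<in>A. coef N m * ?x ^ m) \<le> (\<Sum>m. coef N m * ?x ^ m)"
      by (rule sum_le_suminf) (use power_sums[of N ?x] assms(1) \<tau> in \<open>auto simp: sums_iff\<close>)
    thus "(\<Sum>m\<in>A. coef N m * ?x ^ m) \<le> F ?x ^ N" using power_sums[of N ?x] by (simp add: sums_iff)
  qed (use F_\<tau> in simp)
  finally show ?thesis by (simp add: power_mult_distrib power_divide)
qed

text \<open>Both tails are exponentially small, because the bound of \<open>chernoff\<close> has the derivatives
  \<open>- \<delta>\<close> and \<open>\<delta>\<close> at \<open>\<theta> = 0\<close>. So half of the mass sits on at most \<open>2 N + 1\<close> values near \<open>N / k\<close>.\<close>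

lemma typical_exists:
  assumes \<delta>: "0 < \<delta>" "\<delta> \<le> 1"
  shows "\<exists>N0. \<forall>N\<ge>N0. \<exists>x. \<bar>real k * real x - real N\<bar> \<le> \<delta> * real N \<and> \<beta> N x \<ge> 1 / (4 * real N + 4)"
proof -
  let ?g = "\<lambda>v \<theta>. F (\<tau> * exp (real k * \<theta>)) * exp (- v * \<theta>)"
  have "\<exists>d>0. \<forall>h>0. h < d \<longrightarrow> ?g (1 + \<delta>) 0 > ?g (1 + \<delta>) (0 + h)"
    by (rule DERIV_neg_dec_right[OF tilt_deriv]) (use k \<delta> F_\<tau> in \<open>simp add: mult_less_0_iff\<close>)
  then obtain d1 where d1: "d1 > 0" "\<And>h. 0 < h \<Longrightarrow> h < d1 \<Longrightarrow> ?g (1 + \<delta>) h < F \<tau>" by auto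
  have "\<exists>d>0. \<forall>h>0. h < d \<longrightarrow> ?g (1 - \<delta>) (0 - h) < ?g (1 - \<delta>) 0"
    by (rule DERIV_pos_inc_left[OF tilt_deriv]) (use k \<delta> F_\<tau> in simp)
  then obtain d2 where d2: "d2 > 0" "\<And>h. 0 < h \<Longrightarrow> h < d2 \<Longrightarrow> ?g (1 - \<delta>) (- h) < F \<tau>" by auto
  define r1 where "r1 = ?g (1 + \<delta>) (d1 / 2) / F \<tau>"
  define r2 where "r2 = ?g (1 - \<delta>) (- (d2 / 2)) / F \<tau>"
  have Fp: "F (\<tau> * exp x) > 0" for x by (rule F_pos) (use \<tau> in simp)
  have r1: "0 \<le> r1" "r1 < 1"
    using d1(1) d1(2)[of "d1 / 2"] F_\<tau> Fp[of "real k * (d1 / 2)"] unfolding r1_def by simp_all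
  have r2: "0 \<le> r2" "r2 < 1"
    using d2(1) d2(2)[of "d2 / 2"] F_\<tau> Fp[of "real k * - (d2 / 2)"] unfolding r2_def by simp_all
  have "(\<lambda>N. r1 ^ N + r2 ^ N) \<longlonglongrightarrow> 0 + 0" by (intro tendsto_add LIMSEQ_realpow_zero) (use r1 r2 in auto)
  hence "eventually (\<lambda>N. r1 ^ N + r2 ^ N < 1 / 4) sequentially" by (rule order_tendstoD) simp
  then obtain N0 where N0: "\<And>N. N \<ge> N0 \<Longrightarrow> r1 ^ N + r2 ^ N < 1 / 4" by (auto simp: eventually_sequentially)
  have "\<exists>x. \<bar>real k * real x - real N\<bar> \<le> \<delta> * real N \<and> \<beta> N x \<ge> 1 / (4 * real N + 4)" if N: "N \<ge> N0" for N
  proof (rule ccontr)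
    assume neg: "\<not> ?thesis"
    have "(\<lambda>n. \<Sum>m<n. \<beta> N m) \<longlonglongrightarrow> 1" using \<beta>_sums[of N] by (simp add: sums_def)
    hence "eventually (\<lambda>n. (\<Sum>m<n. \<beta> N m) > 3 / 4) sequentially" by (rule order_tendstoD) simp
    then obtain n where n: "(\<Sum>m<n. \<beta> N m) > 3 / 4" by (auto simp: eventually_sequentially)
    let ?H = "{m\<in>{..<n}. real k * real m > (1 + \<delta>) * real N}"
    let ?L = "{m\<in>{..<n}. real k * real m < (1 - \<delta>) * real N}"
    let ?M = "{m\<in>{..<n}. \<bar>real k * real m - real N\<bar> \<le> \<delta> * real N}"
    have "sum (\<beta> N) ?H \<le> r1 ^ N" unfolding r1_def
      by (rule chernoff) (use d1 in \<open>auto intro!: mult_nonneg_nonneg\<close>)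
    moreover have "sum (\<beta> N) ?L \<le> r2 ^ N" unfolding r2_def
      by (rule chernoff) (use d2 in \<open>auto intro!: mult_nonneg_nonpos simp: mult_le_0_iff\<close>)
    moreover have "sum (\<beta> N) ?M \<le> 1 / 2"
    proof -
      have "?M \<subseteq> {..2 * N}"
      proof
        fix m assume m: "m \<in> ?M"
        have "1 * real m \<le> real k * real m" by (rule mult_right_mono) (use k in auto)
        moreover have "\<delta> * real N \<le> 1 * real N" by (rule mult_right_mono) (use \<delta> in auto)
        ultimately have "real m \<le> 2 * real N" using m by auto
        thus "m \<in> {..2 * N}" by simp
      qed
      hence "card ?M \<le> 2 * N + 1" using card_mono[of "{..2 * N}" ?M] by simp
      have "sum (\<beta> N) ?M \<le> (\<Sum>m\<in>?M. 1 / (4 * real N + 4))"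
      proof (rule sum_mono)
        fix m assume m: "m \<in> ?M"
        from neg have "\<not> (\<bar>real k * real m - real N\<bar> \<le> \<delta> * real N \<and> \<beta> N m \<ge> 1 / (4 * real N + 4))" by blast
        thus "\<beta> N m \<le> 1 / (4 * real N + 4)" using m by auto
      qed
      also have "\<dots> = real (card ?M) * (1 / (4 * real N + 4))" by simp
      also have "\<dots> \<le> real (2 * N + 1) * (1 / (4 * real N + 4))"
        by (rule mult_right_mono) (use \<open>card ?M \<le> 2 * N + 1\<close> in \<open>simp_all only: of_nat_le_iff, simp\<close>)
      also have "\<dots> \<le> 1 / 2" by (simp add: field_simps)
      finally show ?thesis .
    qed
    moreover have "(\<Sum>m<n. \<beta> N m) \<le> sum (\<beta> N) ?H + sum (\<beta> N) ?L + sum (\<beta> N) ?M"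
    proof -
      have "{..<n} \<subseteq> ?H \<union> ?L \<union> ?M" by (auto simp: abs_le_iff algebra_simps)
      hence "(\<Sum>m<n. \<beta> N m) \<le> sum (\<beta> N) (?H \<union> ?L \<union> ?M)" by (intro sum_mono2) (auto simp: \<beta>_nonneg)
      also have "\<dots> \<le> sum (\<beta> N) (?H \<union> ?L) + sum (\<beta> N) ?M"
        using \<beta>_nonneg by (subst sum.union_inter[symmetric]) (auto intro!: sum_nonneg)
      also have "sum (\<beta> N) (?H \<union> ?L) \<le> sum (\<beta> N) ?H + sum (\<beta> N) ?L"
        using \<beta>_nonneg by (subst sum.union_inter[symmetric]) (auto intro!: sum_nonneg)
      finally show ?thesis by simp
    qed
    ultimately show False using n N0[OF N] by linarith
  qed
  thus ?thesis by blast
qed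

text \<open>Lattice effects: it suffices to reach every residue class that can be reached at all by one
  fixed short walk.\<close>

lemma short_walks:
  "\<exists>C \<omega>. \<omega> > 0 \<and> (\<forall>N m. coef N m > 0 \<longrightarrow>
     (\<exists>N' m'. N' \<le> C \<and> m' \<le> C \<and> m' mod b = m mod b \<and> \<beta> N' m' \<ge> \<omega>))"
proof -
  have bp: "b > 0" using b by (cases b) auto
  let ?P = "\<lambda>r. \<exists>N m. coef N m > 0 \<and> m mod b = r"
  have "\<forall>r. \<exists>p. ?P r \<longrightarrow> coef (fst p) (snd p) > 0 \<and> snd p mod b = r" by (metis fst_conv snd_conv)
  from choice[OF this] obtain f' where
    "\<forall>r. ?P r \<longrightarrow> coef (fst (f' r)) (snd (f' r)) > 0 \<and> snd (f' r) mod b = r" ..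
  moreover define Nf mf where "Nf = fst \<circ> f'" and "mf = snd \<circ> f'"
  ultimately have f: "\<And>r. ?P r \<Longrightarrow> coef (Nf r) (mf r) > 0 \<and> mf r mod b = r" by simp
  define S where "S = {r. r < b \<and> ?P r}"
  define C where "C = (\<Sum>r\<in>S. Nf r + mf r)"
  define \<omega> where "\<omega> = Min (insert 1 ((\<lambda>r. \<beta> (Nf r) (mf r)) ` S))"
  have fS: "finite S" by (simp add: S_def)
  have "\<omega> > 0" unfolding \<omega>_def using fS f by (subst Min_gr_iff) (auto simp: \<beta>_pos_iff S_def)
  moreover have "\<exists>N' m'. N' \<le> C \<and> m' \<le> C \<and> m' mod b = m mod b \<and> \<beta> N' m' \<ge> \<omega>" if "coef N m > 0" for N m
  proof -
    let ?r = "m mod b"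
    have r: "?r \<in> S" unfolding S_def using bp that by auto
    have "Nf ?r + mf ?r \<le> C" unfolding C_def by (rule member_le_sum[OF r]) (use fS in auto)
    moreover have "mf ?r mod b = ?r" using f[of ?r] that by auto
    moreover have "\<omega> \<le> \<beta> (Nf ?r) (mf ?r)" unfolding \<omega>_def using fS r by (intro Min_le) auto
    ultimately show ?thesis by (intro exI[of _ "Nf ?r"] exI[of _ "mf ?r"]) auto
  qed
  ultimately show ?thesis by blast
qed

definition step_min :: real where "step_min = min (\<beta> 1 0) (\<beta> 1 b)"

lemma step_min: "0 < step_min" "step_min \<le> 1"
proof -
  have "coef 1 0 > 0" "coef 1 b > 0" using b one by (auto simp: branch_weight_def)
  thus "0 < step_min" unfolding step_min_def using \<beta>_pos_iff by simp
  show "step_min \<le> 1" using \<beta>_finite_sum[of "{0}" 1] unfolding step_min_def by simp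
qed

lemma \<beta>_steer:
  assumes "y \<le> L" shows "\<beta> L (b * y) \<ge> step_min ^ L"
proof -
  have "step_min ^ L = step_min ^ y * step_min ^ (L - y)" using assms by (simp flip: power_add)
  also have "\<dots> \<le> \<beta> 1 b ^ y * \<beta> 1 0 ^ (L - y)"
    using step_min by (intro mult_mono power_mono) (auto simp: step_min_def \<beta>_nonneg)
  also have "\<dots> \<le> \<beta> (y * 1) (y * b) * \<beta> ((L - y) * 1) ((L - y) * 0)"
    by (intro mult_mono \<beta>_power) (auto simp: \<beta>_nonneg)
  also have "\<dots> \<le> \<beta> (y * 1 + (L - y) * 1) (y * b + (L - y) * 0)" by (rule \<beta>_mult)
  finally show ?thesis using assms by (simp add: mult.commute)
qed


text \<open>A sum near \<open>N / k\<close> that is attainable at all is attained with a probability that is not exponentially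
  small: combine a short walk for the residue class modulo \<open>b\<close>, then \<open>b\<close> copies of a walk to a typical value,
  which come close to the target, and a small proportion of steps \<open>0\<close> and \<open>b\<close> that lead to it.\<close>

lemma coef_subexponential:
  assumes \<eta>: "\<eta> > 0" and C: "C \<ge> 0"
  shows "\<exists>N0. \<forall>N\<ge>N0. \<forall>m. \<bar>real k * real m - real N\<bar> \<le> C \<and> coef N m > 0 \<longrightarrow> \<beta> N m \<ge> exp (- \<eta> * real N)"
proof -
  have bp: "b > 0" using b by (cases b) auto
  obtain C1 \<omega> where \<omega>: "\<omega> > 0" and sw: "\<And>N m. coef N m > 0 \<Longrightarrow>
     \<exists>N' m'. N' \<le> C1 \<and> m' \<le> C1 \<and> m' mod b = m mod b \<and> \<beta> N' m' \<ge> \<omega>"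
    using short_walks by blast
  define la where "la = - ln step_min"
  have la: "la \<ge> 0" unfolding la_def using step_min by (simp add: ln_le_zero_iff)
  define \<epsilon> where "\<epsilon> = min (1 / 2) (\<eta> / (2 * (la + 1)))"
  have \<epsilon>: "0 < \<epsilon>" "\<epsilon> \<le> 1 / 2"
    using \<eta> la by (simp_all only: \<epsilon>_def min.cobounded1) simp
  have "\<epsilon> * (la + 1) \<le> \<eta> / (2 * (la + 1)) * (la + 1)" by (rule mult_right_mono) (use la in \<open>auto simp: \<epsilon>_def\<close>)
  also have "\<dots> = \<eta> / 2" using la by (simp add: field_simps)
  finally have \<epsilon>la: "\<epsilon> * la \<le> \<eta> / 2" using \<epsilon> by (simp add: algebra_simps)
  define \<delta> where "\<delta> = \<epsilon> / 2"
  have \<delta>: "0 < \<delta>" "\<delta> \<le> 1" using \<epsilon> by (auto simp: \<delta>_def)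
  obtain M0 where M0: "\<And>M. M \<ge> M0 \<Longrightarrow> \<exists>x. \<bar>real k * real x - real M\<bar> \<le> \<delta> * real M \<and> \<beta> M x \<ge> 1 / (4 * real M + 4)"
    using typical_exists[OF \<delta>] by blast
  define c where "c = \<eta> / (4 * (real b + 1))"
  have c: "c > 0" unfolding c_def using \<eta> by simp
  have e1: "eventually (\<lambda>N. real N \<ge> 2 * real b * (real M0 + 1)) sequentially" by real_asymp
  have e2: "eventually (\<lambda>N. \<delta> * real N \<ge> C + real k * real C1 + real b + 2 * real C1) sequentially"
    using \<delta>(1) by real_asymp
  have e3: "eventually (\<lambda>N. 4 * real N + 4 \<le> exp (c * real N)) sequentially" using c by real_asymp
  have e4: "eventually (\<lambda>N. \<eta> / 4 * real N \<ge> la * real b - ln \<omega>) sequentially" using \<eta> by real_asymp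
  have "eventually (\<lambda>N. \<forall>m. \<bar>real k * real m - real N\<bar> \<le> C \<and> coef N m > 0 \<longrightarrow> \<beta> N m \<ge> exp (- \<eta> * real N)) sequentially"
    using e1 e2 e3 e4
  proof (eventually_elim, safe)
    fix N m
    assume N1: "2 * real b * (real M0 + 1) \<le> real N"
      and N2: "C + real k * real C1 + real b + 2 * real C1 \<le> \<delta> * real N"
      and N3: "4 * real N + 4 \<le> exp (c * real N)" and N4: "la * real b - ln \<omega> \<le> \<eta> / 4 * real N"
      and m: "\<bar>real k * real m - real N\<bar> \<le> C" "coef N m > 0"
    obtain N' m' where w: "N' \<le> C1" "m' \<le> C1" "m' mod b = m mod b" "\<beta> N' m' \<ge> \<omega>" using sw[OF m(2)] by blast
    \<comment> \<open>Of the \<open>N\<close> steps, \<open>b * M\<close> go to typical walks and about \<open>\<epsilon> * N\<close> remain for steering. A multiple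
      of \<open>b\<close> remains to be covered, as the short walk and \<open>b\<close> equal copies fix the residue.\<close>
    define M where "M = nat \<lfloor>(1 - \<epsilon>) * real N / real b\<rfloor>"
    have Mr: "real M \<le> (1 - \<epsilon>) * real N / real b" "(1 - \<epsilon>) * real N / real b < real M + 1"
      unfolding M_def using \<epsilon> by auto
    have bM: "real b * real M \<le> (1 - \<epsilon>) * real N" "(1 - \<epsilon>) * real N - real b \<le> real b * real M"
      using Mr bp by (auto simp: field_simps)
    have "M \<ge> M0"
    proof -
      have "real b * (real M0 + 1) \<le> (1 / 2) * real N" using N1 by simp
      also have "\<dots> \<le> (1 - \<epsilon>) * real N" by (rule mult_right_mono) (use \<epsilon> in auto)
      finally have "real M0 + 1 \<le> (1 - \<epsilon>) * real N / real b" using bp by (simp add: field_simps)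
      hence "real M0 < real M + 1" using Mr by linarith
      thus ?thesis by simp
    qed
    then obtain x where x: "\<bar>real k * real x - real M\<bar> \<le> \<delta> * real M" "\<beta> M x \<ge> 1 / (4 * real M + 4)" using M0 by blast
    have bMN: "real b * real M \<le> real N" 
    proof -
      have "0 \<le> \<epsilon> * real N" using \<epsilon> by simp
      moreover have "(1 - \<epsilon>) * real N = real N - \<epsilon> * real N" by (simp add: algebra_simps)
      ultimately show ?thesis using bM(1) by linarith
    qed
    have \<delta>bM: "\<delta> * (real b * real M) \<le> \<delta> * real N" by (rule mult_left_mono) (use bMN \<delta> in auto)
    have bx: "\<bar>real k * (real b * real x) - real b * real M\<bar> \<le> \<delta> * real N"
    proof -
      have "\<bar>real k * (real b * real x) - real b * real M\<bar> = real b * \<bar>real k * real x - real M\<bar>"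
      proof -
        have "real k * (real b * real x) - real b * real M = real b * (real k * real x - real M)" by (simp add: algebra_simps)
        thus ?thesis by (simp only: abs_mult abs_of_nat)
      qed
      also have "\<dots> \<le> real b * (\<delta> * real M)" by (rule mult_left_mono) (use x in auto)
      also have "\<dots> \<le> \<delta> * real N" using \<delta>bM by (simp add: mult_ac)
      finally show ?thesis .
    qed
    have km': "real k * real m' \<le> real k * real C1" by (rule mult_left_mono) (use w in auto)
    have Ce: "C1 \<ge> 0" "real C1 \<ge> 0" by auto
    have \<epsilon>\<delta>: "\<epsilon> * real N = 2 * (\<delta> * real N)" by (simp add: \<delta>_def)
    have bM': "real b * real M \<le> real N - 2 * (\<delta> * real N)" "real N - 2 * (\<delta> * real N) - real b \<le> real b * real M"
      using bM \<epsilon>\<delta> by (auto simp: algebra_simps)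
    have "real k * (real m' + real b * real x) \<le> real k * real m"
    proof -
      have "real k * (real m' + real b * real x) = real k * real m' + real k * (real b * real x)" by (simp add: algebra_simps)
      thus ?thesis using km' bx bM'(1) m(1) N2 unfolding abs_le_iff by linarith
    qed
    hence "real (m' + b * x) \<le> real m" using k by simp
    hence le: "m' + b * x \<le> m" by linarith
    have "(m' + b * x) mod b = m mod b" using w(3) by simp
    hence "b dvd m - (m' + b * x)" using le by (metis mod_eq_dvd_iff_nat)
    then obtain y where y: "m - (m' + b * x) = b * y" ..
    have my: "m = m' + (b * x + b * y)" using y le by simp
    define L where "L = N - (N' + b * M)"
    have N'C: "real N' \<le> real C1" using w by simp
    moreover have "0 \<le> real k * real C1" "0 \<le> \<delta> * real N" using \<delta> by auto
    ultimately have "real (N' + b * M) \<le> real N" unfolding of_nat_add of_nat_mult using bM'(1) N2 C Ce by linarith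
    hence NL: "N = N' + (b * M + L)" unfolding L_def by linarith
    have rL: "real L = real N - real N' - real b * real M" using NL by (metis add_diff_cancel_left' diff_diff_eq of_nat_add of_nat_mult add.assoc)
    have kby: "real k * (real b * real y) \<le> real k * (real b * real L)"
    proof -
      have e: "real k * (real b * real y) = real k * real m - real k * real m' - real k * (real b * real x)"
        unfolding my by (simp add: algebra_simps)
      have "2 * real L \<le> real k * real b * real L" by (rule mult_right_mono) (use b in \<open>simp_all flip: of_nat_mult\<close>)
      moreover have "2 * real L \<ge> 2 * (2 * (\<delta> * real N) - real C1)"
      proof -
        have "2 * (\<delta> * real N) - real C1 \<le> real L" using rL bM'(1) N'C by linarith
        thus ?thesis by (rule mult_left_mono) simp
      qed
      moreover have "real k * real m' \<ge> 0" by simp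
      moreover have "real k * real m - real k * (real b * real x) \<le> C + 3 * (\<delta> * real N) + real b"
        using m(1) bx bM'(2) unfolding abs_le_iff by linarith
      moreover have "real k * real C1 \<ge> 0" by simp
      moreover have "P - Q - R \<le> S" if "2 * l \<le> S" "2 * (2 * d - c1) \<le> 2 * l" "0 \<le> Q"
        "P - R \<le> C + 3 * d + b'" "0 \<le> kc" "C + kc + b' + 2 * c1 \<le> d"
        for P Q R S l d c1 b' kc :: real
        using that by argo
      ultimately show ?thesis unfolding e using N2 unfolding mult.assoc by blast
    qed
    have "real y \<le> real L" using kby k bp by simp
    hence yL: "y \<le> L" by simp
    have "real M \<le> real N"
    proof -
      have "1 * real M \<le> real b * real M" by (rule mult_right_mono) (use bp in auto)
      thus ?thesis using bMN by simp
    qed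
    have "1 / (4 * real N + 4) \<le> 1 / (4 * real M + 4)" by (rule divide_left_mono) (use \<open>real M \<le> real N\<close> in auto)
    hence f2: "1 / (4 * real N + 4) \<le> \<beta> M x" using x(2) by linarith
    have g2: "exp (- (\<eta> / 4) * real N) \<le> \<beta> (b * M) (b * x)"
    proof -
      have "exp (- (\<eta> / 4) * real N) \<le> exp (- c * real N) ^ b"
      proof -
        have "real b * c \<le> \<eta> / 4" unfolding c_def using \<eta> by (simp add: field_simps)
        hence "real b * c * real N \<le> \<eta> / 4 * real N" by (rule mult_right_mono) simp
        thus ?thesis by (simp add: exp_of_nat_mult[symmetric] algebra_simps)
      qed
      also have "\<dots> \<le> (1 / (4 * real N + 4)) ^ b"
        using N3 by (intro power_mono) (auto simp: exp_minus field_simps)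
      also have "\<dots> \<le> \<beta> M x ^ b" by (rule power_mono[OF f2]) simp
      also have "\<dots> \<le> \<beta> (b * M) (b * x)" by (rule \<beta>_power)
      finally show ?thesis .
    qed
    have g3: "exp (- la * real L) \<le> \<beta> L (b * y)"
    proof -
      have "exp (- la * real L) = step_min ^ L" using step_min by (simp add: la_def exp_of_nat2_mult)
      thus ?thesis using \<beta>_steer[OF yL] by simp
    qed
    have "la * real L \<le> la * (\<epsilon> * real N + real b)" by (rule mult_left_mono) (use rL bM(2) la in \<open>auto simp: algebra_simps\<close>)
    also have "\<dots> = \<epsilon> * la * real N + la * real b" by (simp add: algebra_simps)
    also have "\<dots> \<le> \<eta> / 2 * real N + la * real b" using mult_right_mono[OF \<epsilon>la, of "real N"] by simp
    finally have lL: "la * real L \<le> \<eta> / 2 * real N + la * real b" .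
    have "exp (- \<eta> * real N) \<le> exp (ln \<omega> + (- (\<eta> / 4) * real N + - la * real L))"
      using lL N4 by (simp add: algebra_simps)
    also have "\<dots> = \<omega> * (exp (- (\<eta> / 4) * real N) * exp (- la * real L))"
      unfolding exp_add using \<omega> by simp
    also have "\<dots> \<le> \<beta> N' m' * (\<beta> (b * M) (b * x) * \<beta> L (b * y))"
      by (intro mult_mono g2 g3 w(4)) (use \<omega> \<beta>_nonneg in auto)
    also have "\<dots> \<le> \<beta> N' m' * \<beta> (b * M + L) (b * x + b * y)"
      by (rule mult_left_mono[OF \<beta>_mult \<beta>_nonneg])
    also have "\<dots> \<le> \<beta> (N' + (b * M + L)) (m' + (b * x + b * y))" by (rule \<beta>_mult)
    finally show "exp (- \<eta> * real N) \<le> \<beta> N m" using NL my by simp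
  qed
  thus ?thesis by (simp add: eventually_sequentially)
qed


text \<open>The coefficient of \<open>(branch_fps \<Omega>) ^ N\<close> counts sequences; \<open>occur N m a j\<close> is the part of it
  that comes from the sequences in which the number \<open>a\<close> occurs exactly \<open>j\<close> times.\<close>

definition occur :: "nat \<Rightarrow> nat \<Rightarrow> nat \<Rightarrow> nat \<Rightarrow> real" where
  "occur N m a j = fps_nth (of_nat (N choose j) * (fps_const (branch_weight \<Omega> a) * fps_X ^ a) ^ j
      * (branch_fps \<Omega> - fps_const (branch_weight \<Omega> a) * fps_X ^ a) ^ (N - j)) m"

definition removed :: "nat \<Rightarrow> nat \<Rightarrow> nat \<Rightarrow> real" where
  "removed N m a = (if a \<le> m then coef (N - 1) (m - a) else 0)"

lemma radius_mult: "fps_conv_radius f = \<infinity> \<Longrightarrow> fps_conv_radius g = \<infinity> \<Longrightarrow> fps_conv_radius (f * g :: real fps) = \<infinity>"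
  using fps_conv_radius_mult[of f g] by simp

lemma radius_power: "fps_conv_radius f = \<infinity> \<Longrightarrow> fps_conv_radius (f ^ n :: real fps) = \<infinity>"
  using fps_conv_radius_power[of f n] by simp

lemma fps_mult_nonneg:
  fixes f g :: "real fps"
  shows "(\<And>i. fps_nth f i \<ge> 0) \<Longrightarrow> (\<And>i. fps_nth g i \<ge> 0) \<Longrightarrow> fps_nth (f * g) i \<ge> 0"
  by (auto simp: fps_mult_nth intro!: sum_nonneg)

lemma prob_bounds: "0 \<le> prob a" "prob a \<le> 1"
proof -
  have "prob a = \<beta> 1 a" by (simp add: prob_def \<beta>_def)
  thus "0 \<le> prob a" "prob a \<le> 1" using \<beta>_nonneg \<beta>_finite_sum[of "{a}" 1] by auto
qed

lemma occur_bounds: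
  shows "0 \<le> occur N m a j"
    and "j \<le> N \<Longrightarrow> occur N m a j * \<tau> ^ m \<le> F \<tau> ^ N * (real (N choose j) * prob a ^ j * (1 - prob a) ^ (N - j))"
proof -
  let ?A = "fps_const (branch_weight \<Omega> a) * fps_X ^ a :: real fps"
  let ?B = "branch_fps \<Omega> - ?A"
  let ?T = "of_nat (N choose j) * ?A ^ j * ?B ^ (N - j)"
  have A0: "fps_nth ?A i \<ge> 0" for i by (simp add: fps_X_power_nth)
  have B0: "fps_nth ?B i \<ge> 0" for i by (simp add: fps_X_power_nth)
  have B1: "\<bar>fps_nth ?B i\<bar> \<le> 1 / fact i" for i by (simp add: fps_X_power_nth branch_weight_def)
  have c0: "fps_nth (of_nat c :: real fps) i \<ge> 0" for c i by (simp add: fps_of_nat[symmetric])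
  have T0: "fps_nth ?T i \<ge> 0" for i
    by (intro fps_mult_nonneg fps_power_nonneg A0 B0 c0)
  show "0 \<le> occur N m a j" unfolding occur_def by (rule T0)
  have rA: "fps_conv_radius ?A = \<infinity>" by (intro radius_mult) auto
  have rB: "fps_conv_radius ?B = \<infinity>" by (rule infinite_radius_if_le_fact[OF B1])
  have rc: "fps_conv_radius (of_nat c :: real fps) = \<infinity>" for c by (simp add: fps_of_nat[symmetric])
  have rT: "fps_conv_radius ?T = \<infinity>" by (intro radius_mult radius_power rA rB rc)
  have eA: "eval_fps ?A \<tau> = branch_weight \<Omega> a * \<tau> ^ a" by (simp add: eval_fps_mult)
  have eB: "eval_fps ?B \<tau> = F \<tau> - branch_weight \<Omega> a * \<tau> ^ a"
    by (subst eval_fps_diff) (simp_all add: rA eA F_def)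
  have ec: "eval_fps (of_nat c :: real fps) \<tau> = real c" for c by (simp add: fps_of_nat[symmetric])
  have p: "branch_weight \<Omega> a * \<tau> ^ a = F \<tau> * prob a" using F_\<tau> by (simp add: prob_def)
  have "occur N m a j * \<tau> ^ m \<le> eval_fps ?T \<tau>"
    unfolding occur_def by (rule coeff_le_eval[OF T0 rT]) (use \<tau> in simp)
  also have "\<dots> = real (N choose j) * eval_fps ?A \<tau> ^ j * eval_fps ?B \<tau> ^ (N - j)"
    by (subst eval_fps_mult, simp_all add: radius_mult radius_power rA rB rc,
        subst eval_fps_mult, simp_all add: radius_power rA rB rc eval_fps_power ec)
  also have "\<dots> = F \<tau> ^ (j + (N - j)) * (real (N choose j) * prob a ^ j * (1 - prob a) ^ (N - j))"
  proof -
    have "F \<tau> - F \<tau> * prob a = F \<tau> * (1 - prob a)" by (simp add: algebra_simps)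
    thus ?thesis unfolding eA eB p by (simp only: power_mult_distrib power_add mult_ac)
  qed
  finally show "occur N m a j * \<tau> ^ m \<le> F \<tau> ^ N * (real (N choose j) * prob a ^ j * (1 - prob a) ^ (N - j))"
    if "j \<le> N" using that by simp
qed

lemma occur_sum: "(\<Sum>j\<le>N. occur N m a j) = coef N m"
proof -
  have "branch_fps \<Omega> ^ N = (fps_const (branch_weight \<Omega> a) * fps_X ^ a + (branch_fps \<Omega> - fps_const (branch_weight \<Omega> a) * fps_X ^ a)) ^ N"
    by simp
  also have "fps_nth \<dots> m = (\<Sum>j\<le>N. occur N m a j)"
    unfolding binomial_ring fps_sum_nth occur_def ..
  finally show ?thesis by simp
qed

text \<open>By exchangeability, the expected number of occurrences of \<open>a\<close> is \<open>N\<close> times the contribution of the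
  sequences that end with \<open>a\<close>.\<close>

lemma occur_mean: "(\<Sum>j\<le>N. real j * occur N m a j) = real N * (branch_weight \<Omega> a * removed N m a)"
proof -
  let ?A = "fps_const (branch_weight \<Omega> a) * fps_X ^ a :: real fps"
  have n: "fps_nth (of_nat c * f) m = real c * fps_nth f m" for c and f :: "real fps"
    by (simp add: fps_of_nat[symmetric])
  have "(\<Sum>j\<le>N. real j * occur N m a j) = fps_nth (\<Sum>j\<le>N. of_nat j * (of_nat (N choose j) * ?A ^ j * (branch_fps \<Omega> - ?A) ^ (N - j))) m"
    unfolding fps_sum_nth occur_def n ..
  also have "\<dots> = fps_nth (of_nat N * (?A * branch_fps \<Omega> ^ (N - 1))) m"
    unfolding binomial_mean by (simp add: mult.assoc)
  also have "\<dots> = real N * (branch_weight \<Omega> a * removed N m a)"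
    unfolding n removed_def by (simp add: mult.assoc fps_X_power_mult_nth)
  finally show ?thesis .
qed

text \<open>Without the condition on the sum, the number of occurrences of \<open>a\<close> is binomially distributed, and
  Hoeffding's inequality applies; the condition costs at most a factor \<open>1 / \<beta> N m\<close>.\<close>

lemma occur_concentration:
  assumes N: "N \<ge> 1" and \<epsilon>: "\<epsilon> > 0" and pos: "coef N m > 0"
  shows "\<bar>branch_weight \<Omega> a * removed N m a / coef N m - prob a\<bar> \<le> \<epsilon> + 2 * exp (- 2 * real N * \<epsilon>\<^sup>2) / \<beta> N m"
proof -
  interpret bd: binomial_distribution N "prob a" by unfold_locales (use prob_bounds in auto)
  let ?D = "{j\<in>{..N}. \<bar>real j / real N - prob a\<bar> \<ge> \<epsilon>}"
  have "\<bar>real N * (branch_weight \<Omega> a * removed N m a) - real N * prob a * coef N m\<bar>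
     = \<bar>\<Sum>j\<le>N. (real j - real N * prob a) * occur N m a j\<bar>"
    unfolding occur_mean[symmetric] occur_sum[of N m a, symmetric]
    by (simp add: sum_subtractf sum_distrib_left left_diff_distrib)
  also have "\<dots> \<le> (\<Sum>j\<le>N. \<bar>real j - real N * prob a\<bar> * occur N m a j)"
    by (rule order_trans[OF sum_abs]) (simp add: abs_mult occur_bounds(1))
  also have "\<dots> \<le> (\<Sum>j\<le>N. real N * \<epsilon> * occur N m a j + (if \<bar>real j / real N - prob a\<bar> \<ge> \<epsilon> then real N * occur N m a j else 0))"
  proof (rule sum_mono)
    fix j assume j: "j \<in> {..N}"
    have e: "\<bar>real j - real N * prob a\<bar> = real N * \<bar>real j / real N - prob a\<bar>"
    proof -
      have "real j - real N * prob a = real N * (real j / real N - prob a)" using N by (simp add: right_diff_distrib)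
      thus ?thesis by (simp only: abs_mult abs_of_nat)
    qed
    have le1: "\<bar>real j / real N - prob a\<bar> \<le> 1"
    proof -
      have "0 \<le> real j / real N" "real j / real N \<le> 1" using j N by auto
      thus ?thesis using prob_bounds[of a] unfolding abs_le_iff by linarith
    qed
    show "\<bar>real j - real N * prob a\<bar> * occur N m a j \<le> real N * \<epsilon> * occur N m a j + (if \<bar>real j / real N - prob a\<bar> \<ge> \<epsilon> then real N * occur N m a j else 0)"
    proof (cases "\<bar>real j / real N - prob a\<bar> \<ge> \<epsilon>")
      case True
      have "real N * \<bar>real j / real N - prob a\<bar> * occur N m a j \<le> real N * 1 * occur N m a j"
        by (intro mult_right_mono mult_left_mono le1) (auto simp: occur_bounds(1))
      moreover have "real N * \<epsilon> * occur N m a j \<ge> 0" using \<epsilon> by (simp add: occur_bounds(1))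
      ultimately show ?thesis using True unfolding e by simp
    next
      case False
      hence "\<bar>real j / real N - prob a\<bar> \<le> \<epsilon>" using j by auto
      hence "real N * \<bar>real j / real N - prob a\<bar> * occur N m a j \<le> real N * \<epsilon> * occur N m a j"
        by (intro mult_right_mono mult_left_mono) (auto simp: occur_bounds(1))
      thus ?thesis using False unfolding e by simp
    qed
  qed
  also have "\<dots> = real N * \<epsilon> * coef N m + real N * (\<Sum>j\<in>?D. occur N m a j)"
    unfolding sum.distrib sum.inter_filter[OF finite_atMost, symmetric] sum_distrib_left[symmetric] occur_sum ..
  finally have 1: "\<bar>real N * (branch_weight \<Omega> a * removed N m a) - real N * prob a * coef N m\<bar>
     \<le> real N * \<epsilon> * coef N m + real N * (\<Sum>j\<in>?D. occur N m a j)" .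
  have 2: "(\<Sum>j\<in>?D. occur N m a j) * \<tau> ^ m \<le> F \<tau> ^ N * (2 * exp (- 2 * real N * \<epsilon>\<^sup>2))"
  proof -
    have "(\<Sum>j\<in>?D. occur N m a j) * \<tau> ^ m \<le> (\<Sum>j\<in>?D. F \<tau> ^ N * pmf (binomial_pmf N (prob a)) j)"
      unfolding sum_distrib_right using occur_bounds(2) prob_bounds by (intro sum_mono) auto
    also have "\<dots> = F \<tau> ^ N * measure_pmf.prob (binomial_pmf N (prob a)) ?D"
      by (simp add: measure_measure_pmf_finite sum_distrib_left)
    also have "\<dots> \<le> F \<tau> ^ N * measure_pmf.prob (binomial_pmf N (prob a)) {x. \<bar>real x / real N - prob a\<bar> \<ge> \<epsilon>}"
      using F_\<tau> by (intro mult_left_mono measure_pmf.finite_measure_mono) auto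
    also have "\<dots> \<le> F \<tau> ^ N * (2 * exp (- 2 * real N * \<epsilon>\<^sup>2))"
      using F_\<tau> bd.prob_abs_ge'[of \<epsilon>] \<epsilon> N by (intro mult_left_mono) auto
    finally show ?thesis .
  qed
  have "(\<Sum>j\<in>?D. occur N m a j) / coef N m \<le> 2 * exp (- 2 * real N * \<epsilon>\<^sup>2) / \<beta> N m"
    using 2 pos \<tau> F_\<tau> unfolding \<beta>_def by (simp add: field_simps)
  moreover have "\<bar>branch_weight \<Omega> a * removed N m a / coef N m - prob a\<bar> \<le> \<epsilon> + (\<Sum>j\<in>?D. occur N m a j) / coef N m"
  proof -
    define X where "X = branch_weight \<Omega> a * removed N m a"
    define Y where "Y = (\<Sum>j\<in>?D. occur N m a j)"
    define c where "c = coef N m"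
    have c: "c > 0" using pos by (simp add: c_def)
    have "real N * \<bar>X - prob a * c\<bar> \<le> real N * (\<epsilon> * c + Y)"
    proof -
      have "real N * X - real N * prob a * c = real N * (X - prob a * c)" by (simp add: algebra_simps)
      hence "real N * \<bar>X - prob a * c\<bar> = \<bar>real N * X - real N * prob a * c\<bar>" by (simp only: abs_mult abs_of_nat)
      also have "\<dots> \<le> real N * \<epsilon> * c + real N * Y" using 1 by (simp only: X_def Y_def c_def)
      finally show ?thesis by (simp add: algebra_simps)
    qed
    hence "\<bar>X - prob a * c\<bar> \<le> \<epsilon> * c + Y" using N by simp
    hence "\<bar>X - prob a * c\<bar> / c \<le> (\<epsilon> * c + Y) / c" using c by (intro divide_right_mono) auto
    moreover have "\<bar>X - prob a * c\<bar> / c = \<bar>X / c - prob a\<bar>"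
    proof -
      have "X / c - prob a = (X - prob a * c) / c" using c by (simp add: diff_divide_distrib)
      thus ?thesis using c by (simp add: abs_divide)
    qed
    ultimately show ?thesis using c unfolding X_def[symmetric] Y_def[symmetric] c_def[symmetric]
      by (simp add: add_divide_distrib)
  qed
  ultimately show ?thesis by linarith
qed

lemma step_ratio:
  assumes e: "e > 0" and C: "C \<ge> 0"
  shows "\<exists>N0. \<forall>N\<ge>N0. \<forall>m. \<bar>real k * real m - real N\<bar> \<le> C \<and> coef N m > 0 \<longrightarrow>
     \<bar>branch_weight \<Omega> a * removed N m a / coef N m - prob a\<bar> < e"
proof -
  define \<epsilon> where "\<epsilon> = e / 2"
  have \<epsilon>: "\<epsilon> > 0" using e by (simp add: \<epsilon>_def)
  obtain N0 where N0: "\<And>N m. N \<ge> N0 \<Longrightarrow> \<bar>real k * real m - real N\<bar> \<le> C \<Longrightarrow> coef N m > 0 \<Longrightarrow> \<beta> N m \<ge> exp (- (\<epsilon>\<^sup>2) * real N)"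
    using coef_subexponential[of "\<epsilon>\<^sup>2", OF _ C] \<epsilon> by auto
  have "eventually (\<lambda>N. 2 * exp (- (\<epsilon>\<^sup>2) * real N) < e / 2) sequentially"
  proof -
    have "(\<lambda>N. 2 * exp (- (\<epsilon>\<^sup>2) * real N)) \<longlonglongrightarrow> 0" using \<epsilon> by real_asymp
    thus ?thesis by (rule order_tendstoD) (use e in simp)
  qed
  then obtain N1 where N1: "\<And>N. N \<ge> N1 \<Longrightarrow> 2 * exp (- (\<epsilon>\<^sup>2) * real N) < e / 2" by (auto simp: eventually_sequentially)
  show ?thesis
  proof (intro exI[of _ "max 1 (max N0 N1)"] allI impI, elim conjE)
    fix N m assume N: "max 1 (max N0 N1) \<le> N" and m: "\<bar>real k * real m - real N\<bar> \<le> C" "coef N m > 0"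
    have b: "\<beta> N m \<ge> exp (- (\<epsilon>\<^sup>2) * real N)" using N0 N m by simp
    have "2 * exp (- 2 * real N * \<epsilon>\<^sup>2) / \<beta> N m \<le> 2 * exp (- 2 * real N * \<epsilon>\<^sup>2) / exp (- (\<epsilon>\<^sup>2) * real N)"
      by (rule divide_left_mono) (use b in \<open>auto intro: mult_pos_pos less_le_trans[OF exp_gt_zero b]\<close>)
    also have "\<dots> = 2 * exp (- (\<epsilon>\<^sup>2) * real N)"
    proof -
      have "exp (- 2 * real N * \<epsilon>\<^sup>2) = exp (- (\<epsilon>\<^sup>2) * real N) * exp (- (\<epsilon>\<^sup>2) * real N)"
        by (simp add: exp_add[symmetric] algebra_simps)
      thus ?thesis by simp
    qed
    finally have "2 * exp (- 2 * real N * \<epsilon>\<^sup>2) / \<beta> N m < e / 2" using N1[of N] N by linarith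
    moreover have "\<bar>branch_weight \<Omega> a * removed N m a / coef N m - prob a\<bar> \<le> \<epsilon> + 2 * exp (- 2 * real N * \<epsilon>\<^sup>2) / \<beta> N m"
      by (rule occur_concentration[OF _ \<epsilon> m(2)]) (use N in simp)
    ultimately show "\<bar>branch_weight \<Omega> a * removed N m a / coef N m - prob a\<bar> < e" by (simp add: \<epsilon>_def)
  qed
qed

definition feasible :: "nat filter" where
  "feasible = inf sequentially (principal {n. coef (k * n + 1) (n - 1) > 0})"

lemma eventually_feasible:
  "eventually P feasible \<longleftrightarrow> eventually (\<lambda>n. coef (k * n + 1) (n - 1) > 0 \<longrightarrow> P n) sequentially"
  unfolding feasible_def eventually_inf_principal by simp

text \<open>Each element of the list is one step \<open>(N, m) \<mapsto> (N - 1, m - a)\<close>, and \<open>k m - N\<close> stays bounded.\<close>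

lemma prefix_ratio:
  assumes "\<forall>a\<in>set as. branch_weight \<Omega> a > 0"
  shows "((\<lambda>n. coef (k * n + 1 - length as) (n - 1 - sum_list as) / coef (k * n + 1) (n - 1))
    \<longlongrightarrow> prod_list (map (\<lambda>a. \<tau> ^ a / F \<tau>) as)) feasible"
  using assms
proof (induction as rule: rev_induct)
  case Nil
  have "eventually (\<lambda>n. coef (k * n + 1 - length ([] :: nat list)) (n - 1 - sum_list []) / coef (k * n + 1) (n - 1) = 1) feasible"
    unfolding eventually_feasible by simp
  thus ?case by (simp add: tendsto_eventually)
next
  case (snoc a as)
  let ?N = "\<lambda>n. k * n + 1 - length as" and ?m = "\<lambda>n. n - 1 - sum_list as"
  let ?P = "prod_list (map (\<lambda>a. \<tau> ^ a / F \<tau>) as)"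
  have IH: "((\<lambda>n. coef (?N n) (?m n) / coef (k * n + 1) (n - 1)) \<longlongrightarrow> ?P) feasible"
    using snoc by simp
  have "?P > 0" by (induction as) (use \<tau> F_\<tau> in auto)
  hence "eventually (\<lambda>n. coef (?N n) (?m n) / coef (k * n + 1) (n - 1) > 0) feasible"
    using order_tendstoD(1)[OF IH] by simp
  hence pos: "eventually (\<lambda>n. coef (?N n) (?m n) > 0) feasible"
  proof (rule eventually_mono)
    fix n assume "coef (?N n) (?m n) / coef (k * n + 1) (n - 1) > 0"
    thus "coef (?N n) (?m n) > 0"
      using branch_power_nonneg[of \<Omega> "?N n" "?m n"] by (metis div_0 less_irrefl order_le_less)
  qed
  define C where "C = real k + real k * real (sum_list as) + real (length as) + 1"
  have large: "eventually (\<lambda>n. n \<ge> n0) feasible" for n0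
    unfolding eventually_feasible by (rule eventually_mono[OF eventually_ge_at_top[of n0]]) simp
  have ratio: "((\<lambda>n. branch_weight \<Omega> a * removed (?N n) (?m n) a / coef (?N n) (?m n)) \<longlongrightarrow> prob a) feasible"
  proof (rule tendstoI)
    fix e :: real assume e: "e > 0"
    obtain N0 where N0: "\<And>N m. N \<ge> N0 \<Longrightarrow> \<bar>real k * real m - real N\<bar> \<le> C \<Longrightarrow> coef N m > 0 \<Longrightarrow>
       \<bar>branch_weight \<Omega> a * removed N m a / coef N m - prob a\<bar> < e"
      using step_ratio[OF e, of C a] by (auto simp: C_def)
    show "eventually (\<lambda>n. dist (branch_weight \<Omega> a * removed (?N n) (?m n) a / coef (?N n) (?m n)) (prob a) < e) feasible"
      using pos large[of "N0 + length as + sum_list as + 1"]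
    proof eventually_elim
      case (elim n)
      have kn: "n \<le> k * n" using k by (cases k) auto
      have le: "length as \<le> k * n + 1" using kn elim by linarith
      have rN: "real (?N n) = real k * real n + 1 - real (length as)" unfolding of_nat_diff[OF le] by simp
      have rm: "real (?m n) = real n - 1 - real (sum_list as)" using elim by (simp add: of_nat_diff)
      have d: "\<bar>real k * real (?m n) - real (?N n)\<bar> \<le> C"
      proof -
        have "real k * real (?m n) - real (?N n) = real (length as) - (real k + real k * real (sum_list as) + 1)"
          unfolding rN rm by (simp add: algebra_simps)
        moreover have "0 \<le> real k * real (sum_list as)" by simp
        ultimately show ?thesis unfolding C_def abs_le_iff by linarith
      qed
      have "N0 \<le> ?N n" using kn elim by linarith
      thus ?case unfolding dist_real_def by (rule N0[OF _ d elim(1)])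
    qed
  qed
  have bw: "branch_weight \<Omega> a > 0" using snoc.prems by simp
  have A: "((\<lambda>n. branch_weight \<Omega> a * removed (?N n) (?m n) a / coef (?N n) (?m n) / branch_weight \<Omega> a *
      (coef (?N n) (?m n) / coef (k * n + 1) (n - 1))) \<longlongrightarrow> prob a / branch_weight \<Omega> a * ?P) feasible"
    by (intro tendsto_mult tendsto_divide ratio IH tendsto_const) (use bw in simp)
  have B: "eventually (\<lambda>n. branch_weight \<Omega> a * removed (?N n) (?m n) a / coef (?N n) (?m n) / branch_weight \<Omega> a *
      (coef (?N n) (?m n) / coef (k * n + 1) (n - 1)) =
      coef (k * n + 1 - length (as @ [a])) (n - 1 - sum_list (as @ [a])) / coef (k * n + 1) (n - 1)) feasible"
    using pos large[of "1 + sum_list as + a"]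
  proof eventually_elim
    case (elim n)
    have "removed (?N n) (?m n) a = coef (k * n + 1 - length (as @ [a])) (n - 1 - sum_list (as @ [a]))"
      using elim by (simp add: removed_def)
    thus ?case using elim bw by simp
  qed
  have P: "prob a / branch_weight \<Omega> a * ?P = prod_list (map (\<lambda>a. \<tau> ^ a / F \<tau>) (as @ [a]))"
    using bw by (simp add: prob_def)
  show ?case by (rule iffD1[OF tendsto_cong[OF B] A[unfolded P]])
qed

end

section \<open>The limiting exploration process\<close>

text \<open>The law of the first \<open>i\<close> entries of the random sequence whose next entry has law \<open>K p\<close> after the
  prefix \<open>p\<close>.\<close>

primrec chain :: "(nat list \<Rightarrow> nat pmf) \<Rightarrow> nat \<Rightarrow> nat list pmf" where
  "chain K 0 = return_pmf []"
| "chain K (Suc i) = bind_pmf (chain K i) (\<lambda>ds. map_pmf (\<lambda>d. ds @ [d]) (K ds))"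

lemma length_chain: "ds \<in> set_pmf (chain K i) \<Longrightarrow> length ds = i"
  by (induction i arbitrary: ds) auto

lemma pmf_chain_Suc: "pmf (chain K (Suc i)) (ds @ [d]) = pmf (chain K i) ds * pmf (K ds) d"
proof -
  have e: "pmf (map_pmf (\<lambda>d. ds' @ [d]) (K ds')) (ds @ [d]) = indicator {ds} ds' * pmf (K ds) d" for ds'
  proof (cases "ds' = ds")
    case True
    have "pmf (map_pmf (\<lambda>d. ds @ [d]) (K ds)) (ds @ [d]) = pmf (K ds) d"
      by (rule pmf_map_inj') (auto simp: inj_on_def)
    thus ?thesis using True by simp
  next
    case False
    hence "ds @ [d] \<notin> (\<lambda>d. ds' @ [d]) ` set_pmf (K ds')" by auto
    thus ?thesis using False by (simp add: pmf_map_outside)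
  qed
  have "pmf (chain K (Suc i)) (ds @ [d]) = (\<integral>ds'. indicator {ds} ds' * pmf (K ds) d \<partial>measure_pmf (chain K i))"
    by (simp only: chain.simps pmf_bind e)
  also have "\<dots> = measure_pmf.prob (chain K i) {ds} * pmf (K ds) d" by simp
  finally show ?thesis by (simp only: measure_pmf_single)
qed

definition prefix_prob :: "nat set \<Rightarrow> nat \<Rightarrow> nat \<Rightarrow> nat list \<Rightarrow> real" where
  "prefix_prob \<Omega> k n p = (\<Sum>ds | ds \<in> words k n \<and> (\<exists>es. ds = p @ es). word_weight \<Omega> ds) / total_weight \<Omega> k n"

definition class_filter :: "nat set \<Rightarrow> nat \<Rightarrow> nat filter" where
  "class_filter \<Omega> k = inf sequentially (principal {n. labelled_Omega_ktrees \<Omega> k n \<noteq> {}})"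

text \<open>The interface between the analysis of weights and the construction of the limit: the limiting
  exploration never stops and respects \<open>\<Omega>\<close>, its prefixes have the limiting probabilities, and it
  finishes each level once the previous level is finished.\<close>

definition good_kernel :: "nat set \<Rightarrow> nat \<Rightarrow> (nat list \<Rightarrow> nat pmf) \<Rightarrow> bool" where
  "good_kernel \<Omega> k K \<longleftrightarrow>
     (\<forall>p. p \<noteq> [] \<longrightarrow> pmf (chain K (length p)) p > 0 \<longrightarrow> legal k 1 p \<and> after k 1 p > 0 \<and> word_weight \<Omega> p > 0) \<and>
     (\<forall>p. ((\<lambda>n. prefix_prob \<Omega> k n p) \<longlongrightarrow> pmf (chain K (length p)) p) (class_filter \<Omega> k)) \<and>
     (\<forall>l p. p \<noteq> [] \<longrightarrow> stopped l (canonical k p) \<longrightarrow>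
        (\<lambda>j. measure_pmf.prob (chain K (length p + j)) {ds. (\<exists>es. ds = p @ es) \<and> \<not> stopped (Suc l) (canonical k ds)})
          \<longlonglongrightarrow> 0)"

lemma eventually_class_filter:
  assumes "k \<ge> 1" "eventually (\<lambda>n. total_weight \<Omega> k n > 0 \<longrightarrow> P n) sequentially"
  shows "eventually P (class_filter \<Omega> k)"
  unfolding class_filter_def eventually_inf_principal
  using assms(2) by (rule eventually_mono) (use rooted_prob(1)[OF assms(1)] in auto)

lemma prefix_prob_Nil: "total_weight \<Omega> k n > 0 \<Longrightarrow> prefix_prob \<Omega> k n [] = 1"
  by (simp add: prefix_prob_def total_weight_def)

lemma prefix_prob_illegal: "\<not> legal k 1 p \<Longrightarrow> prefix_prob \<Omega> k n p = 0"
proof -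
  assume "\<not> legal k 1 p"
  hence "{ds. ds \<in> words k n \<and> (\<exists>es. ds = p @ es)} = {}" by (auto simp: words_def complete_append)
  thus ?thesis unfolding prefix_prob_def by (simp only: sum.empty div_0)
qed

lemma prefix_prob_eq:
  assumes "k \<ge> 1" "p \<noteq> []" "legal k 1 p" "sum_list p \<le> n" "n \<ge> 1"
  shows "prefix_prob \<Omega> k n p = word_weight \<Omega> p * forest_weight \<Omega> k (after k 1 p) (n - sum_list p) /
    (fps_nth (branch_fps \<Omega> ^ (k * n + 1)) (n - 1) / real n)"
  unfolding prefix_prob_def prefix_weight[OF assms(1-4)] total_weight_eq[OF assms(1,5)] ..

lemma forest_weight_active:
  assumes "legal k 1 p" "sum_list p \<le> n" "after k 1 p > 0"
  shows "forest_weight \<Omega> k (after k 1 p) (n - sum_list p) =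
    real (after k 1 p) / real (k * n + 1 - length p) * fps_nth (branch_fps \<Omega> ^ (k * n + 1 - length p)) (n - sum_list p)"
proof -
  obtain r where r: "n = sum_list p + r" using assms(2) by (metis le_Suc_ex)
  have "after k 1 p + k * (n - sum_list p) = k * n + 1 - length p"
    using legal_after[OF assms(1)] unfolding r by (simp add: algebra_simps)
  thus ?thesis using assms(3) by (simp add: forest_weight_def)
qed

section \<open>Scores of active fronts\<close>

definition level_count :: "nat \<Rightarrow> ('a \<times> nat) list \<Rightarrow> nat" where
  "level_count l C = length (filter (\<lambda>p. snd p = l) C)"

text \<open>The number of vertices at distance \<open>l\<close>, counted once for each active front that contains them. The
  count per front is an eigenvector of the replacement of a front by its children: a vertex at
  distance \<open>l\<close> survives in \<open>k - 1\<close> of the \<open>k\<close> children of each new hedron. So exploring a front with count \<open>s\<close>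
  changes the score by \<open>s ((k - 1) d - 1)\<close>, which has negative mean for the mean \<open>1 / k\<close> of \<open>d\<close>.\<close>

definition score :: "nat \<Rightarrow> ('a \<times> nat) list list \<Rightarrow> nat" where
  "score l Q = sum_list (map (level_count l) Q)"

lemma filter_update_length:
  "i < length C \<Longrightarrow> \<not> P x \<Longrightarrow>
    length (filter P (C[i := x])) + (if P (C ! i) then 1 else 0) = length (filter P C)"
proof (induction C arbitrary: i)
  case (Cons c C)
  thus ?case by (cases i) auto
qed simp

lemma score_mset: "mset Q = mset Q' \<Longrightarrow> score l Q = score l Q'"
  unfolding score_def by (metis mset_map sum_mset_sum_list)

lemma score_kids:
  assumes "lev C = l"
  shows "score l (kids C L) + length L * level_count l C = length L * (length C * level_count l C)"
proof (induction L)
  case (Cons v L)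
  let ?P = "\<lambda>p::'a \<times> nat. snd p = l"
  let ?x = "(v, Suc (lev C))"
  have "(\<Sum>i<length C. level_count l (C[i := ?x])) + level_count l C
      = (\<Sum>i<length C. level_count l (C[i := ?x])) + (\<Sum>i<length C. if ?P (C ! i) then 1 else 0)"
    by (simp add: level_count_def length_filter_conv_card sum.If_cases Int_def conj_commute)
  also have "\<dots> = (\<Sum>i<length C. level_count l (C[i := ?x]) + (if ?P (C ! i) then 1 else 0))"
    by (rule sum.distrib[symmetric])
  also have "\<dots> = (\<Sum>i<length C. level_count l C)"
    unfolding level_count_def using assms by (intro sum.cong refl filter_update_length) auto
  finally have 1: "(\<Sum>i<length C. level_count l (C[i := ?x])) + level_count l C = length C * level_count l C" by simp
  have 2: "score l (kids C (v # L)) = (\<Sum>i<length C. level_count l (C[i := ?x])) + score l (kids C L)"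
    by (simp add: score_def kids_def comp_def interv_sum_list_conv_sum_set_nat atLeast0LessThan)
  show ?case unfolding 2 using 1 Cons.IH by (simp add: algebra_simps)
qed (simp add: score_def kids_def)

lemma unfinished_cases:
  assumes k: "k \<ge> 1" and st: "stopped l (canonical k ds)" "\<not> stopped (Suc l) (canonical k ds)"
  obtains D E C Q where "canonical k ds = (D, E, C # Q)" "lev C = l" "length C = k"
    "1 \<le> level_count l C" "level_count l C \<le> k"
proof -
  obtain C' where C': "C' \<in> set (act (canonical k ds))" "\<not> Suc l \<le> lev C'" using st(2) by (auto simp: stopped_def)
  hence "act (canonical k ds) \<noteq> []" by auto
  then obtain D E C Q where s: "canonical k ds = (D, E, C # Q)" by (rule state_Cons_cases)
  have I: "exploration_inv k {0..<k} (canonical k ds)" using inv_canonical[OF k] by blast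
  have "sorted (map lev (C # Q))" "length C = k" using I s by (auto simp: exploration_inv_def)
  hence "lev C \<le> lev C'" using C' s by auto
  moreover have "l \<le> lev C" using st(1) s by (auto simp: stopped_def)
  ultimately have lC: "lev C = l" using C' by simp
  have "C \<noteq> []" using \<open>length C = k\<close> k by auto
  then obtain u where "(u, l) \<in> set C" using lev_attained[of C] lC by auto
  hence "filter (\<lambda>p. snd p = l) C \<noteq> []" by (auto simp: filter_empty_conv intro: bexI[of _ "(u, l)"])
  hence "1 \<le> level_count l C" by (simp add: level_count_def Suc_le_eq)
  moreover have "level_count l C \<le> k" using \<open>length C = k\<close> by (auto simp: level_count_def)
  ultimately show ?thesis using that s lC \<open>length C = k\<close> by blast
qed

lemma score_step:
  assumes s: "canonical k ds = (D, E, C # Q)" and C: "lev C = l" "length C = k"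
  shows "score l (act (canonical k (ds @ [d]))) + level_count l C + d * level_count l C =
    score l (act (canonical k ds)) + d * (k * level_count l C)"
proof -
  let ?L = "[k + sum_list ds..<k + sum_list ds + d]"
  have "act (canonical k (ds @ [d])) = foldr (insort_key lev) (kids C ?L) Q"
    by (simp add: canonical_snoc s)
  hence "score l (act (canonical k (ds @ [d]))) = score l (kids C ?L @ Q)"
    by (intro score_mset) (simp add: mset_foldr_insort)
  also have "\<dots> = score l (kids C ?L) + score l Q" by (simp add: score_def)
  finally have 1: "score l (act (canonical k (ds @ [d]))) = score l (kids C ?L) + score l Q" .
  have 2: "score l (act (canonical k ds)) = level_count l C + score l Q" by (simp add: s score_def)
  show ?thesis unfolding 1 2 using score_kids[OF C(1), of ?L] C(2) by simp
qed

lemma illegal_stuck: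
  assumes "k \<ge> 1" "\<not> legal k 1 ds" shows "act (canonical k ds) = []"
  using assms(2)
proof (induction ds rule: rev_induct)
  case (snoc d ds)
  have "act (canonical k ds) = []"
  proof (cases "legal k 1 ds")
    case True
    hence "after k 1 ds = 0" using snoc.prems by (simp add: legal_append)
    thus ?thesis using length_act_canonical[OF assms(1) True] by simp
  qed (use snoc in simp)
  thus ?case by (simp add: canonical_snoc grow_stuck)
qed simp

lemma pmf_of_sums:
  fixes f :: "nat \<Rightarrow> real"
  assumes "\<And>d. f d \<ge> 0" "f sums 1"
  shows "\<exists>p. \<forall>d. pmf p d = f d"
proof -
  have "(\<integral>\<^sup>+x. ennreal (f x) \<partial>count_space UNIV) = (\<Sum>d. ennreal (f d))" by (rule nn_integral_count_space_nat)
  also have "\<dots> = ennreal (\<Sum>d. f d)" using assms by (intro suminf_ennreal2) (auto simp: sums_iff)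
  also have "\<dots> = 1" using assms(2) by (simp add: sums_iff)
  finally have "\<forall>d. pmf (embed_pmf f) d = f d" using assms(1) by (auto intro!: pmf_embed_pmf)
  thus ?thesis by blast
qed

section \<open>The critical case\<close>

context critical
begin

lemma prob_sums: "prob sums 1"
  using \<beta>_sums[of 1] by (simp add: \<beta>_def[abs_def] prob_def[abs_def])

lemma prob_mean: "(\<lambda>d. real k * real d * prob d) sums 1"
proof -
  let ?F' = "eval_fps (fps_deriv (branch_fps \<Omega>)) \<tau>"
  have r: "fps_conv_radius (fps_deriv (branch_fps \<Omega>)) = \<infinity>"
    using fps_conv_radius_deriv[of "branch_fps \<Omega>"] by simp
  have "(\<lambda>d. fps_nth (fps_deriv (branch_fps \<Omega>)) d * \<tau> ^ d) sums ?F'"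
    by (rule sums_eval_fps) (simp add: r)
  hence "(\<lambda>d. real (Suc d) * branch_weight \<Omega> (Suc d) * \<tau> ^ d * (real k * \<tau> / F \<tau>)) sums (?F' * (real k * \<tau> / F \<tau>))"
    by (intro sums_mult2) simp
  moreover have "?F' * (real k * \<tau> / F \<tau>) = 1" using \<tau>(2) F_\<tau> by (simp add: F_def field_simps)
  moreover have "real (Suc d) * branch_weight \<Omega> (Suc d) * \<tau> ^ d * (real k * \<tau> / F \<tau>) = real k * real (Suc d) * prob (Suc d)" for d
    by (simp add: prob_def mult_ac del: of_nat_Suc)
  ultimately have "(\<lambda>d. real k * real (Suc d) * prob (Suc d)) sums 1" by (simp only:)
  thus ?thesis by (subst (asm) sums_Suc_iff) simp
qed

text \<open>The conditioned process is the Doob transform of the random walk of the number of active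
  fronts with respect to its harmonic function \<open>q \<mapsto> q\<close>.\<close>

lemma kernel_sums:
  assumes "q > 0"
  shows "(\<lambda>d. prob d * real (q - 1 + k * d) / real q) sums 1"
proof -
  have "(\<lambda>d. prob d * ((real q - 1) / real q) + real k * real d * prob d * (1 / real q)) sums
      (1 * ((real q - 1) / real q) + 1 * (1 / real q))"
    by (intro sums_add sums_mult2 prob_sums prob_mean)
  moreover have "1 * ((real q - 1) / real q) + 1 * (1 / real q) = 1" using assms by (simp add: diff_divide_distrib)
  moreover have "prob d * ((real q - 1) / real q) + real k * real d * prob d * (1 / real q) = prob d * real (q - 1 + k * d) / real q" for d
  proof -
    have "real (q - 1 + k * d) = real q - 1 + real k * real d" using assms by (simp add: of_nat_diff)
    thus ?thesis by (simp only:) (simp add: add_divide_distrib[symmetric] algebra_simps)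
  qed
  ultimately show ?thesis by simp
qed

definition kernel :: "nat list \<Rightarrow> nat pmf" where
  "kernel p = (if p = [] then map_pmf Suc (SOME K. \<forall>d. pmf K d = prob d)
     else SOME K. after k 1 p > 0 \<longrightarrow> (\<forall>d. pmf K d = prob d * real (after k 1 p - 1 + k * d) / real (after k 1 p)))"

lemma kernel_Nil: "pmf (kernel []) d = (if d = 0 then 0 else prob (d - 1))"
proof -
  define K where "K = (SOME K. \<forall>d. pmf K d = prob d)"
  have "\<exists>K. \<forall>d. pmf K d = prob d" by (rule pmf_of_sums) (auto simp: prob_bounds prob_sums)
  hence K: "\<forall>d. pmf K d = prob d" unfolding K_def by (rule someI_ex)
  have "pmf (map_pmf Suc K) (Suc d') = pmf K d'" for d' by (rule pmf_map_inj') simp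
  moreover have "pmf (map_pmf Suc K) 0 = 0" by (rule pmf_map_outside) auto
  ultimately show ?thesis using K unfolding kernel_def K_def[symmetric] by (cases d) auto
qed

lemma kernel_step:
  assumes "p \<noteq> []" "after k 1 p > 0"
  shows "pmf (kernel p) d = prob d * real (after k 1 p - 1 + k * d) / real (after k 1 p)"
proof -
  have "\<exists>K. \<forall>d. pmf K d = prob d * real (after k 1 p - 1 + k * d) / real (after k 1 p)"
    by (rule pmf_of_sums[OF _ kernel_sums[OF assms(2)]]) (simp add: prob_bounds)
  hence "\<exists>K. after k 1 p > 0 \<longrightarrow> (\<forall>d. pmf K d = prob d * real (after k 1 p - 1 + k * d) / real (after k 1 p))" by blast
  from someI_ex[OF this] show ?thesis using assms unfolding kernel_def by auto
qed

text \<open>The probability of the word under independent entries with distribution \<open>prob\<close>, the first one shifted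
  by one, multiplied with the ratio of the final number \<open>q\<close> of active fronts and its value \<open>k d\<close> after
  the first entry \<open>d\<close>; the quotient by \<open>d\<close> is part of the weight \<open>1 / d!\<close> of the root front.\<close>

definition limit_weight :: "nat list \<Rightarrow> real" where
  "limit_weight p = (if legal k 1 p then word_weight \<Omega> p * (real (after k 1 p) / real k) *
     prod_list (map (\<lambda>a. \<tau> ^ a / F \<tau>) ((hd p - 1) # tl p)) else 0)"

lemma chain_kernel:
  assumes "p \<noteq> []" shows "pmf (chain kernel (length p)) p = limit_weight p"
  using assms
proof (induction p rule: rev_induct)
  case (snoc d p)
  have c: "pmf (chain kernel (length (p @ [d]))) (p @ [d]) = pmf (chain kernel (length p)) p * pmf (kernel p) d"
    using pmf_chain_Suc[of kernel "length p" p d] by simp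
  show ?case
  proof (cases "p = []")
    case True
    show ?thesis
    proof (cases d)
      case 0
      thus ?thesis using c True by (simp add: kernel_Nil limit_weight_def)
    next
      case (Suc a)
      have "weight \<Omega> (Suc a) * real (Suc a) = branch_weight \<Omega> a"
        by (simp add: weight_def branch_weight_def field_simps del: of_nat_Suc)
      moreover have "real (k * Suc a) / real k = real (Suc a)"
        unfolding of_nat_mult by (rule nonzero_mult_div_cancel_left) (use k in simp)
      moreover have "word_weight \<Omega> [Suc a] = weight \<Omega> (Suc a)" by (simp add: word_weight_def)
      ultimately have "word_weight \<Omega> [Suc a] * (real (k * Suc a) / real k) * (\<tau> ^ a / F \<tau>) = prob a"
        by (simp only: prob_def times_divide_eq_right)
      thus ?thesis using c True Suc by (simp add: kernel_Nil limit_weight_def del: of_nat_mult)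
    qed
  next
    case False
    have IH: "pmf (chain kernel (length p)) p = limit_weight p" using snoc False by simp
    show ?thesis
    proof (cases "legal k 1 p \<and> after k 1 p > 0")
      case False': False
      hence "limit_weight p = 0" "\<not> legal k 1 (p @ [d])" by (auto simp: limit_weight_def legal_append)
      thus ?thesis using c IH by (simp add: limit_weight_def)
    next
      case True
      let ?q = "after k 1 p"
      have 1: "legal k 1 (p @ [d])" "after k 1 (p @ [d]) = ?q - 1 + k * d" using True by (auto simp: legal_append after_append)
      have 2: "word_weight \<Omega> (p @ [d]) = word_weight \<Omega> p * branch_weight \<Omega> d" using word_weight_append[OF False, of \<Omega> "[d]"] by simp
      have 3: "hd (p @ [d]) = hd p" "tl (p @ [d]) = tl p @ [d]" using False by auto
      have 4: "limit_weight p = word_weight \<Omega> p * (real ?q / real k) * prod_list (map (\<lambda>a. \<tau> ^ a / F \<tau>) ((hd p - 1) # tl p))"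
        using True by (simp add: limit_weight_def)
      have 5: "pmf (kernel p) d = branch_weight \<Omega> d * \<tau> ^ d / F \<tau> * real (?q - 1 + k * d) / real ?q"
        using kernel_step[OF False] True by (simp add: prob_def)
      have "limit_weight (p @ [d]) = word_weight \<Omega> p * branch_weight \<Omega> d * (real (?q - 1 + k * d) / real k) *
         (prod_list (map (\<lambda>a. \<tau> ^ a / F \<tau>) ((hd p - 1) # tl p)) * (\<tau> ^ d / F \<tau>))"
        unfolding limit_weight_def using 1 2 3 by (simp del: of_nat_add of_nat_mult)
      also have "\<dots> = limit_weight p * pmf (kernel p) d"
        unfolding 4 5 using True by (simp del: of_nat_add of_nat_mult)
      finally show ?thesis using c IH by simp
    qed
  qed
qed simp

lemma branch_pos_of_word_weight:
  assumes "p \<noteq> []" "word_weight \<Omega> p > 0" "hd p \<ge> 1"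
  shows "\<forall>a\<in>set ((hd p - 1) # tl p). branch_weight \<Omega> a > 0"
proof -
  obtain d ds where p: "p = d # ds" using assms(1) by (cases p) auto
  have "weight \<Omega> d * prod_list (map (branch_weight \<Omega>) ds) > 0" using assms(2) p by (simp add: word_weight_def)
  hence "weight \<Omega> d * prod_list (map (branch_weight \<Omega>) ds) \<noteq> 0" by (metis less_irrefl)
  hence "d \<in> \<Omega>" "\<forall>a\<in>set ds. branch_weight \<Omega> a \<noteq> 0"
    by (auto simp: weight_def prod_list_zero_iff split: if_splits)
  thus ?thesis using assms(3) p branch_weight_nonneg[of \<Omega>] by (auto simp: branch_weight_def less_le)
qed

lemma class_filter_le: "class_filter \<Omega> k \<le> feasible"
proof (rule filter_leI)
  fix P assume "eventually P feasible"
  hence P: "eventually (\<lambda>n. coef (k * n + 1) (n - 1) > 0 \<longrightarrow> P n) sequentially" unfolding eventually_feasible .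
  show "eventually P (class_filter \<Omega> k)"
  proof (rule eventually_class_filter[OF k])
    show "eventually (\<lambda>n. total_weight \<Omega> k n > 0 \<longrightarrow> P n) sequentially"
      using P eventually_ge_at_top[of 1]
    proof eventually_elim
      case (elim n)
      show ?case
      proof
        assume "total_weight \<Omega> k n > 0"
        hence "coef (k * n + 1) (n - 1) / real n > 0" using total_weight_eq[OF k, of n \<Omega>] elim by simp
        hence "coef (k * n + 1) (n - 1) > 0" using branch_power_nonneg[of \<Omega> "k * n + 1" "n - 1"]
          by (metis div_0 less_irrefl order_le_less)
        thus "P n" using elim by blast
      qed
    qed
  qed
qed

lemma prefix_prob_tendsto:
  "((\<lambda>n. prefix_prob \<Omega> k n p) \<longlongrightarrow> pmf (chain kernel (length p)) p) (class_filter \<Omega> k)"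
proof (cases "p = []")
  case True
  have "eventually (\<lambda>n. prefix_prob \<Omega> k n p = 1) (class_filter \<Omega> k)"
    by (rule eventually_class_filter[OF k]) (simp add: True prefix_prob_Nil)
  thus ?thesis using True by (simp add: tendsto_eventually)
next
  case False
  show ?thesis unfolding chain_kernel[OF False]
  proof (cases "legal k 1 p \<and> word_weight \<Omega> p > 0 \<and> after k 1 p > 0")
    case neg: False
    have nz: "word_weight \<Omega> p = 0 \<or> after k 1 p = 0" if "legal k 1 p"
      using neg that word_weight_nonneg[of \<Omega> p] by (metis gr0I order_le_less)
    have l0: "limit_weight p = 0" using nz by (auto simp: limit_weight_def)
    have "eventually (\<lambda>n. prefix_prob \<Omega> k n p = 0) sequentially"
      using eventually_ge_at_top[of "sum_list p + 1"]
    proof eventually_elim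
      case (elim n)
      show ?case
      proof (cases "legal k 1 p")
        case True
        have "word_weight \<Omega> p * forest_weight \<Omega> k (after k 1 p) (n - sum_list p) = 0"
          using nz[OF True] elim by (auto simp: forest_weight_def)
        thus ?thesis using prefix_prob_eq[OF k False True, of n \<Omega>] elim by simp
      qed (simp add: prefix_prob_illegal)
    qed
    hence "eventually (\<lambda>n. prefix_prob \<Omega> k n p = 0) (class_filter \<Omega> k)"
      by (intro eventually_class_filter[OF k]) (auto elim: eventually_mono)
    thus "((\<lambda>n. prefix_prob \<Omega> k n p) \<longlongrightarrow> limit_weight p) (class_filter \<Omega> k)"
      unfolding l0 by (simp add: tendsto_eventually)
  next
    case True
    let ?q = "after k 1 p" let ?as = "(hd p - 1) # tl p"
    obtain d ds where p: "p = d # ds" using False by (cases p) auto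
    have d: "hd p \<ge> 1"
    proof (rule ccontr)
      assume "\<not> hd p \<ge> 1"
      hence "d = 0" using p by simp
      hence "legal k 0 ds" "after k 0 ds > 0" using True p by auto
      thus False by (cases ds) auto
    qed
    have ln: "length ?as = length p" "sum_list ?as = sum_list p - 1" "sum_list p \<ge> 1" using p d by auto
    have R: "((\<lambda>n. coef (k * n + 1 - length ?as) (n - 1 - sum_list ?as) / coef (k * n + 1) (n - 1))
       \<longlongrightarrow> prod_list (map (\<lambda>a. \<tau> ^ a / F \<tau>) ?as)) (class_filter \<Omega> k)"
      by (rule tendsto_mono[OF class_filter_le prefix_ratio[OF branch_pos_of_word_weight[OF False _ d]]]) (use True in simp)
    have lim: "(\<lambda>n. real n / (real k * real n + 1 - real (length p))) \<longlonglongrightarrow> 1 / real k"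
    proof -
      have "(\<lambda>n. real n / (real k * real n + 1 - real (length p))) \<longlonglongrightarrow> inverse (real k)"
        using k by real_asymp
      thus ?thesis by (simp add: inverse_eq_divide)
    qed
    have cs: "class_filter \<Omega> k \<le> sequentially" unfolding class_filter_def by simp
    have A: "((\<lambda>n. word_weight \<Omega> p * real ?q * (real n / (real k * real n + 1 - real (length p))) *
        (coef (k * n + 1 - length ?as) (n - 1 - sum_list ?as) / coef (k * n + 1) (n - 1))) \<longlongrightarrow>
        word_weight \<Omega> p * real ?q * (1 / real k) * prod_list (map (\<lambda>a. \<tau> ^ a / F \<tau>) ?as)) (class_filter \<Omega> k)"
      by (intro tendsto_mult tendsto_const R tendsto_mono[OF cs lim])
    have P: "word_weight \<Omega> p * real ?q * (1 / real k) * prod_list (map (\<lambda>a. \<tau> ^ a / F \<tau>) ?as) = limit_weight p"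
      unfolding limit_weight_def using True by simp
    have "eventually (\<lambda>n. word_weight \<Omega> p * real ?q * (real n / (real k * real n + 1 - real (length p))) *
        (coef (k * n + 1 - length ?as) (n - 1 - sum_list ?as) / coef (k * n + 1) (n - 1)) = prefix_prob \<Omega> k n p) sequentially"
      using eventually_ge_at_top[of "sum_list p + length p + 1"]
    proof eventually_elim
      case (elim n)
      have kn: "n \<le> k * n" using k by (cases k) auto
      have le: "length p \<le> k * n + 1" using kn elim by linarith
      have rN: "real (k * n + 1 - length p) = real k * real n + 1 - real (length p)" unfolding of_nat_diff[OF le] by simp
      have m: "n - 1 - sum_list ?as = n - sum_list p" using ln elim by simp
      have n: "sum_list p \<le> n" "n \<ge> 1" using elim by auto
      have "prefix_prob \<Omega> k n p = word_weight \<Omega> p * (real ?q / (real k * real n + 1 - real (length p)) *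
          coef (k * n + 1 - length p) (n - sum_list p)) / (coef (k * n + 1) (n - 1) / real n)"
        using prefix_prob_eq[OF k False _ n, of \<Omega>] forest_weight_active[of k p n \<Omega>] True n unfolding rN by simp
      thus ?case unfolding m ln(1) by simp
    qed
    hence B: "eventually (\<lambda>n. word_weight \<Omega> p * real ?q * (real n / (real k * real n + 1 - real (length p))) *
        (coef (k * n + 1 - length ?as) (n - 1 - sum_list ?as) / coef (k * n + 1) (n - 1)) = prefix_prob \<Omega> k n p) (class_filter \<Omega> k)"
      by (rule filter_leD[OF cs])
    show "((\<lambda>n. prefix_prob \<Omega> k n p) \<longlongrightarrow> limit_weight p) (class_filter \<Omega> k)"
      by (rule iffD1[OF tendsto_cong[OF B] A[unfolded P]])
  qed
qed


text \<open>The increment of score plus number of active fronts at a front with count \<open>s\<close> is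
  \<open>(s (k - 1) + k) d - (s + 1)\<close>, with mean \<open>- s / k\<close>. Hence its exponential moments are below one for
  small \<open>\<theta>\<close>, uniformly in the finitely many values of \<open>s\<close>.\<close>

lemma exp_contraction:
  "\<exists>\<theta>>0. \<exists>\<kappa>. 0 \<le> \<kappa> \<and> \<kappa> < 1 \<and> (\<forall>s\<in>{1..k}.
     F (\<tau> * exp (real (s * (k - 1) + k) * \<theta>)) * exp (- real (s + 1) * \<theta>) \<le> \<kappa> * F \<tau>)"
proof -
  let ?g = "\<lambda>s \<theta>. F (\<tau> * exp (real (s * (k - 1) + k) * \<theta>)) * exp (- real (s + 1) * \<theta>)"
  have "\<exists>d>0. \<forall>h>0. h < d \<longrightarrow> ?g s h < F \<tau>" if s: "s \<in> {1..k}" for s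
  proof -
    have "real (s * (k - 1) + k) / real k - real (s + 1) = - (real s / real k)"
      using k by (simp add: of_nat_diff field_simps)
    hence "(real (s * (k - 1) + k) / real k - real (s + 1)) * F \<tau> < 0"
      using s k F_\<tau> by (simp add: mult_less_0_iff)
    from DERIV_neg_dec_right[OF tilt_deriv this] show ?thesis by simp
  qed
  then obtain d where d: "\<And>s. s \<in> {1..k} \<Longrightarrow> d s > 0" "\<And>s h. s \<in> {1..k} \<Longrightarrow> h > 0 \<Longrightarrow> h < d s \<Longrightarrow> ?g s h < F \<tau>"
    by metis
  define \<theta> where "\<theta> = Min (d ` {1..k}) / 2"
  have fin: "finite (d ` {1..k})" "d ` {1..k} \<noteq> {}" using k by auto
  have "Min (d ` {1..k}) > 0" using fin d(1) by (subst Min_gr_iff) auto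
  hence \<theta>: "\<theta> > 0" "\<theta> < Min (d ` {1..k})" by (auto simp: \<theta>_def)
  have less: "?g s \<theta> < F \<tau>" if s: "s \<in> {1..k}" for s
    by (rule d(2)[OF s \<theta>(1)]) (use \<theta>(2) s fin in \<open>auto dest: less_le_trans[OF _ Min_le]\<close>)
  define \<kappa> where "\<kappa> = Max ((\<lambda>s. ?g s \<theta> / F \<tau>) ` {1..k})"
  have fin': "finite ((\<lambda>s. ?g s \<theta> / F \<tau>) ` {1..k})" "(\<lambda>s. ?g s \<theta> / F \<tau>) ` {1..k} \<noteq> {}" using k by auto
  have "\<kappa> < 1" unfolding \<kappa>_def using less F_\<tau> by (subst Max_less_iff[OF fin']) auto
  moreover have le: "?g s \<theta> \<le> \<kappa> * F \<tau>" if s: "s \<in> {1..k}" for s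
  proof -
    have "?g s \<theta> / F \<tau> \<le> \<kappa>" unfolding \<kappa>_def by (rule Max_ge[OF fin'(1)]) (use s in auto)
    thus ?thesis using F_\<tau> by (simp add: divide_le_eq)
  qed
  moreover have "0 \<le> \<kappa>"
  proof -
    have "?g 1 \<theta> > 0" using F_pos[of "\<tau> * exp (real (1 * (k - 1) + k) * \<theta>)"] \<tau>(1) by simp
    hence "\<kappa> * F \<tau> > 0" using le[of 1] k by simp
    thus ?thesis using F_\<tau> by (simp add: zero_less_mult_iff)
  qed
  ultimately show ?thesis using \<theta>(1) by blast
qed

text \<open>Let \<open>Y\<close> be the score and \<open>q\<close> the number of active fronts. Under the untransformed walk,
  \<open>exp (\<theta> (Y + q))\<close> contracts while the level is unfinished. The Doob transform multiplies
  probabilities by \<open>q\<close>, so \<open>exp (\<theta> (Y + q)) / q\<close> contracts under the kernel; it is at least \<open>\<theta>\<close>, so the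
  probability of an unfinished level decays exponentially.\<close>

lemma phase_finishes:
  assumes p: "p \<noteq> []" and st: "stopped l (canonical k p)"
  shows "(\<lambda>j. measure_pmf.prob (chain kernel (length p + j)) {ds. (\<exists>es. ds = p @ es) \<and> \<not> stopped (Suc l) (canonical k ds)})
          \<longlonglongrightarrow> 0"
proof -
  \<comment> \<open>The factor \<open>1 / q\<close> undoes the Doob transform, so that \<open>V / q\<close> contracts by \<open>\<kappa>\<close> in each step.\<close>
  obtain \<theta> \<kappa> where \<theta>: "\<theta> > 0" and \<kappa>: "0 \<le> \<kappa>" "\<kappa> < 1"
    and contr: "\<And>s. s \<in> {1..k} \<Longrightarrow> F (\<tau> * exp (real (s * (k - 1) + k) * \<theta>)) * exp (- real (s + 1) * \<theta>) \<le> \<kappa> * F \<tau>"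
    using exp_contraction by blast
  define A where "A = {ds. (\<exists>es. ds = p @ es) \<and> \<not> stopped (Suc l) (canonical k ds)}"
  define q where "q = (\<lambda>ds. length (act (canonical k ds)))"
  define V where "V = (\<lambda>ds. exp (\<theta> * (real (score l (act (canonical k ds))) + real (q ds))))"
  define G where "G = (\<lambda>ds. if ds \<in> A then V ds / real (q ds) else 0)"
  have G0: "G ds \<ge> 0" for ds by (simp add: G_def V_def)
  have qpos: "q ds > 0" if "ds \<in> A" for ds using that by (auto simp: A_def q_def stopped_def)
  have step: "(\<integral>\<^sup>+d. ennreal (G (ds @ [d])) \<partial>measure_pmf (kernel ds)) \<le> ennreal \<kappa> * ennreal (G ds)"
    if len: "length ds \<ge> length p" for ds
  proof (cases "ds \<in> A")
    case False
    have "ds @ [d] \<notin> A" for d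
    proof
      assume a: "ds @ [d] \<in> A"
      then obtain es where es: "ds @ [d] = p @ es" by (auto simp: A_def)
      hence "es \<noteq> []" using len by auto
      then obtain es' where "es = es' @ [d]" "ds = p @ es'" using es by (cases es rule: rev_cases) auto
      hence "stopped (Suc l) (canonical k ds)" using False by (auto simp: A_def)
      hence "stopped (Suc l) (canonical k (ds @ [d]))" by (rule canonical_extends(4)[OF k])
      thus False using a by (simp add: A_def)
    qed
    thus ?thesis by (simp add: G_def)
  next
    case True
    then obtain es where es: "ds = p @ es" and ns: "\<not> stopped (Suc l) (canonical k ds)" by (auto simp: A_def)
    have stl: "stopped l (canonical k ds)" unfolding es by (rule canonical_extends(4)[OF k st])
    obtain D E C Q where s: "canonical k ds = (D, E, C # Q)" and C: "lev C = l" "length C = k"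
      and sb: "1 \<le> level_count l C" "level_count l C \<le> k" by (rule unfinished_cases[OF k stl ns])
    define sc where "sc = level_count l C"
    define u where "u = real (sc * (k - 1) + k)" define v where "v = real (sc + 1)"
    have q: "q ds > 0" using qpos[OF True] .
    have legal: "legal k 1 ds" using illegal_stuck[OF k] s by fastforce
    have aq: "after k 1 ds = q ds" using length_act_canonical[OF k legal] by (simp add: q_def)
    have dsn: "ds \<noteq> []" using p es by auto
    have kd: "pmf (kernel ds) d = prob d * real (q ds - 1 + k * d) / real (q ds)" for d
      using kernel_step[OF dsn] aq q by simp
    have qs: "q (ds @ [d]) = q ds - 1 + k * d" for d
      using length_act_snoc[OF k, of ds d] q by (simp add: q_def)
    have Vs: "V (ds @ [d]) = V ds * exp (u * \<theta>) ^ d * exp (- v * \<theta>)" for d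
    proof -
      have 1: "real (score l (act (canonical k (ds @ [d])))) = real (score l (act (canonical k ds))) + real d * real sc * (real k - 1) - real sc"
      proof -
        have "real (score l (act (canonical k (ds @ [d]))) + sc + d * sc) = real (score l (act (canonical k ds)) + d * (k * sc))"
          using score_step[OF s C, of d] by (simp only: sc_def)
        thus ?thesis by (simp add: algebra_simps)
      qed
      have 2: "real (q (ds @ [d])) = real (q ds) - 1 + real k * real d" unfolding qs using q by (simp add: of_nat_diff)
      have 3: "u = real sc * (real k - 1) + real k" unfolding u_def using k by (simp add: of_nat_diff)
      have "V (ds @ [d]) = exp (\<theta> * (real (score l (act (canonical k ds))) + real (q ds)) + (real d * (u * \<theta>) + - v * \<theta>))"
        unfolding V_def 1 2 3 v_def by (simp add: algebra_simps)
      thus ?thesis by (simp only: exp_add V_def exp_of_nat_mult mult.assoc)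
    qed
    define h where "h = (\<lambda>d. branch_weight \<Omega> d * (\<tau> * exp (u * \<theta>)) ^ d * (V ds * exp (- v * \<theta>) / (F \<tau> * real (q ds))))"
    have h0: "h d \<ge> 0" for d unfolding h_def V_def using \<tau> F_\<tau> by simp
    have hs: "h sums (F (\<tau> * exp (u * \<theta>)) * (V ds * exp (- v * \<theta>) / (F \<tau> * real (q ds))))"
      unfolding h_def by (rule sums_mult2[OF F_sums])
    have term_le: "pmf (kernel ds) d * G (ds @ [d]) \<le> h d" for d
    proof (cases "ds @ [d] \<in> A")
      case False
      thus ?thesis using h0 by (simp add: G_def)
    next
      case True
      hence "q (ds @ [d]) > 0" by (rule qpos)
      hence "real (q ds - 1 + k * d) > 0" unfolding qs by (rule of_nat_0_less_iff[THEN iffD2])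
      hence "pmf (kernel ds) d * G (ds @ [d]) = prob d * V (ds @ [d]) / real (q ds)"
      proof -
        have gen: "x * z / y * (w / z) = x * w / y" if "z > 0" for x y z w :: real using that by simp
        show ?thesis using gen[OF \<open>real (q ds - 1 + k * d) > 0\<close>] True unfolding kd G_def qs by (simp only: if_True)
      qed
      also have "\<dots> = h d" unfolding Vs h_def prob_def by (simp add: power_mult_distrib mult_ac)
      finally show ?thesis by simp
    qed
    have "(\<integral>\<^sup>+d. ennreal (G (ds @ [d])) \<partial>measure_pmf (kernel ds)) = (\<integral>\<^sup>+d. ennreal (pmf (kernel ds) d) * ennreal (G (ds @ [d])) \<partial>count_space UNIV)"
      by (rule nn_integral_measure_pmf)
    also have "\<dots> \<le> (\<integral>\<^sup>+d. ennreal (h d) \<partial>count_space UNIV)"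
      using term_le G0 by (intro nn_integral_mono) (simp add: ennreal_mult[symmetric] ennreal_leI)
    also have "\<dots> = ennreal (suminf h)"
      using h0 hs by (subst nn_integral_count_space_nat, subst suminf_ennreal2) (auto simp: sums_iff)
    also have "suminf h = F (\<tau> * exp (u * \<theta>)) * exp (- v * \<theta>) * (V ds / (F \<tau> * real (q ds)))"
      using hs by (simp add: sums_iff)
    also have "ennreal \<dots> \<le> ennreal (\<kappa> * F \<tau> * (V ds / (F \<tau> * real (q ds))))"
    proof (rule ennreal_leI, rule mult_right_mono)
      show "F (\<tau> * exp (u * \<theta>)) * exp (- v * \<theta>) \<le> \<kappa> * F \<tau>"
        unfolding u_def v_def by (rule contr) (use sb in \<open>simp add: sc_def\<close>)
      show "0 \<le> V ds / (F \<tau> * real (q ds))" using F_\<tau> by (simp add: V_def)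
    qed
    also have "\<kappa> * F \<tau> * (V ds / (F \<tau> * real (q ds))) = \<kappa> * G ds" using True F_\<tau> by (simp add: G_def)
    also have "ennreal (\<kappa> * G ds) = ennreal \<kappa> * ennreal (G ds)" using \<kappa> G0 by (simp add: ennreal_mult)
    finally show ?thesis .
  qed
  let ?I = "\<lambda>j. \<integral>\<^sup>+ds. ennreal (G ds) \<partial>measure_pmf (chain kernel (length p + j))"
  have I: "?I j \<le> ennreal (\<kappa> ^ j * G p)" for j
  proof (induction j)
    case 0
    have "?I 0 \<le> (\<integral>\<^sup>+ds. ennreal (G p) \<partial>measure_pmf (chain kernel (length p + 0)))"
    proof (rule nn_integral_mono_AE, unfold AE_measure_pmf_iff, rule ballI)
      fix ds assume "ds \<in> set_pmf (chain kernel (length p + 0))"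
      hence "length ds = length p" using length_chain by fastforce
      hence "ds = p \<or> ds \<notin> A" by (auto simp: A_def)
      thus "ennreal (G ds) \<le> ennreal (G p)" by (auto simp: G_def)
    qed
    also have "\<dots> = ennreal (G p)" by (simp add: measure_pmf.emeasure_space_1)
    finally show ?case by simp
  next
    case (Suc j)
    have "?I (Suc j) = (\<integral>\<^sup>+ds. \<integral>\<^sup>+d. ennreal (G (ds @ [d])) \<partial>measure_pmf (kernel ds) \<partial>measure_pmf (chain kernel (length p + j)))"
      by simp
    also have "\<dots> \<le> (\<integral>\<^sup>+ds. ennreal \<kappa> * ennreal (G ds) \<partial>measure_pmf (chain kernel (length p + j)))"
    proof (rule nn_integral_mono_AE, unfold AE_measure_pmf_iff, rule ballI)
      fix ds assume "ds \<in> set_pmf (chain kernel (length p + j))"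
      hence "length ds \<ge> length p" using length_chain by fastforce
      thus "(\<integral>\<^sup>+d. ennreal (G (ds @ [d])) \<partial>measure_pmf (kernel ds)) \<le> ennreal \<kappa> * ennreal (G ds)" by (rule step)
    qed
    also have "\<dots> = ennreal \<kappa> * ?I j" by (rule nn_integral_cmult) simp
    also have "\<dots> \<le> ennreal \<kappa> * ennreal (\<kappa> ^ j * G p)" by (rule mult_left_mono[OF Suc]) simp
    also have "\<dots> = ennreal (\<kappa> ^ Suc j * G p)" using \<kappa> G0 by (simp add: ennreal_mult[symmetric] mult.assoc)
    finally show ?case .
  qed
  have bound: "measure_pmf.prob (chain kernel (length p + j)) A \<le> \<kappa> ^ j * G p / \<theta>" for j
  proof -
    have ind: "indicator A ds \<le> ennreal (1 / \<theta>) * ennreal (G ds)" for ds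
    proof (cases "ds \<in> A")
      case True
      have q: "real (q ds) > 0" using qpos[OF True] by simp
      have "\<theta> * real (q ds) \<le> exp (\<theta> * real (q ds))" using exp_ge_add_one_self[of "\<theta> * real (q ds)"] by linarith
      also have "\<dots> \<le> V ds" unfolding V_def using \<theta> by (simp add: algebra_simps)
      finally have "1 \<le> 1 / \<theta> * (V ds / real (q ds))" using \<theta> q by (simp add: field_simps)
      hence "ennreal 1 \<le> ennreal (1 / \<theta> * G ds)" using True by (intro ennreal_leI) (simp add: G_def)
      also have "ennreal (1 / \<theta> * G ds) = ennreal (1 / \<theta>) * ennreal (G ds)"
        by (rule ennreal_mult) (use \<theta> G0 in auto)
      finally show ?thesis using True by (simp only: indicator_simps ennreal_1)
    qed simp
    have "ennreal (measure_pmf.prob (chain kernel (length p + j)) A) = (\<integral>\<^sup>+ds. indicator A ds \<partial>measure_pmf (chain kernel (length p + j)))"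
      by (simp add: measure_pmf.emeasure_eq_measure)
    also have "\<dots> \<le> (\<integral>\<^sup>+ds. ennreal (1 / \<theta>) * ennreal (G ds) \<partial>measure_pmf (chain kernel (length p + j)))"
      by (rule nn_integral_mono) (rule ind)
    also have "\<dots> = ennreal (1 / \<theta>) * ?I j" by (rule nn_integral_cmult) simp
    also have "\<dots> \<le> ennreal (1 / \<theta>) * ennreal (\<kappa> ^ j * G p)" by (rule mult_left_mono[OF I]) simp
    also have "\<dots> = ennreal (\<kappa> ^ j * G p / \<theta>)" using \<kappa> G0 \<theta> by (simp add: ennreal_mult[symmetric])
    finally show ?thesis using \<kappa> G0 \<theta> by (subst (asm) ennreal_le_iff) auto
  qed
  have "(\<lambda>j. \<kappa> ^ j * G p / \<theta>) \<longlonglongrightarrow> 0 * G p / \<theta>"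
    by (intro tendsto_intros LIMSEQ_realpow_zero \<kappa>) (use \<theta> in simp)
  hence lim: "(\<lambda>j. \<kappa> ^ j * G p / \<theta>) \<longlonglongrightarrow> 0" by simp
  have "(\<lambda>j. measure_pmf.prob (chain kernel (length p + j)) A) \<longlonglongrightarrow> 0"
  proof (rule real_tendsto_sandwich[OF _ _ tendsto_const lim])
    show "eventually (\<lambda>j. 0 \<le> measure_pmf.prob (chain kernel (length p + j)) A) sequentially" by simp
    show "eventually (\<lambda>j. measure_pmf.prob (chain kernel (length p + j)) A \<le> \<kappa> ^ j * G p / \<theta>) sequentially"
      by (intro always_eventually allI bound)
  qed
  thus ?thesis unfolding A_def .
qed

lemma good_kernel: "good_kernel \<Omega> k kernel"
  unfolding good_kernel_def
proof (intro conjI allI impI)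
  fix p :: "nat list" assume p: "p \<noteq> []" "0 < pmf (chain kernel (length p)) p"
  have lw: "limit_weight p > 0" using p chain_kernel by simp
  show "legal k 1 p" using lw by (auto simp: limit_weight_def split: if_splits)
  have "limit_weight p = 0" if "word_weight \<Omega> p = 0 \<or> after k 1 p = 0" using that by (auto simp: limit_weight_def)
  hence "word_weight \<Omega> p \<noteq> 0" "after k 1 p \<noteq> 0" using lw by auto
  thus "0 < after k 1 p" "0 < word_weight \<Omega> p" using word_weight_nonneg[of \<Omega> p] by (auto simp: order_le_less)
qed (use prefix_prob_tendsto phase_finishes in auto)

end

text \<open>The equation for \<open>\<tau>\<close> reads \<open>(\<Sum>d. (k d - 1) \<phi>_d \<tau>^d) = 0\<close>. Only the term with \<open>d = 0\<close> is
  negative, and the term with \<open>d = b\<close> is unbounded, so the intermediate value theorem gives a solution.\<close>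

lemma critical_exists:
  assumes "k \<ge> 1" "1 \<in> \<Omega>" "Suc b \<in> \<Omega>" "k * b \<ge> 2"
  shows "\<exists>\<tau>. critical \<Omega> k \<tau> b"
proof -
  let ?f = "branch_fps \<Omega>"
  define g where "g = (\<lambda>x. real k * x * eval_fps (fps_deriv ?f) x - eval_fps ?f x)"
  have r: "fps_conv_radius (fps_deriv ?f) = \<infinity>" using fps_conv_radius_deriv[of ?f] by simp
  have s1: "(\<lambda>d. branch_weight \<Omega> d * x ^ d) sums eval_fps ?f x" for x :: real
    using branch_power_sums[of \<Omega> 1 x] by simp
  have s2: "(\<lambda>d. real d * branch_weight \<Omega> d * x ^ d) sums (x * eval_fps (fps_deriv ?f) x)" for x :: real
  proof -
    have "(\<lambda>d. fps_nth (fps_deriv ?f) d * x ^ d) sums eval_fps (fps_deriv ?f) x"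
      by (rule sums_eval_fps) (simp add: r)
    hence "(\<lambda>d. x * (fps_nth (fps_deriv ?f) d * x ^ d)) sums (x * eval_fps (fps_deriv ?f) x)" by (rule sums_mult)
    hence "(\<lambda>d. real (Suc d) * branch_weight \<Omega> (Suc d) * x ^ Suc d) sums (x * eval_fps (fps_deriv ?f) x)"
      by (simp add: mult_ac)
    thus ?thesis by (subst (asm) sums_Suc_iff) simp
  qed
  have gs: "(\<lambda>d. (real k * real d - 1) * branch_weight \<Omega> d * x ^ d) sums g x" for x
  proof -
    have "(\<lambda>d. real k * (real d * branch_weight \<Omega> d * x ^ d) - branch_weight \<Omega> d * x ^ d) sums
        (real k * (x * eval_fps (fps_deriv ?f) x) - eval_fps ?f x)"
      by (intro sums_diff sums_mult s1 s2)
    thus ?thesis unfolding g_def by (simp add: algebra_simps)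
  qed
  have cont: "continuous_on {0..X} g" for X
    unfolding g_def by (intro continuous_intros) (auto simp: r)
  have b: "b \<ge> 1" using assms(4) by (cases b) auto
  have g0: "g 0 = -1"
  proof -
    have "(\<lambda>d. if d = 0 then -1 else 0 :: real) sums g 0"
    proof -
      have "(\<lambda>d. (real k * real d - 1) * branch_weight \<Omega> d * 0 ^ d) = (\<lambda>d. if d = 0 then -1 else 0 :: real)"
        using assms(2) by (intro ext) (auto simp: branch_weight_def power_0_left)
      thus ?thesis using gs[of 0] by simp
    qed
    moreover have "(\<lambda>d. if d = 0 then -1 else 0 :: real) sums -1" using sums_single[of 0 "\<lambda>_. -1 :: real"] by simp
    ultimately show ?thesis by (rule sums_unique2)
  qed
  \<comment> \<open>Large enough for the single positive term at \<open>b\<close> to outweigh the only negative term, at \<open>0\<close>.\<close>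
  define X where "X = fact b + (1 :: real)"
  have X: "X \<ge> 1" "X \<ge> 0" by (auto simp: X_def)
  have "g X \<ge> 0"
  proof -
    have pos: "(real k * real d - 1) * branch_weight \<Omega> d * X ^ d \<ge> 0" if "d \<noteq> 0" for d
    proof -
      have "1 * 1 \<le> real k * real d" by (rule mult_mono) (use assms(1) that in auto)
      thus ?thesis using X by simp
    qed
    have "(\<Sum>d\<in>{0, b}. (real k * real d - 1) * branch_weight \<Omega> d * X ^ d) \<le> g X"
    proof -
      have "(\<Sum>d\<in>{0, b}. (real k * real d - 1) * branch_weight \<Omega> d * X ^ d) \<le> (\<Sum>d. (real k * real d - 1) * branch_weight \<Omega> d * X ^ d)"
        by (rule sum_le_suminf) (use gs[of X] pos in \<open>auto simp: sums_iff\<close>)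
      thus ?thesis using gs[of X] by (simp add: sums_iff)
    qed
    moreover have "(\<Sum>d\<in>{0, b}. (real k * real d - 1) * branch_weight \<Omega> d * X ^ d) =
        - 1 + (real k * real b - 1) * (X ^ b / fact b)"
      using b assms(2,3) by (simp add: branch_weight_def)
    moreover have "(real k * real b - 1) * (X ^ b / fact b) \<ge> 1 * 1"
    proof (rule mult_mono)
      have "real (k * b) \<ge> 2" using assms(4) by (simp del: of_nat_mult)
      thus "1 \<le> real k * real b - 1" "0 \<le> real k * real b - 1" by simp_all
      have "X ^ 1 \<le> X ^ b" by (rule power_increasing[OF b X(1)])
      hence "fact b \<le> X ^ b" by (simp add: X_def)
      thus "1 \<le> X ^ b / fact b" by simp
    qed auto
    ultimately show ?thesis by linarith
  qed
  then obtain x where x: "0 \<le> x" "x \<le> X" "g x = 0"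
    using IVT'[of g 0 0 X] cont[of X] g0 X by auto
  hence "x \<noteq> 0" using g0 by auto
  hence "critical \<Omega> k x b" using x assms by unfold_locales (auto simp: g_def)
  thus ?thesis ..
qed

section \<open>Paths\<close>

text \<open>For \<open>k = 1\<close> and \<open>\<Omega> = {0, 1, 2}\<close> the trees are paths, and there is no critical parameter. The
  root is then with high probability not an end of the path, and the exploration finds one new
  edge at each active front.\<close>

definition path_word :: "nat \<Rightarrow> nat list" where
  "path_word i = (if i = 0 then [] else 2 # replicate (i - 1) 1)"

definition path_kernel :: "nat list \<Rightarrow> nat pmf" where
  "path_kernel p = return_pmf (if p = [] then 2 else 1)"

lemma path_word_Suc: "path_word (Suc i) = path_word i @ [if i = 0 then 2 else 1]"
  by (cases i) (auto simp: path_word_def replicate_append_same)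

lemma chain_path: "chain path_kernel i = return_pmf (path_word i)"
proof (induction i)
  case (Suc i)
  have "path_word i = [] \<longleftrightarrow> i = 0" by (simp add: path_word_def)
  thus ?case using Suc by (simp add: bind_return_pmf path_kernel_def path_word_Suc)
qed (simp add: path_word_def)

lemma path_word_weight: "1 \<in> \<Omega> \<Longrightarrow> 2 \<in> \<Omega> \<Longrightarrow> i > 0 \<Longrightarrow> word_weight \<Omega> (path_word i) = 1 / 2"
  by (simp add: path_word_def word_weight_def weight_def branch_weight_def numeral_2_eq_2)

lemma path_after: "i > 0 \<Longrightarrow> legal 1 1 (path_word i) \<and> after 1 1 (path_word i) = 2"
proof (induction i)
  case (Suc i)
  show ?case
  proof (cases "i = 0")
    case True thus ?thesis by (simp add: path_word_def)
  next
    case False thus ?thesis using Suc by (simp add: path_word_Suc legal_append after_append)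
  qed
qed simp

lemma path_fps:
  assumes "\<Omega> = {0, 1, 2}"
  shows "fps_nth (branch_fps \<Omega> ^ N) m = real (N choose m)"
proof -
  have "branch_fps \<Omega> = 1 + fps_X"
    by (rule fps_ext) (auto simp: assms branch_weight_def fps_X_def)
  hence "branch_fps \<Omega> ^ N = fps_binomial (of_nat N)" by (simp add: fps_binomial_of_nat)
  thus ?thesis by (simp add: binomial_gbinomial)
qed

text \<open>The number of active fronts after the root is at most two and never increases; it stays two only if
  the exploration finds one new vertex each time.\<close>

lemma path_legal_bound:
  assumes "\<Omega> = {0, 1, 2}" "p \<noteq> []" "legal 1 1 p" "word_weight \<Omega> p \<noteq> 0"
  shows "after 1 1 p \<le> 2 \<and> (after 1 1 p = 2 \<longrightarrow> p = path_word (length p))"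
  using assms(2-)
proof (induction p rule: rev_induct)
  case (snoc d p)
  show ?case
  proof (cases "p = []")
    case True
    hence "d \<in> \<Omega>" using snoc.prems by (auto simp: word_weight_def weight_def split: if_splits)
    thus ?thesis using True assms(1) by (auto simp: path_word_def)
  next
    case False
    have "word_weight \<Omega> p * branch_weight \<Omega> d \<noteq> 0" using snoc.prems(3) word_weight_append[OF False, of \<Omega> "[d]"] by simp
    hence w: "word_weight \<Omega> p \<noteq> 0" "Suc d \<in> \<Omega>" by (auto simp: branch_weight_def split: if_splits)
    hence d: "d \<le> 1" using assms(1) by auto
    have l: "legal 1 1 p" "after 1 1 p > 0" using snoc.prems by (auto simp: legal_append)
    have IH: "after 1 1 p \<le> 2 \<and> (after 1 1 p = 2 \<longrightarrow> p = path_word (length p))" using snoc.IH[OF False l(1) w(1)] .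
    have a: "after 1 1 (p @ [d]) = after 1 1 p - 1 + d" by (simp add: after_append)
    show ?thesis
    proof (intro conjI impI)
      show "after 1 1 (p @ [d]) \<le> 2" using a IH d by arith
      assume "after 1 1 (p @ [d]) = 2"
      hence "d = 1" "after 1 1 p = 2" using a IH d by auto
      moreover from this IH have "p = path_word (length p)" by simp
      ultimately show "p @ [d] = path_word (length (p @ [d]))" using False path_word_Suc[of "length p"] by simp
    qed
  qed
qed simp

lemma real_choose_2: "real (m choose 2) = real m * (real m - 1) / 2"
  by (induction m) (auto simp: numeral_2_eq_2 field_simps)

text \<open>The probability of a prefix with \<open>q\<close> active fronts is of order \<open>n^(q - 2)\<close>, so only the prefixes with
  \<open>q = 2\<close> keep mass.\<close>

lemma path_prefix_tendsto:
  assumes \<Omega>: "\<Omega> = {0, 1, 2}"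
  shows "((\<lambda>n. prefix_prob \<Omega> 1 n p) \<longlongrightarrow> pmf (chain path_kernel (length p)) p) (class_filter \<Omega> 1)"
proof (cases "p = []")
  case True
  have "eventually (\<lambda>n. prefix_prob \<Omega> 1 n p = 1) (class_filter \<Omega> 1)"
    by (rule eventually_class_filter) (simp_all add: True prefix_prob_Nil)
  thus ?thesis using True by (simp add: tendsto_eventually)
next
  case False
  have cs: "class_filter \<Omega> 1 \<le> sequentially" unfolding class_filter_def by simp
  let ?q = "after 1 1 p"
  have lp: "length p > 0" using False by simp
  have pm: "pmf (chain path_kernel (length p)) p = (if p = path_word (length p) then 1 else 0)"
    by (simp add: chain_path)
  have "(\<lambda>n. prefix_prob \<Omega> 1 n p) \<longlonglongrightarrow> pmf (chain path_kernel (length p)) p"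
  proof (cases "legal 1 1 p \<and> word_weight \<Omega> p \<noteq> 0 \<and> ?q > 0")
    case neg: False
    have "p \<noteq> path_word (length p)"
    proof
      assume e: "p = path_word (length p)"
      have "legal 1 1 p \<and> ?q = 2" using path_after[OF lp] e by simp
      moreover have "word_weight \<Omega> p = 1 / 2" using path_word_weight[OF _ _ lp, of \<Omega>] e \<Omega> by simp
      ultimately show False using neg by simp
    qed
    hence z: "pmf (chain path_kernel (length p)) p = 0" using pm by simp
    have "eventually (\<lambda>n. prefix_prob \<Omega> 1 n p = 0) sequentially"
      using eventually_ge_at_top[of "sum_list p + 1"]
    proof eventually_elim
      case (elim n)
      show ?case
      proof (cases "legal 1 1 p")
        case True
        hence "word_weight \<Omega> p = 0 \<or> ?q = 0" using neg by auto
        hence "word_weight \<Omega> p * forest_weight \<Omega> 1 ?q (n - sum_list p) = 0" using elim by (auto simp: forest_weight_def)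
        thus ?thesis using prefix_prob_eq[OF _ False True, of n \<Omega>] elim by simp
      qed (simp add: prefix_prob_illegal)
    qed
    thus ?thesis unfolding z by (rule tendsto_eventually)
  next
    case True
    hence q: "?q \<le> 2" "?q = 2 \<longrightarrow> p = path_word (length p)" using path_legal_bound[OF \<Omega> False] by auto
    have formula: "eventually (\<lambda>n. prefix_prob \<Omega> 1 n p = word_weight \<Omega> p * real ?q * real ((n + 1 - length p) choose ?q) / real (n + 1 - length p) *
        (2 / (real n + 1))) sequentially"
      using eventually_ge_at_top[of "sum_list p + length p + 1"]
    proof eventually_elim
      case (elim n)
      have "?q + length p = 1 + sum_list p" using legal_after[of 1 1 p] True by simp
      hence d: "n - sum_list p = (n + 1 - length p) - ?q" "?q \<le> n + 1 - length p" using elim by auto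
      have fw: "forest_weight \<Omega> 1 ?q (n - sum_list p) = real ?q / real (n + 1 - length p) * real ((n + 1 - length p) choose ?q)"
      proof -
        have "(n + 1 - length p) choose (n - sum_list p) = (n + 1 - length p) choose ?q"
          unfolding d(1) by (rule binomial_symmetric[OF d(2), symmetric])
        thus ?thesis using forest_weight_active[of 1 p n \<Omega>] True elim by (simp only: path_fps[OF \<Omega>] mult_1)
      qed
      have "(n + 1) choose (n - 1) = (n + 1) choose 2" using elim binomial_symmetric[of 2 "n + 1"] by simp
      hence tw: "fps_nth (branch_fps \<Omega> ^ (1 * n + 1)) (n - 1) = (real n + 1) * real n / 2"
        unfolding path_fps[OF \<Omega>] mult_1 using real_choose_2[of "n + 1"] by simp
      have n: "sum_list p \<le> n" "1 \<le> n" using elim by auto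
      have "prefix_prob \<Omega> 1 n p = word_weight \<Omega> p * (real ?q / real (n + 1 - length p) * real ((n + 1 - length p) choose ?q)) /
          (((real n + 1) * real n / 2) / real n)"
        using prefix_prob_eq[OF _ False _ n, of 1 \<Omega>] True unfolding fw tw by blast
      moreover have "((real n + 1) * real n / 2) / real n = (real n + 1) / 2" using n by simp
      moreover have "w * (a / N * b) / (z / 2) = w * a * b / N * (2 / z)" for w a N b z :: real by simp
      ultimately show ?case by (simp only:)
    qed
    show ?thesis
    proof (cases "?q = 2")
      case q2: True
      hence e: "p = path_word (length p)" using q by simp
      have w: "word_weight \<Omega> p = 1 / 2" using path_word_weight[OF _ _ lp, of \<Omega>] e \<Omega> by simp
      have "(\<lambda>n. (real n - real (length p)) / (real n + 1)) \<longlonglongrightarrow> 1" by real_asymp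
      moreover have "eventually (\<lambda>n. prefix_prob \<Omega> 1 n p = (real n - real (length p)) / (real n + 1)) sequentially"
        using formula eventually_ge_at_top[of "length p + 1"]
      proof eventually_elim
        case (elim n)
        have r: "real (n + 1 - length p) = real n + 1 - real (length p)" using elim by (simp add: of_nat_diff)
        have pos: "real (n + 1 - length p) > 0" using elim by simp
        have gen: "1 / 2 * 2 * (z * (z - 1) / 2) / z * (2 / y) = (z - 1) / y" if "z > 0" for z y :: real
          using that by (cases "y = 0") (auto simp: field_simps)
        have "prefix_prob \<Omega> 1 n p = (real (n + 1 - length p) - 1) / (real n + 1)"
          unfolding elim(1) q2 w real_choose_2 of_nat_numeral by (rule gen[OF pos])
        thus ?case unfolding r by simp
      qed
      moreover have "pmf (chain path_kernel (length p)) p = 1" using pm e by simp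
      ultimately show ?thesis using tendsto_cong by fastforce
    next
      case q1: False
      hence "?q = 1" using True q by simp
      have "p \<noteq> path_word (length p)" using path_after[OF lp] q1 by metis
      hence z: "pmf (chain path_kernel (length p)) p = 0" using pm by simp
      have "(\<lambda>n. word_weight \<Omega> p * (2 / (real n + 1))) \<longlonglongrightarrow> word_weight \<Omega> p * 0"
        by (intro tendsto_mult tendsto_const) real_asymp
      moreover have "eventually (\<lambda>n. prefix_prob \<Omega> 1 n p = word_weight \<Omega> p * (2 / (real n + 1))) sequentially"
        using formula eventually_ge_at_top[of "length p + 1"]
      proof eventually_elim
        case (elim n)
        have "real (n + 1 - length p) > 0" using elim by simp
        moreover have "w * real 1 * z / z * t = w * t" if "z > 0" for w z t :: real using that by simp
        ultimately show ?case unfolding elim(1) \<open>?q = 1\<close> choose_one by blast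
      qed
      ultimately show ?thesis unfolding z using tendsto_cong by fastforce
    qed
  qed
  thus ?thesis by (rule tendsto_mono[OF cs])
qed

text \<open>For \<open>k = 1\<close> the score decreases in every step.\<close>

lemma path_phase_finishes:
  assumes st: "stopped l (canonical 1 p)"
  shows "(\<lambda>j. measure_pmf.prob (chain path_kernel (length p + j)) {ds. (\<exists>es. ds = p @ es) \<and> \<not> stopped (Suc l) (canonical 1 ds)})
          \<longlonglongrightarrow> 0"
proof -
  let ?sc = "\<lambda>ds. score l (act (canonical 1 ds))"
  have dec: "?sc (p @ es) + length es \<le> ?sc p" if "\<not> stopped (Suc l) (canonical 1 (p @ es))" for es
    using that
  proof (induction es rule: rev_induct)
    case (snoc d es)
    have st1: "stopped l (canonical 1 (p @ es))" by (rule canonical_extends(4)[OF _ st]) simp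
    have ns: "\<not> stopped (Suc l) (canonical 1 (p @ es))"
      using snoc.prems canonical_extends(4)[of 1 "Suc l" "p @ es" "[d]"] by auto
    obtain D E C Q where s: "canonical 1 (p @ es) = (D, E, C # Q)" and C: "lev C = l" "length C = 1"
      and sb: "1 \<le> level_count l C" "level_count l C \<le> 1" by (rule unfinished_cases[OF _ st1 ns]) simp
    show ?case using score_step[OF s C, of d] sb snoc.IH[OF ns] by simp
  qed simp
  have "eventually (\<lambda>j. measure_pmf.prob (chain path_kernel (length p + j))
     {ds. (\<exists>es. ds = p @ es) \<and> \<not> stopped (Suc l) (canonical 1 ds)} = 0) sequentially"
    using eventually_gt_at_top[of "?sc p"]
  proof eventually_elim
    case (elim j)
    have "set_pmf (chain path_kernel (length p + j)) \<inter> {ds. (\<exists>es. ds = p @ es) \<and> \<not> stopped (Suc l) (canonical 1 ds)} = {}"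
    proof (intro equals0I, elim IntE CollectE conjE exE)
      fix ds es assume "ds \<in> set_pmf (chain path_kernel (length p + j))" "ds = p @ es" "\<not> stopped (Suc l) (canonical 1 ds)"
      thus False using length_chain[of ds path_kernel "length p + j"] dec[of es] elim by simp
    qed
    thus ?case by (simp add: measure_pmf_zero_iff)
  qed
  thus ?thesis by (rule tendsto_eventually)
qed

lemma good_path_kernel:
  assumes \<Omega>: "\<Omega> = {0, 1, 2}"
  shows "good_kernel \<Omega> 1 path_kernel"
  unfolding good_kernel_def
proof (intro conjI allI impI)
  fix p :: "nat list" assume p: "p \<noteq> []" "0 < pmf (chain path_kernel (length p)) p"
  have e: "p = path_word (length p)" using p by (auto simp: chain_path indicator_def split: if_splits)
  have lp: "length p > 0" using p by simp
  show "legal 1 1 p" "0 < after 1 1 p" using path_after[OF lp] e by auto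
  show "0 < word_weight \<Omega> p" using path_word_weight[OF _ _ lp, of \<Omega>] e \<Omega> by simp
qed (use path_prefix_tendsto[OF \<Omega>] path_phase_finishes in auto)

lemma good_kernel_exists:
  assumes k: "k \<ge> 1" and \<Omega>: "0 \<in> \<Omega>" "1 \<in> \<Omega>" "\<exists>m\<in>\<Omega>. m > 1"
  shows "\<exists>K. good_kernel \<Omega> k K"
proof (cases "\<exists>b. Suc b \<in> \<Omega> \<and> k * b \<ge> 2")
  case True
  then obtain b where "Suc b \<in> \<Omega>" "k * b \<ge> 2" by blast
  from critical_exists[OF k \<Omega>(2) this] obtain \<tau> where "critical \<Omega> k \<tau> b" ..
  then interpret critical \<Omega> k \<tau> b .
  show ?thesis using good_kernel by blast
next
  case False
  obtain m where m: "m \<in> \<Omega>" "m > 1" using \<Omega>(3) by blast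
  have "k * (m - 1) < 2" using False m by (metis Suc_diff_1 not_le order_less_trans zero_less_one)
  moreover have "m - 1 \<ge> 1" using m by simp
  ultimately have "k = 1"
    using k mult_le_mono[of 2 k 1 "m - 1"] by fastforce
  have "x \<le> 2" if "x \<in> \<Omega>" for x
  proof (rule ccontr)
    assume "\<not> x \<le> 2"
    hence "Suc (x - 1) \<in> \<Omega>" "k * (x - 1) \<ge> 2" using that \<open>k = 1\<close> by auto
    thus False using False by blast
  qed
  hence "\<Omega> \<subseteq> {0, 1, 2}" "m = 2" using m by fastforce+
  hence "\<Omega> = {0, 1, 2}" using \<Omega> m by auto
  thus ?thesis using good_path_kernel \<open>k = 1\<close> by blast
qed

section \<open>The space of infinite explorations\<close>

primrec pre :: "(nat list \<Rightarrow> nat) \<Rightarrow> nat \<Rightarrow> nat list" where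
  "pre \<omega> 0 = []"
| "pre \<omega> (Suc i) = pre \<omega> i @ [\<omega> (pre \<omega> i)]"

text \<open>Independent random numbers are attached to all finite words, and the random sequence reads at each
  time the number that belongs to its current prefix. This realises the chain with kernel \<open>K\<close> on a
  product space.\<close>

definition seq_space :: "(nat list \<Rightarrow> nat pmf) \<Rightarrow> (nat list \<Rightarrow> nat) measure" where
  "seq_space K = PiM UNIV (\<lambda>p. measure_pmf (K p))"

lemma length_pre [simp]: "length (pre \<omega> i) = i"
  by (induction i) auto

lemma pre_prefix: "i \<le> j \<Longrightarrow> \<exists>es. pre \<omega> j = pre \<omega> i @ es"
proof (induction j)
  case (Suc j)
  thus ?case by (cases "i = Suc j") auto
qed simp

lemma take_pre: "i \<le> j \<Longrightarrow> take i (pre \<omega> j) = pre \<omega> i"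
  using pre_prefix[of i j \<omega>] by auto

lemma pre_eq_iff: "pre \<omega> i = ds \<longleftrightarrow> length ds = i \<and> (\<forall>p\<in>(\<lambda>j. take j ds) ` {..<i}. \<omega> p \<in> {ds ! length p})"
proof (induction i arbitrary: ds)
  case (Suc i)
  show ?case
  proof (cases "length ds = Suc i")
    case True
    then obtain es d where ds: "ds = es @ [d]" "length es = i" by (cases ds rule: rev_cases) auto
    have "(\<lambda>j. take j ds) ` {..<Suc i} = insert es ((\<lambda>j. take j es) ` {..<i})"
      using ds by (auto simp: lessThan_Suc)
    moreover have "ds ! length p = es ! length p" if "p \<in> (\<lambda>j. take j es) ` {..<i}" for p
      using that ds by (auto simp: nth_append)
    moreover have "pre \<omega> (Suc i) = ds \<longleftrightarrow> pre \<omega> i = es \<and> \<omega> es = d" using ds by auto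
    moreover have "ds ! length es = d" "length es = i" "length ds = Suc i" using ds by auto
    ultimately show ?thesis using Suc.IH[of es] by (simp del: pre.simps) blast
  qed (metis length_pre)
qed auto

lemma pmf_chain_prod: "pmf (chain K (length ds)) ds = (\<Prod>j<length ds. pmf (K (take j ds)) (ds ! j))"
proof (induction ds rule: rev_induct)
  case (snoc d ds)
  have "(\<Prod>j<length ds. pmf (K (take j (ds @ [d]))) ((ds @ [d]) ! j)) = (\<Prod>j<length ds. pmf (K (take j ds)) (ds ! j))"
    by (intro prod.cong) (auto simp: nth_append)
  thus ?case using snoc pmf_chain_Suc[of K "length ds" ds d] by (simp del: chain.simps)
qed simp

lemma space_seq_space [simp]: "space (seq_space K) = UNIV"
  by (simp add: seq_space_def space_PiM PiE_UNIV_domain)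

lemma prob_space_seq_space: "prob_space (seq_space K)"
  unfolding seq_space_def by (intro prob_space_PiM prob_space_measure_pmf)

lemma emeasure_pre: "emeasure (seq_space K) {\<omega>. pre \<omega> i = ds} = ennreal (pmf (chain K i) ds)"
  and sets_pre: "{\<omega>. pre \<omega> i = ds} \<in> sets (seq_space K)"
proof -
  interpret product_prob_space "\<lambda>p. measure_pmf (K p)" UNIV
    by (rule product_prob_spaceI) (rule prob_space_measure_pmf)
  let ?J = "(\<lambda>j. take j ds) ` {..<i}"
  have "emeasure (seq_space K) {\<omega>. pre \<omega> i = ds} = ennreal (pmf (chain K i) ds) \<and> {\<omega>. pre \<omega> i = ds} \<in> sets (seq_space K)"
  proof (cases "length ds = i")
    case True
    have e: "{\<omega>. pre \<omega> i = ds} = {\<omega> \<in> space (PiM UNIV (\<lambda>p. measure_pmf (K p))). \<forall>p\<in>?J. \<omega> p \<in> {ds ! length p}}"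
      unfolding pre_eq_iff using True by (auto simp: space_PiM)
    have "emeasure (seq_space K) {\<omega>. pre \<omega> i = ds} = (\<Prod>p\<in>?J. emeasure (measure_pmf (K p)) {ds ! length p})"
      unfolding e seq_space_def by (rule emeasure_PiM_Collect) auto
    also have "\<dots> = (\<Prod>j<i. emeasure (measure_pmf (K (take j ds))) {ds ! length (take j ds)})"
    proof (rule prod.reindex_cong[of "\<lambda>j. take j ds"])
      show "inj_on (\<lambda>j. take j ds) {..<i}"
        using True by (auto simp: inj_on_def) (metis length_take min.absorb4)
    qed auto
    also have "\<dots> = (\<Prod>j<i. ennreal (pmf (K (take j ds)) (ds ! j)))"
      using True by (intro prod.cong) (auto simp: emeasure_pmf_single)
    also have "\<dots> = ennreal (pmf (chain K i) ds)"
      using pmf_chain_prod[of K ds] True by (simp add: prod_ennreal)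
    finally have 1: "emeasure (seq_space K) {\<omega>. pre \<omega> i = ds} = ennreal (pmf (chain K i) ds)" .
    have "{\<omega>. pre \<omega> i = ds} = prod_emb UNIV (\<lambda>p. measure_pmf (K p)) ?J (PiE ?J (\<lambda>p. {ds ! length p}))"
      unfolding e prod_emb_def by (auto simp: space_PiM Pi_iff)
    also have "\<dots> \<in> sets (seq_space K)"
      unfolding seq_space_def by (intro sets_PiM_I) auto
    finally show ?thesis using 1 by simp
  next
    case False
    hence "{\<omega>. pre \<omega> i = ds} = {}" by auto
    moreover have "ds \<notin> set_pmf (chain K i)" using length_chain False by blast
    ultimately show ?thesis by (simp add: set_pmf_iff)
  qed
  thus "emeasure (seq_space K) {\<omega>. pre \<omega> i = ds} = ennreal (pmf (chain K i) ds)"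
    "{\<omega>. pre \<omega> i = ds} \<in> sets (seq_space K)" by auto
qed

lemma measurable_pre [measurable]: "(\<lambda>\<omega>. pre \<omega> i) \<in> measurable (seq_space K) (count_space UNIV)"
  by (rule measurable_count_space_eq_countable[THEN iffD2]) (auto simp: vimage_def sets_pre)

lemma distr_pre: "distr (seq_space K) (count_space UNIV) (\<lambda>\<omega>. pre \<omega> i) = measure_pmf (chain K i)"
proof (rule measure_eqI_countable[of _ UNIV])
  fix ds
  show "emeasure (distr (seq_space K) (count_space UNIV) (\<lambda>\<omega>. pre \<omega> i)) {ds} = emeasure (measure_pmf (chain K i)) {ds}"
    by (subst emeasure_distr) (auto simp: vimage_def emeasure_pre emeasure_pmf_single)
qed auto

lemma measure_pre: "measure (seq_space K) {\<omega>. pre \<omega> i \<in> A} = measure_pmf.prob (chain K i) A"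
  unfolding distr_pre[symmetric] by (subst measure_distr) (auto simp: vimage_def)

lemma sets_pre_in [measurable]: "{\<omega>. P (pre \<omega> i)} \<in> sets (seq_space K)"
  using measurable_sets[OF measurable_pre, of "{ds. P ds}" i K] by (simp add: vimage_def)

lemma AE_pre: "(\<And>ds. ds \<in> set_pmf (chain K i) \<Longrightarrow> P ds) \<Longrightarrow> AE \<omega> in seq_space K. P (pre \<omega> i)"
proof -
  assume P: "\<And>ds. ds \<in> set_pmf (chain K i) \<Longrightarrow> P ds"
  have "AE ds in distr (seq_space K) (count_space UNIV) (\<lambda>\<omega>. pre \<omega> i). P ds"
    unfolding distr_pre AE_measure_pmf_iff using P by blast
  thus ?thesis by (subst (asm) AE_distr_iff) auto
qed

definition good :: "nat set \<Rightarrow> nat \<Rightarrow> (nat list \<Rightarrow> nat) \<Rightarrow> bool" where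
  "good \<Omega> k \<omega> \<longleftrightarrow>
     (\<forall>i. i > 0 \<longrightarrow> legal k 1 (pre \<omega> i) \<and> after k 1 (pre \<omega> i) > 0 \<and> word_weight \<Omega> (pre \<omega> i) > 0) \<and>
     (\<forall>l. \<exists>i. i > 0 \<and> stopped l (canonical k (pre \<omega> i)))"

lemma sets_good: "{\<omega>. good \<Omega> k \<omega>} \<in> sets (seq_space K)"
proof -
  have "{\<omega>. good \<Omega> k \<omega>} =
      (\<Inter>i. {\<omega>. (\<lambda>p. i > 0 \<longrightarrow> legal k 1 p \<and> after k 1 p > 0 \<and> word_weight \<Omega> p > 0) (pre \<omega> i)}) \<inter>
      (\<Inter>l. \<Union>i. {\<omega>. (\<lambda>p. i > 0 \<and> stopped l (canonical k p)) (pre \<omega> i)})"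
    unfolding good_def by auto
  also have "\<dots> \<in> sets (seq_space K)"
    by (intro sets.Int sets.countable_INT' sets.countable_UN' sets_pre_in) auto
  finally show ?thesis .
qed

text \<open>Level \<open>Suc l\<close> is finished almost surely after every word that finishes level \<open>l\<close>, and there are
  countably many words.\<close>

lemma AE_good:
  assumes K: "good_kernel \<Omega> k K" and k: "k \<ge> 1"
  shows "AE \<omega> in seq_space K. good \<Omega> k \<omega>"
proof -
  interpret prob_space "seq_space K" by (rule prob_space_seq_space)
  have 1: "AE \<omega> in seq_space K. \<forall>i. i > 0 \<longrightarrow> legal k 1 (pre \<omega> i) \<and> after k 1 (pre \<omega> i) > 0 \<and> word_weight \<Omega> (pre \<omega> i) > 0"
  proof (subst AE_all_countable, intro allI)
    fix i
    show "AE \<omega> in seq_space K. i > 0 \<longrightarrow> legal k 1 (pre \<omega> i) \<and> after k 1 (pre \<omega> i) > 0 \<and> word_weight \<Omega> (pre \<omega> i) > 0"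
    proof (rule AE_pre[where P = "\<lambda>p. i > 0 \<longrightarrow> legal k 1 p \<and> after k 1 p > 0 \<and> word_weight \<Omega> p > 0"], intro impI)
      fix ds assume ds: "ds \<in> set_pmf (chain K i)" "i > 0"
      hence l: "length ds = i" "ds \<noteq> []" using length_chain by fastforce+
      have "pmf (chain K (length ds)) ds > 0" using ds l by (simp add: pmf_positive_iff)
      thus "legal k 1 ds \<and> after k 1 ds > 0 \<and> word_weight \<Omega> ds > 0"
        using K l unfolding good_kernel_def by blast
    qed
  qed
  have null: "AE \<omega> in seq_space K. pre \<omega> (length p) = p \<longrightarrow> (\<exists>i. i > 0 \<and> stopped (Suc l) (canonical k (pre \<omega> i)))"
    if p: "p \<noteq> []" "stopped l (canonical k p)" for p l
  proof -
    let ?N = "{\<omega>. pre \<omega> (length p) = p} \<inter> (\<Inter>i. {\<omega>. (\<lambda>w. \<not> (i > 0 \<and> stopped (Suc l) (canonical k w))) (pre \<omega> i)})"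
    let ?A = "{ds. (\<exists>es. ds = p @ es) \<and> \<not> stopped (Suc l) (canonical k ds)}"
    have N: "?N \<in> events" by (intro sets.Int sets.countable_INT' sets_pre_in sets_pre) auto
    have le: "prob ?N \<le> measure_pmf.prob (chain K (length p + j)) ?A" for j
      unfolding measure_pre[symmetric]
    proof (rule finite_measure_mono)
      show "?N \<subseteq> {\<omega>. pre \<omega> (length p + j) \<in> ?A}"
      proof
        fix \<omega> assume w: "\<omega> \<in> ?N"
        obtain es where "pre \<omega> (length p + j) = pre \<omega> (length p) @ es" using pre_prefix[of "length p" "length p + j" \<omega>] by auto
        hence e: "pre \<omega> (length p + j) = p @ es" using w by simp
        have "length p + j > 0" using p by simp
        moreover have "\<forall>i. \<not> (i > 0 \<and> stopped (Suc l) (canonical k (pre \<omega> i)))" using w by simp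
        ultimately have "\<not> stopped (Suc l) (canonical k (pre \<omega> (length p + j)))" by blast
        thus "\<omega> \<in> {\<omega>. pre \<omega> (length p + j) \<in> ?A}" using e by simp
      qed
      show "{\<omega>. pre \<omega> (length p + j) \<in> ?A} \<in> events" by (rule sets_pre_in)
    qed
    have "(\<lambda>j. measure_pmf.prob (chain K (length p + j)) ?A) \<longlonglongrightarrow> 0"
      using K p unfolding good_kernel_def by blast
    hence "prob ?N \<le> 0" by (rule LIMSEQ_le_const) (use le in blast)
    hence "prob ?N = 0" using measure_nonneg[of "seq_space K" ?N] by linarith
    hence "emeasure (seq_space K) ?N = 0" by (simp add: emeasure_eq_measure)
    hence "AE \<omega> in seq_space K. \<omega> \<notin> ?N" using N by (intro AE_not_in) (auto simp: null_sets_def)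
    thus ?thesis by (rule AE_mp) (auto intro!: AE_I2)
  qed
  have 2: "AE \<omega> in seq_space K. \<exists>i. i > 0 \<and> stopped l (canonical k (pre \<omega> i))" for l
  proof (induction l)
    case 0
    show ?case by (rule AE_I2) (auto simp: stopped_def intro!: exI[of _ 1])
  next
    case (Suc l)
    have "AE \<omega> in seq_space K. \<forall>p. p \<noteq> [] \<longrightarrow> stopped l (canonical k p) \<longrightarrow>
        pre \<omega> (length p) = p \<longrightarrow> (\<exists>i. i > 0 \<and> stopped (Suc l) (canonical k (pre \<omega> i)))"
      by (subst AE_all_countable) (use null in auto)
    thus ?case using Suc
    proof eventually_elim
      case (elim \<omega>)
      then obtain i where i: "i > 0" "stopped l (canonical k (pre \<omega> i))" by blast
      hence "pre \<omega> i \<noteq> []" by (metis length_pre less_irrefl list.size(3))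
      thus ?case using elim(1) i by (metis length_pre)
    qed
  qed
  have "AE \<omega> in seq_space K. \<forall>l. \<exists>i. i > 0 \<and> stopped l (canonical k (pre \<omega> i))"
    by (subst AE_all_countable) (use 2 in blast)
  thus ?thesis using 1 unfolding good_def by eventually_elim blast
qed

section \<open>The limit graph\<close>

definition limit_graph :: "nat \<Rightarrow> (nat list \<Rightarrow> nat) \<Rightarrow> nat rooted_graph" where
  "limit_graph k \<omega> = ((fst ` (\<Union>i. fst (canonical k (pre \<omega> i))), \<Union>i. fst (snd (canonical k (pre \<omega> i)))), {0..<k})"

lemma degs_canonical:
  assumes k: "k \<ge> 1" and ds: "ds \<noteq> []" "word_weight \<Omega> ds > 0"
  shows "degs \<Omega> k 1 (canonical k ds)"
proof -
  obtain d es where de: "ds = d # es" using ds by (cases ds) auto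
  have "weight \<Omega> d * prod_list (map (branch_weight \<Omega>) es) > 0" using ds de by (simp add: word_weight_def)
  hence "weight \<Omega> d * prod_list (map (branch_weight \<Omega>) es) \<noteq> 0" by (metis less_irrefl)
  hence w: "d \<in> \<Omega>" "\<forall>a\<in>set es. Suc a \<in> \<Omega>"
    by (auto simp: weight_def branch_weight_def prod_list_zero_iff split: if_splits)
  have "degs \<Omega> k 1 (canonical k (d # es))" using w(2)
  proof (induction es rule: rev_induct)
    case Nil
    let ?L = "[k..<k + d]"
    have I: "exploration_inv k (set [0..<k]) (root_state [0..<k])" by (rule inv_root) auto
    have dg: "degs \<Omega> k 0 (root_state [0..<k])" by (rule degs_root) auto
    have "degs \<Omega> k 1 (grow (root_state [0..<k]) ?L)" unfolding root_state_eq
      by (rule degs_grow[OF I[unfolded root_state_eq] k _ _ dg[unfolded root_state_eq]])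
        (use w(1) in \<open>auto simp: image_image\<close>)
    thus ?case using canonical_snoc[of k "[]" d] by (simp add: canonical_Nil)
  next
    case (snoc a es)
    let ?ds = "d # es"
    have c: "canonical k (d # es @ [a]) = grow (canonical k ?ds) [k + sum_list ?ds..<k + sum_list ?ds + a]"
      using canonical_snoc[of k ?ds a] by simp
    have IH: "degs \<Omega> k 1 (canonical k ?ds)" using snoc by simp
    show ?case
    proof (cases "act (canonical k ?ds) = []")
      case True thus ?thesis unfolding c using IH grow_stuck by metis
    next
      case False
      obtain D E C Q where s: "canonical k ?ds = (D, E, C # Q)" using state_Cons_cases[OF False] .
      have I: "exploration_inv k {0..<k} (canonical k ?ds)" and V: "fst ` fst (canonical k ?ds) \<subseteq> {0..<k + sum_list ?ds}"
        using inv_canonical[OF k, of ?ds] by auto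
      have fresh: "set [k + sum_list ?ds..<k + sum_list ?ds + a] \<inter> fst ` D = {}" using V s by fastforce
      show ?thesis unfolding c s
        by (rule degs_grow[OF I[unfolded s] k _ fresh IH[unfolded s]]) (use snoc.prems in auto)
    qed
  qed
  thus ?thesis using de by simp
qed

lemma nbrs_canonical:
  assumes k: "k \<ge> 1" and F: "F \<in> cliques k (gr (canonical k ds))" "F \<notin> vs ` set (act (canonical k ds))"
  shows "F \<in> cliques k (gr (canonical k (ds @ es))) \<and> F \<notin> vs ` set (act (canonical k (ds @ es))) \<and>
    nbrs (gr (canonical k (ds @ es))) F = nbrs (gr (canonical k ds)) F"
proof (induction es rule: rev_induct)
  case Nil
  show ?case using F by simp
next
  case (snoc d es)
  let ?ds = "ds @ es" let ?L = "[k + sum_list ?ds..<k + sum_list ?ds + d]"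
  have c: "canonical k (ds @ es @ [d]) = grow (canonical k ?ds) ?L" using canonical_snoc[of k ?ds d] by simp
  show ?case
  proof (cases "act (canonical k ?ds) = []")
    case True thus ?thesis unfolding c using snoc grow_stuck by metis
  next
    case False
    obtain D E C Q where s: "canonical k ?ds = (D, E, C # Q)" using state_Cons_cases[OF False] .
    have I: "exploration_inv k {0..<k} (canonical k ?ds)" and V: "fst ` fst (canonical k ?ds) \<subseteq> {0..<k + sum_list ?ds}"
      using inv_canonical[OF k, of ?ds] by auto
    have kt: "ktree k (gr (canonical k ?ds))" and C: "distinct (map fst C)" "vs C \<in> cliques k (gr (canonical k ?ds))"
      using I s unfolding exploration_inv_def by auto
    have sg: "simple_graph (gr (canonical k ?ds))" using ktree_simple[OF kt] by auto
    have Ld: "set ?L \<inter> fst (gr (canonical k ?ds)) = {}" using V by (fastforce simp: gr_def)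
    have g: "gr (grow (canonical k ?ds) ?L) = attach (gr (canonical k ?ds)) (vs C) (set ?L)" using s gr_grow by metis
    have 1: "F \<in> cliques k (gr (grow (canonical k ?ds) ?L))" unfolding g using snoc by (intro cliques_attach_mono) blast
    have "F \<inter> set ?L = {}" using snoc Ld by (auto simp: cliques_iff)
    hence "F \<notin> vs ` set (kids C ?L)" unfolding vs_kids[OF C(1)] by blast
    hence 2: "F \<notin> vs ` set (act (grow (canonical k ?ds) ?L))" using snoc s by (auto simp: set_foldr_insort)
    have "nbrs (gr (grow (canonical k ?ds) ?L)) F = nbrs (gr (canonical k ?ds)) F" unfolding g
      by (rule nbrs_attach_other[OF sg Ld C(2)]) (use snoc s in auto)
    thus ?thesis unfolding c using 1 2 snoc by simp
  qed
qed

text \<open>In the order of the labels, every vertex outside the root is attached to a front of earlier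
  vertices.\<close>

lemma elimination_order:
  assumes k: "k \<ge> 1" and "legal k 1 ds"
  shows "fst ` fst (canonical k ds) = {0..<k + sum_list ds} \<and>
    (\<forall>v\<in>{k..<k + sum_list ds}. {u. u < v \<and> {u, v} \<in> fst (snd (canonical k ds))} \<in> cliques k (gr (canonical k ds)))"
  using assms(2)
proof (induction ds rule: rev_induct)
  case Nil
  show ?case by (simp add: canonical_Nil root_state_def image_image)
next
  case (snoc d ds)
  let ?h = "k + sum_list ds" let ?L = "[?h..<?h + d]"
  have l: "legal k 1 ds" "after k 1 ds > 0" using snoc.prems by (auto simp: legal_append)
  have IH: "fst ` fst (canonical k ds) = {0..<?h}"
    "\<And>v. v \<in> {k..<?h} \<Longrightarrow> {u. u < v \<and> {u, v} \<in> fst (snd (canonical k ds))} \<in> cliques k (gr (canonical k ds))"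
    using snoc.IH[OF l(1)] by blast+
  have "act (canonical k ds) \<noteq> []" using length_act_canonical[OF k l(1)] l(2) by auto
  then obtain D E C Q where s: "canonical k ds = (D, E, C # Q)" by (rule state_Cons_cases)
  have c: "canonical k (ds @ [d]) = grow (canonical k ds) ?L" by (rule canonical_snoc)
  have I: "exploration_inv k {0..<k} (canonical k ds)" using inv_canonical[OF k] by blast
  have kt: "ktree k (gr (canonical k ds))" and C: "vs C \<in> cliques k (gr (canonical k ds))"
    using I s unfolding exploration_inv_def by auto
  have sg: "simple_graph (gr (canonical k ds))" using ktree_simple[OF kt] by auto
  have V: "fst (gr (canonical k ds)) = {0..<?h}" using IH(1) by (simp add: gr_def)
  have g: "gr (canonical k (ds @ [d])) = attach (gr (canonical k ds)) (vs C) (set ?L)" unfolding c using s gr_grow by metis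
  have E': "fst (snd (canonical k (ds @ [d]))) = snd (gr (canonical k (ds @ [d])))" by (simp add: gr_def)
  have E0: "fst (snd (canonical k ds)) = snd (gr (canonical k ds))" by (simp add: gr_def)
  have CV: "vs C \<subseteq> {0..<?h}" using C V by (auto simp: cliques_iff)
  have ev: "x < ?h \<and> y < ?h" if "{x, y} \<in> snd (gr (canonical k ds))" for x y
    using simple_edgeD[OF sg that] V by auto
  have "{u. u < v \<and> {u, v} \<in> fst (snd (canonical k (ds @ [d])))} \<in> cliques k (gr (canonical k (ds @ [d])))"
    if v: "v \<in> {k..<k + sum_list (ds @ [d])}" for v
  proof (cases "v < ?h")
    case True
    have "{u. u < v \<and> {u, v} \<in> fst (snd (canonical k (ds @ [d])))} = {u. u < v \<and> {u, v} \<in> fst (snd (canonical k ds))}"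
      unfolding E' E0 g edge_attach_iff using True by auto
    thus ?thesis unfolding g using IH(2)[of v] v True by (simp add: cliques_attach_mono)
  next
    case False
    hence "v \<in> set ?L" using v by auto
    hence "{u. u < v \<and> {u, v} \<in> fst (snd (canonical k (ds @ [d])))} = vs C"
      unfolding E' g edge_attach_iff using False ev CV by fastforce
    thus ?thesis unfolding g using C by (simp add: cliques_attach_mono)
  qed
  moreover have "fst ` fst (canonical k (ds @ [d])) = {0..<k + sum_list (ds @ [d])}"
    using IH(1) vertices_grow[OF \<open>act (canonical k ds) \<noteq> []\<close>, of ?L] unfolding c by auto
  ultimately show ?case by blast
qed

text \<open>In a good exploration, the graphs of the prefixes increase to a limit. All properties of the limit
  are read off from a prefix in which the relevant level is finished.\<close>

locale good_exploration =
  fixes \<Omega> :: "nat set" and k :: nat and \<omega> :: "nat list \<Rightarrow> nat"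
  assumes k: "k \<ge> 1" and good: "good \<Omega> k \<omega>"
begin

abbreviation "st i \<equiv> canonical k (pre \<omega> i)"

definition D where "D = (\<Union>i. fst (st i))"
definition E where "E = (\<Union>i. fst (snd (st i)))"

lemma limit_graph_eq: "limit_graph k \<omega> = ((fst ` D, E), {0..<k})"
  by (simp add: limit_graph_def D_def E_def)

lemma st_mono:
  assumes "i \<le> j"
  shows "fst (st i) \<subseteq> fst (st j)" "fst (snd (st i)) \<subseteq> fst (snd (st j))"
    "{e \<in> fst (snd (st j)). e \<subseteq> fst ` fst (st i)} = {e \<in> fst (snd (st i)). e \<subseteq> fst ` fst (st i)}"
    "stopped l (st i) \<Longrightarrow> stopped l (st j)"
    "stopped l (st i) \<Longrightarrow> p \<in> fst (st j) \<Longrightarrow> p \<in> fst (st i) \<or> l < snd p"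
proof -
  obtain es where es: "pre \<omega> j = pre \<omega> i @ es" using pre_prefix[OF assms] by blast
  note x = canonical_extends[OF k, where ds = "pre \<omega> i" and es = es]
  show "fst (st i) \<subseteq> fst (st j)" "fst (snd (st i)) \<subseteq> fst (snd (st j))"
    "{e \<in> fst (snd (st j)). e \<subseteq> fst ` fst (st i)} = {e \<in> fst (snd (st i)). e \<subseteq> fst ` fst (st i)}"
    "stopped l (st i) \<Longrightarrow> stopped l (st j)"
    "stopped l (st i) \<Longrightarrow> p \<in> fst (st j) \<Longrightarrow> p \<in> fst (st i) \<or> l < snd p"
    unfolding es by (fact x(1), fact x(3), fact x(2), erule x(4), erule x(5))
qed

lemma good_legal: "i > 0 \<Longrightarrow> legal k 1 (pre \<omega> i)" "i > 0 \<Longrightarrow> after k 1 (pre \<omega> i) > 0"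
  "i > 0 \<Longrightarrow> word_weight \<Omega> (pre \<omega> i) > 0" "\<exists>i>0. stopped l (st i)"
  using good unfolding good_def by blast+

lemma vertices_st: "i > 0 \<Longrightarrow> fst ` fst (st i) = {0..<k + sum_list (pre \<omega> i)}"
  using elimination_order[OF k good_legal(1)] by blast

lemma sum_pre_large: "i > 0 \<Longrightarrow> i \<le> k * sum_list (pre \<omega> i)"
  using legal_after[OF good_legal(1), of i] good_legal(2)[of i] by simp

lemma vertex_appears: "\<exists>i>0. v < k + sum_list (pre \<omega> i)"
proof -
  have "k * v + k \<le> k * sum_list (pre \<omega> (k * v + k))" using sum_pre_large[of "k * v + k"] k by simp
  hence "k * (v + 1) \<le> k * sum_list (pre \<omega> (k * v + k))" by simp
  hence "v + 1 \<le> sum_list (pre \<omega> (k * v + k))" using k unfolding mult_le_cancel1 by simp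
  thus ?thesis using k by (intro exI[of _ "k * v + k"]) auto
qed

lemma finite_appears:
  assumes "finite A" shows "\<exists>i\<ge>i0. i > 0 \<and> A \<subseteq> fst ` fst (st i)"
proof -
  have "\<exists>m. \<forall>a\<in>A. a \<le> m" using assms finite_nat_set_iff_bounded_le by blast
  then obtain m where m: "\<forall>a\<in>A. a \<le> m" ..
  obtain i where i: "i > 0" "m < k + sum_list (pre \<omega> i)" using vertex_appears by blast
  have "A \<subseteq> fst ` fst (st i)" unfolding vertices_st[OF i(1)] using m i(2) by fastforce
  also have "\<dots> \<subseteq> fst ` fst (st (max i i0))" by (intro image_mono st_mono) simp
  finally show ?thesis using i(1) by (intro exI[of _ "max i i0"]) auto
qed

lemma vertices: "fst ` D = UNIV"
proof -
  have "v \<in> fst ` D" for v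
  proof -
    obtain i where "{v} \<subseteq> fst ` fst (st i)" using finite_appears[of "{v}" 0] by auto
    thus ?thesis unfolding D_def by blast
  qed
  thus ?thesis by blast
qed

lemma edges_restrict: "{e \<in> E. e \<subseteq> fst ` fst (st i)} = {e \<in> fst (snd (st i)). e \<subseteq> fst ` fst (st i)}"
proof (intro equalityI subsetI)
  fix e assume "e \<in> {e \<in> E. e \<subseteq> fst ` fst (st i)}"
  then obtain j where j: "e \<in> fst (snd (st j))" "e \<subseteq> fst ` fst (st i)" by (auto simp: E_def)
  hence "e \<in> fst (snd (st (max i j)))" using st_mono(2)[of j "max i j"] by auto
  thus "e \<in> {e \<in> fst (snd (st i)). e \<subseteq> fst ` fst (st i)}" using st_mono(3)[of i "max i j"] j(2) by auto
qed (auto simp: E_def)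

lemma edge_iff: "x \<in> fst ` fst (st i) \<Longrightarrow> y \<in> fst ` fst (st i) \<Longrightarrow> {x, y} \<in> E \<longleftrightarrow> {x, y} \<in> fst (snd (st i))"
  using edges_restrict[of i] by (auto simp: set_eq_iff)

lemma cliques_restrict:
  assumes "F \<subseteq> fst ` fst (st i)"
  shows "F \<in> cliques m (fst ` D, E) \<longleftrightarrow> F \<in> cliques m (gr (st i))"
  using assms edge_iff[of _ i] vertices unfolding cliques_iff gr_def by (auto simp: subset_iff)

lemma metric_st: "metric {0..<k} (fst (st i)) (fst (snd (st i)))"
  by (rule metric_canonical[OF k])

lemma metric_limit: "metric {0..<k} D E"
proof -
  have two: "\<exists>j. p \<in> fst (st j) \<and> q \<in> fst (st j)" if pq: "p \<in> D" "q \<in> D" for p q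
  proof -
    obtain i j where "p \<in> fst (st i)" "q \<in> fst (st j)" using pq by (auto simp: D_def)
    thus ?thesis using st_mono(1)[of i "max i j"] st_mono(1)[of j "max i j"] by auto
  qed
  have 1: "inj_on fst D"
  proof (rule inj_onI)
    fix p q assume pq: "p \<in> D" "q \<in> D" "fst p = fst q"
    then obtain j where "p \<in> fst (st j)" "q \<in> fst (st j)" using two by blast
    moreover have "inj_on fst (fst (st j))" using metric_st by (simp add: metric_def)
    ultimately show "p = q" using pq by (auto dest: inj_onD)
  qed
  have 2: "simple_graph (fst ` D, E)" unfolding simple_graph_def fst_conv snd_conv
  proof
    fix e assume "e \<in> E"
    then obtain j where "e \<in> fst (snd (st j))" by (auto simp: E_def)
    hence "e \<in> complete_edges (fst ` fst (st j))" using metric_st[of j] by (auto simp: metric_def simple_graph_def)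
    thus "e \<in> complete_edges (fst ` D)" unfolding vertices complete_edges_def by auto
  qed
  have 3: "(v, 0) \<in> D \<longleftrightarrow> v \<in> {0..<k}" for v using metric_st by (auto simp: D_def metric_def)
  have 4: "\<exists>u. (u, m) \<in> D \<and> {u, v} \<in> E" if vm: "(v, Suc m) \<in> D" for v m
  proof -
    obtain j where "(v, Suc m) \<in> fst (st j)" using vm by (auto simp: D_def)
    then obtain u where "(u, m) \<in> fst (st j)" "{u, v} \<in> fst (snd (st j))" using metric_st[of j] unfolding metric_def by blast
    thus ?thesis unfolding D_def E_def by blast
  qed
  have 5: "b \<le> Suc a" if uv: "(u, a) \<in> D" "(v, b) \<in> D" "{u, v} \<in> E" for u a v b
  proof -
    obtain j where j: "(u, a) \<in> fst (st j)" "(v, b) \<in> fst (st j)" using two[OF uv(1,2)] by blast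
    hence "u \<in> fst ` fst (st j)" "v \<in> fst ` fst (st j)" by force+
    hence "{u, v} \<in> fst (snd (st j))" using edge_iff uv(3) by blast
    thus ?thesis using metric_st[of j] j unfolding metric_def by blast
  qed
  show ?thesis unfolding metric_def
    by (intro conjI allI impI 1 2 3 4) (assumption, elim conjE, erule (2) 5)
qed

lemma far_outside: "stopped l (st i) \<Longrightarrow> p \<in> D \<Longrightarrow> p \<in> fst (st i) \<or> l < snd p"
proof -
  assume s: "stopped l (st i)" and "p \<in> D"
  then obtain j where "p \<in> fst (st j)" by (auto simp: D_def)
  hence "p \<in> fst (st (max i j))" using st_mono(1)[of j "max i j"] by auto
  thus ?thesis by (rule st_mono(5)[OF max.cobounded1 s])
qed

lemma U_limit:
  assumes "stopped l (st i)"
  shows "U l (limit_graph k \<omega>) = U l (root_graph k (pre \<omega> i))"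
  unfolding limit_graph_eq root_graph_def gr_def
proof (rule U_agree[OF metric_st metric_limit])
  show "fst (st i) \<subseteq> D" by (auto simp: D_def)
  show "p \<in> fst (st i) \<or> l < snd p" if "p \<in> D" for p by (rule far_outside[OF assms that])
  show "{e \<in> E. e \<subseteq> fst ` fst (st i)} = {e \<in> fst (snd (st i)). e \<subseteq> fst ` fst (st i)}" by (rule edges_restrict)
qed

lemma finite_st: "finite (fst (st i))"
  using inv_canonical[OF k, of "pre \<omega> i"] by (simp add: exploration_inv_def)

text \<open>A vertex at distance \<open>m\<close> has its neighbours at distance at most \<open>m + 1\<close>, and these are explored when
  level \<open>m + 1\<close> is finished.\<close>

lemma locally_finite_limit: "locally_finite (fst ` D, E)"
  unfolding locally_finite_def
proof
  fix v assume "v \<in> fst (fst ` D, E)"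
  then obtain m where vm: "(v, m) \<in> D" by auto
  obtain i where i: "stopped (Suc m) (st i)" using good_legal(4) by blast
  have "{u \<in> fst (fst ` D, E). {u, v} \<in> snd (fst ` D, E)} \<subseteq> fst ` fst (st i)"
  proof
    fix u assume "u \<in> {u \<in> fst (fst ` D, E). {u, v} \<in> snd (fst ` D, E)}"
    then obtain b where u: "(u, b) \<in> D" "{v, u} \<in> E" by (auto simp: insert_commute)
    hence "b \<le> Suc m" using metric_limit vm unfolding metric_def by blast
    hence "(u, b) \<in> fst (st i)" using far_outside[OF i u(1)] by auto
    thus "u \<in> fst ` fst (st i)" by force
  qed
  thus "finite {u \<in> fst (fst ` D, E). {u, v} \<in> snd (fst ` D, E)}" using finite_st finite_subset by blast
qed

lemma infinite_ktree_limit: "infinite_ktree k (fst ` D, E)"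
  unfolding infinite_ktree_def
proof (intro exI[of _ "\<lambda>j. ({0..<k + j}, {e \<in> E. e \<subseteq> {0..<k + j}})"] conjI allI)
  have sg: "simple_graph (fst ` D, E)" using metric_limit by (simp add: metric_def)
  have root: "fst ` fst (st 0) = {0..<k}" "fst (snd (st 0)) = complete_edges {0..<k}"
    by (simp_all add: canonical_Nil root_state_def image_image)
  have "{e \<in> E. e \<subseteq> {0..<k}} = complete_edges {0..<k}"
    using edges_restrict[of 0] unfolding root by (auto simp: complete_edges_def)
  thus "\<exists>K. finite K \<and> card K = k \<and> ({0..<k + 0}, {e \<in> E. e \<subseteq> {0..<k + 0}}) = (K, complete_edges K)"
    by (intro exI[of _ "{0..<k}"]) simp
  show "ktree_step k ({0..<k + j}, {e \<in> E. e \<subseteq> {0..<k + j}}) ({0..<k + Suc j}, {e \<in> E. e \<subseteq> {0..<k + Suc j}})" for j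
    unfolding ktree_step_iff
  proof (intro exI[of _ "k + j"] exI[of _ "{u. u < k + j \<and> {u, k + j} \<in> E}"] conjI)
    let ?v = "k + j"
    let ?B = "{u. u < ?v \<and> {u, ?v} \<in> E}"
    obtain i where i: "i > 0" "?v < k + sum_list (pre \<omega> i)" using vertex_appears by blast
    have V: "u \<in> fst ` fst (st i)" if "u \<le> ?v" for u unfolding vertices_st[OF i(1)] using that i(2) by simp
    have "?B = {u. u < ?v \<and> {u, ?v} \<in> fst (snd (st i))}" using edge_iff[of _ i ?v] V by auto
    also have "\<dots> \<in> cliques k (gr (st i))" using elimination_order[OF k good_legal(1)[OF i(1)]] i(2) by auto
    finally have B: "?B \<in> cliques k (gr (st i))" .
    have "{x, y} \<in> E" if "x \<in> ?B" "y \<in> ?B" "x \<noteq> y" for x y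
      using B that edge_iff[of x i y] V[of x] V[of y] by (auto simp: cliques_iff gr_def)
    thus "?B \<in> cliques k ({0..<?v}, {e \<in> E. e \<subseteq> {0..<?v}})" using B by (auto simp: cliques_iff)
    show "?v \<notin> fst ({0..<?v}, {e \<in> E. e \<subseteq> {0..<?v}})" by simp
    have "e \<in> {e \<in> E. e \<subseteq> {0..<k + Suc j}} \<longleftrightarrow> e \<in> {e \<in> E. e \<subseteq> {0..<?v}} \<union> {{v, u} | v u. v \<in> {?v} \<and> u \<in> ?B}" for e
    proof
      assume e: "e \<in> {e \<in> E. e \<subseteq> {0..<k + Suc j}}"
      hence "e \<in> complete_edges (fst ` D)" using sg by (auto simp: simple_graph_def)
      then obtain x y where xy: "e = {x, y}" "x \<noteq> y" unfolding complete_edges_def by blast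
      consider "x < ?v" "y < ?v" | "x = ?v" "y < ?v" | "y = ?v" "x < ?v" using e xy by fastforce
      thus "e \<in> {e \<in> E. e \<subseteq> {0..<?v}} \<union> {{v, u} | v u. v \<in> {?v} \<and> u \<in> ?B}"
      proof cases
        case 1 thus ?thesis using e xy by auto
      next
        case 2
        hence "e = {?v, y}" "y \<in> ?B" using e xy by (auto simp: insert_commute)
        thus ?thesis by blast
      next
        case 3
        hence "e = {?v, x}" "x \<in> ?B" using e xy by (auto simp: insert_commute)
        thus ?thesis by blast
      qed
    next
      assume "e \<in> {e \<in> E. e \<subseteq> {0..<?v}} \<union> {{v, u} | v u. v \<in> {?v} \<and> u \<in> ?B}"
      then consider "e \<in> E" "e \<subseteq> {0..<?v}" | u where "e = {?v, u}" "u < ?v" "{u, ?v} \<in> E" by blast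
      thus "e \<in> {e \<in> E. e \<subseteq> {0..<k + Suc j}}"
      proof cases
        case 1
        have "{0..<?v} \<subseteq> {0..<k + Suc j}" by auto
        thus ?thesis using 1 by blast
      next
        case 2
        hence "e \<in> E" by (simp add: insert_commute)
        thus ?thesis using 2 by auto
      qed
    qed
    hence "{e \<in> E. e \<subseteq> {0..<k + Suc j}} = {e \<in> E. e \<subseteq> {0..<?v}} \<union> {{v, u} | v u. v \<in> {?v} \<and> u \<in> ?B}" by (rule set_eqI)
    moreover have "{0..<k + Suc j} = {0..<?v} \<union> {?v}" by auto
    ultimately show "({0..<k + Suc j}, {e \<in> E. e \<subseteq> {0..<k + Suc j}}) =
        attach ({0..<?v}, {e \<in> E. e \<subseteq> {0..<?v}}) ?B {?v}"
      by (simp only: attach_def fst_conv snd_conv)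
  qed
  have "(\<Union>j. {e \<in> E. e \<subseteq> {0..<k + j}}) = E"
  proof (intro equalityI subsetI)
    fix e assume e: "e \<in> E"
    hence "e \<in> complete_edges (fst ` D)" using sg by (auto simp: simple_graph_def)
    then obtain x y where "e = {x, y}" unfolding complete_edges_def by blast
    hence "e \<subseteq> {0..<k + (x + y + 1)}" by auto
    thus "e \<in> (\<Union>j. {e \<in> E. e \<subseteq> {0..<k + j}})" using e by blast
  qed auto
  moreover have "(\<Union>j. {0..<k + j}) = UNIV"
  proof -
    have "v \<in> {0..<k + (v + 1)}" for v by simp
    thus ?thesis by blast
  qed
  ultimately show "(fst ` D, E) = (\<Union>j. fst ({0..<k + j}, {e \<in> E. e \<subseteq> {0..<k + j}}), \<Union>j. snd ({0..<k + j}, {e \<in> E. e \<subseteq> {0..<k + j}}))"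
    using vertices by simp
qed

text \<open>Every front is eventually explored, since its level is finished at some time; from then on its set
  of common neighbours does not change.\<close>

lemma hedra_condition_limit: "hedra_condition \<Omega> k (fst ` D, E)"
  unfolding hedra_condition_iff
proof
  fix F assume F: "F \<in> cliques k (fst ` D, E)"
  have fF: "finite F" using F by (auto simp: cliques_iff)
  obtain i0 where i0: "F \<subseteq> fst ` fst (st i0)" using finite_appears[OF fF] by blast
  have "\<exists>l. \<forall>p\<in>fst (st i0). snd p \<le> l" using finite_st finite_nat_set_iff_bounded_le[of "snd ` fst (st i0)"] by auto
  then obtain l where l: "\<forall>p\<in>fst (st i0). snd p \<le> l" ..
  obtain i1 where i1: "stopped (Suc l) (st i1)" using good_legal(4) by blast
  \<comment> \<open>At time \<open>i\<close> every active front lies at distance more than \<open>l\<close>, so \<open>F\<close> has been explored.\<close>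
  define i where "i = Suc (max i0 i1)"
  have i: "i > 0" "i0 \<le> i" "i1 \<le> i" by (auto simp: i_def)
  have s: "stopped (Suc l) (st i)" by (rule st_mono(4)[OF i(3) i1])
  have Fi: "F \<subseteq> fst ` fst (st i)" using i0 st_mono(1)[OF i(2)] by blast
  have FC: "F \<in> cliques k (gr (st i))" using F cliques_restrict[OF Fi] by blast
  have I: "exploration_inv k {0..<k} (st i)" using inv_canonical[OF k] by blast
  have na: "F \<notin> vs ` set (act (st i))"
  proof
    assume "F \<in> vs ` set (act (st i))"
    then obtain C where C: "C \<in> set (act (st i))" "F = vs C" by auto
    have lC: "length C = k" "set C \<subseteq> fst (st i)" using I C by (auto simp: exploration_inv_def)
    hence "C \<noteq> []" using k by auto
    then obtain u where u: "(u, lev C) \<in> set C" using lev_attained by blast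
    hence "u \<in> F" unfolding C(2) vs_def by force
    then obtain b where b: "(u, b) \<in> fst (st i0)" using i0 by force
    have "(u, b) \<in> fst (st i)" "(u, lev C) \<in> fst (st i)" using b st_mono(1)[OF i(2)] u lC(2) by auto
    moreover have "inj_on fst (fst (st i))" using I by (simp add: exploration_inv_def)
    ultimately have "(u, b) = (u, lev C)" by (intro inj_onD[of fst "fst (st i)"]) auto
    moreover have "b \<le> l" using l b by force
    moreover have "Suc l \<le> lev C" using s C by (auto simp: stopped_def)
    ultimately show False by simp
  qed
  have ne: "pre \<omega> i \<noteq> []" using i(1) by (metis length_pre less_irrefl list.size(3))
  have "degs \<Omega> k 1 (st i)" by (rule degs_canonical[OF k ne good_legal(3)[OF i(1)]])
  hence card: "card (nbrs (gr (st i)) F) \<in> \<Omega>" using FC na unfolding degs_def by auto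
  have "nbrs (fst ` D, E) F = nbrs (gr (st i)) F"
  proof (intro equalityI subsetI)
    fix x assume x: "x \<in> nbrs (fst ` D, E) F"
    obtain j where j: "j \<ge> i" "insert x F \<subseteq> fst ` fst (st j)" using finite_appears[of "insert x F" i] fF by auto
    have "{x, u} \<in> fst (snd (st j))" if "u \<in> F" for u
    proof -
      have "x \<in> fst ` fst (st j)" "u \<in> fst ` fst (st j)" using j(2) that by auto
      moreover have "{x, u} \<in> E" using x that by (simp add: nbrs_def)
      ultimately show ?thesis using edge_iff by blast
    qed
    hence "x \<in> nbrs (gr (st j)) F" using x j(2) unfolding nbrs_def gr_def by auto
    moreover obtain es where "pre \<omega> j = pre \<omega> i @ es" using pre_prefix[OF j(1)] by blast
    ultimately show "x \<in> nbrs (gr (st i)) F" using nbrs_canonical[OF k FC na, of es] by simp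
  next
    fix x assume "x \<in> nbrs (gr (st i)) F"
    thus "x \<in> nbrs (fst ` D, E) F" using vertices unfolding nbrs_def gr_def E_def by auto
  qed
  moreover have "finite (nbrs (gr (st i)) F)" using finite_st by (intro finite_nbrs) (simp add: gr_def)
  ultimately show "finite (nbrs (fst ` D, E) F) \<and> card (nbrs (fst ` D, E) F) \<in> \<Omega>" using card by simp
qed

lemma limit_graph_in: "limit_graph k \<omega> \<in> infinite_rooted_Omega_ktrees \<Omega> k"
proof -
  have "simple_graph (fst ` D, E)" using metric_limit by (simp add: metric_def)
  moreover have "{0..<k} \<in> fronts k (fst ` D, E)"
  proof -
    have "{0..<k} \<in> cliques k (gr (st 0))" by (simp add: canonical_Nil gr_root_state cliques_complete)
    thus ?thesis using cliques_restrict[of "{0..<k}" 0 k] by (simp add: canonical_Nil root_state_def image_image)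
  qed
  ultimately show ?thesis
    unfolding limit_graph_eq infinite_rooted_Omega_ktrees_def infinite_Omega_ktree_def front_rooted_def
    using infinite_ktree_limit hedra_condition_limit locally_finite_limit by simp
qed

end

section \<open>Convergence\<close>

text \<open>The words after which level \<open>l\<close> is finished for the first time. None of them is a proper prefix of
  another one, so they label disjoint events.\<close>

definition first_stop :: "nat \<Rightarrow> nat \<Rightarrow> nat list set" where
  "first_stop k l = {ds. stopped l (canonical k ds) \<and> (\<forall>i<length ds. \<not> stopped l (canonical k (take i ds)))}"

definition hits :: "nat list set \<Rightarrow> nat list \<Rightarrow> bool" where
  "hits A w \<longleftrightarrow> (\<exists>p es. w = p @ es \<and> p \<in> A)"

lemma first_stop_unique:
  assumes "p \<in> first_stop k l" "p' \<in> first_stop k l" "w = p @ es" "w = p' @ es'"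
  shows "p = p'"
proof -
  have "p = p'" if p: "p \<in> first_stop k l" "p' \<in> first_stop k l" "w = p @ es" "w = p' @ es'" "length p \<le> length p'" for p p' es es'
  proof (rule ccontr)
    assume ne: "p \<noteq> p'"
    have tk: "take (length p) p' = p" using p(3-5) by (metis append_eq_append_conv_if append_take_drop_id)
    hence "length p < length p'" using ne p(5) by (metis le_neq_implies_less take_all_iff order_refl)
    thus False using p(1,2) tk unfolding first_stop_def by auto
  qed
  from this[OF assms] this[OF assms(2,1,4,3)] show ?thesis
    using linear[of "length p" "length p'"] by auto
qed

lemma first_stop_exists:
  assumes "stopped l (canonical k (take j w))"
  shows "\<exists>i\<le>j. take i w \<in> first_stop k l"
proof -
  define i where "i = (LEAST i. stopped l (canonical k (take i w)))"
  have i: "stopped l (canonical k (take i w))" unfolding i_def by (rule LeastI) (rule assms)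
  have less: "\<not> stopped l (canonical k (take m w))" if "m < i" for m using not_less_Least that unfolding i_def by blast
  have "i \<le> j" unfolding i_def by (rule Least_le) (rule assms)
  moreover have "take i w \<in> first_stop k l" unfolding first_stop_def
  proof (intro CollectI conjI allI impI i)
    fix m assume "m < length (take i w)"
    hence "m < i" by simp
    thus "\<not> stopped l (canonical k (take m (take i w)))" using less[of m] by (simp add: min_def)
  qed
  ultimately show ?thesis by blast
qed

definition hit_prob :: "nat set \<Rightarrow> nat \<Rightarrow> nat \<Rightarrow> nat list set \<Rightarrow> real" where
  "hit_prob \<Omega> k n A = (\<Sum>w | w \<in> words k n \<and> hits A w. word_weight \<Omega> w) / total_weight \<Omega> k n"

lemma total_weight_nonneg: "total_weight \<Omega> k n \<ge> 0"
  unfolding total_weight_def by (intro sum_nonneg word_weight_nonneg)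

lemma hit_prob_mono: "A \<subseteq> B \<Longrightarrow> hit_prob \<Omega> k n A \<le> hit_prob \<Omega> k n B"
  unfolding hit_prob_def
  by (intro divide_right_mono sum_mono2 total_weight_nonneg) (auto simp: finite_words hits_def word_weight_nonneg)

lemma hit_prob_finite:
  assumes "finite A" "A \<subseteq> first_stop k l"
  shows "hit_prob \<Omega> k n A = (\<Sum>p\<in>A. prefix_prob \<Omega> k n p)"
proof -
  have e: "{w. w \<in> words k n \<and> hits A w} = (\<Union>p\<in>A. {w. w \<in> words k n \<and> (\<exists>es. w = p @ es)})"
    by (auto simp: hits_def)
  have "(\<Sum>w | w \<in> words k n \<and> hits A w. word_weight \<Omega> w) = (\<Sum>p\<in>A. \<Sum>w | w \<in> words k n \<and> (\<exists>es. w = p @ es). word_weight \<Omega> w)"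
    unfolding e
  proof (rule sum.UNION_disjoint[OF assms(1)])
    show "\<forall>p\<in>A. finite {w. w \<in> words k n \<and> (\<exists>es. w = p @ es)}" using finite_words by auto
    show "\<forall>p\<in>A. \<forall>p'\<in>A. p \<noteq> p' \<longrightarrow> {w. w \<in> words k n \<and> (\<exists>es. w = p @ es)} \<inter> {w. w \<in> words k n \<and> (\<exists>es. w = p' @ es)} = {}"
    proof (intro ballI impI, rule ccontr)
      fix p p' assume p: "p \<in> A" "p' \<in> A" "p \<noteq> p'"
      assume "{w. w \<in> words k n \<and> (\<exists>es. w = p @ es)} \<inter> {w. w \<in> words k n \<and> (\<exists>es. w = p' @ es)} \<noteq> {}"
      then obtain w es es' where "w = p @ es" "w = p' @ es'" by blast
      thus False using first_stop_unique[of p k l p'] p assms(2) by blast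
    qed
  qed
  thus ?thesis unfolding hit_prob_def prefix_prob_def by (simp add: sum_divide_distrib)
qed

definition limit_hit :: "(nat list \<Rightarrow> nat pmf) \<Rightarrow> nat list set \<Rightarrow> real" where
  "limit_hit K A = measure (seq_space K) {\<omega>. \<exists>i. pre \<omega> i \<in> A}"

lemma sets_hit: "{\<omega>. \<exists>i. pre \<omega> i \<in> A} \<in> sets (seq_space K)"
proof -
  have "{\<omega>. \<exists>i. pre \<omega> i \<in> A} = (\<Union>i. {\<omega>. pre \<omega> i \<in> A})" by auto
  also have "\<dots> \<in> sets (seq_space K)" by (intro sets.countable_UN' sets_pre_in) auto
  finally show ?thesis .
qed

lemma limit_hit_finite:
  assumes "finite A" "A \<subseteq> first_stop k l"
  shows "limit_hit K A = (\<Sum>p\<in>A. pmf (chain K (length p)) p)"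
proof -
  interpret prob_space "seq_space K" by (rule prob_space_seq_space)
  have e: "{\<omega>. \<exists>i. pre \<omega> i \<in> A} = (\<Union>p\<in>A. {\<omega>. pre \<omega> (length p) = p})"
    by auto (metis length_pre)
  have "limit_hit K A = (\<Sum>p\<in>A. prob {\<omega>. pre \<omega> (length p) = p})"
    unfolding limit_hit_def e
  proof (rule finite_measure_finite_Union[OF assms(1)])
    show "(\<lambda>p. {\<omega>. pre \<omega> (length p) = p}) ` A \<subseteq> events" using sets_pre by auto
    show "disjoint_family_on (\<lambda>p. {\<omega>. pre \<omega> (length p) = p}) A"
      unfolding disjoint_family_on_def
    proof (intro ballI impI, rule ccontr)
      fix p p' assume p: "p \<in> A" "p' \<in> A" "p \<noteq> p'"
      assume "{\<omega>. pre \<omega> (length p) = p} \<inter> {\<omega>. pre \<omega> (length p') = p'} \<noteq> {}"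
      then obtain \<omega> where w: "pre \<omega> (length p) = p" "pre \<omega> (length p') = p'" by blast
      obtain es where es: "pre \<omega> (length p + length p') = p @ es" using pre_prefix[of "length p" "length p + length p'" \<omega>] w by auto
      obtain es' where es': "pre \<omega> (length p + length p') = p' @ es'" using pre_prefix[of "length p'" "length p + length p'" \<omega>] w by auto
      show False using first_stop_unique[of p k l p' _ es es'] p assms(2) es es' by blast
    qed
  qed
  also have "\<dots> = (\<Sum>p\<in>A. pmf (chain K (length p)) p)"
    by (intro sum.cong refl) (simp add: measure_def emeasure_pre)
  finally show ?thesis .
qed

text \<open>The probability of each finite set of these words converges, and finite sets approximate \<open>A\<close> from
  inside. Applied to a set and to its complement in \<open>first_stop k l\<close>, this lower bound gives the limit, as
  both pairs of probabilities add up to one.\<close>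

lemma hit_prob_liminf:
  assumes K: "good_kernel \<Omega> k K" and A: "A \<subseteq> first_stop k l" and e: "e > 0"
  shows "eventually (\<lambda>n. hit_prob \<Omega> k n A > limit_hit K A - e) (class_filter \<Omega> k)"
proof -
  interpret prob_space "seq_space K" by (rule prob_space_seq_space)
  define B where "B N = {p \<in> A. to_nat p < N}" for N
  have fB: "finite (B N)" for N
  proof (rule finite_subset[of _ "from_nat ` {..<N}"])
    show "B N \<subseteq> from_nat ` {..<N}"
    proof
      fix x assume "x \<in> B N"
      hence "to_nat x \<in> {..<N}" "x = from_nat (to_nat x)" by (auto simp: B_def)
      thus "x \<in> from_nat ` {..<N}" by blast
    qed
  qed simp
  have BA: "B N \<subseteq> A" for N by (auto simp: B_def)
  have un: "(\<Union>N. {\<omega>. \<exists>i. pre \<omega> i \<in> B N}) = {\<omega>. \<exists>i. pre \<omega> i \<in> A}"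
    by (auto simp: B_def)
  have "(\<lambda>N. prob {\<omega>. \<exists>i. pre \<omega> i \<in> B N}) \<longlonglongrightarrow> prob (\<Union>N. {\<omega>. \<exists>i. pre \<omega> i \<in> B N})"
  proof (rule finite_Lim_measure_incseq)
    show "range (\<lambda>N. {\<omega>. \<exists>i. pre \<omega> i \<in> B N}) \<subseteq> events" using sets_hit by blast
    show "incseq (\<lambda>N. {\<omega>. \<exists>i. pre \<omega> i \<in> B N})" by (auto simp: incseq_def B_def)
  qed
  hence "(\<lambda>N. limit_hit K (B N)) \<longlonglongrightarrow> limit_hit K A" unfolding un limit_hit_def .
  hence "eventually (\<lambda>N. limit_hit K (B N) > limit_hit K A - e) sequentially"
    by (rule order_tendstoD) (use e in simp)
  then obtain N where N: "limit_hit K (B N) > limit_hit K A - e" by (auto simp: eventually_sequentially)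
  have BS: "B N \<subseteq> first_stop k l" using BA A by blast
  have "((\<lambda>n. \<Sum>p\<in>B N. prefix_prob \<Omega> k n p) \<longlongrightarrow> (\<Sum>p\<in>B N. pmf (chain K (length p)) p)) (class_filter \<Omega> k)"
    using K unfolding good_kernel_def by (intro tendsto_sum) blast
  hence "((\<lambda>n. hit_prob \<Omega> k n (B N)) \<longlongrightarrow> limit_hit K (B N)) (class_filter \<Omega> k)"
    unfolding hit_prob_finite[OF fB BS] limit_hit_finite[OF fB BS] .
  hence "eventually (\<lambda>n. hit_prob \<Omega> k n (B N) > limit_hit K A - e) (class_filter \<Omega> k)"
    by (rule order_tendstoD) (rule N)
  thus ?thesis by (rule eventually_mono) (use hit_prob_mono[OF BA] in \<open>fastforce intro: less_le_trans\<close>)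
qed

definition event_stops :: "nat \<Rightarrow> nat \<Rightarrow> nat rooted_graph \<Rightarrow> nat list set" where
  "event_stops k l X = {p \<in> first_stop k l. U l (root_graph k p) \<simeq> X}"

lemma words_stopped:
  assumes k: "k \<ge> 1" and w: "w \<in> words k n"
  shows "hits (event_stops k l X) w \<longleftrightarrow> U l (root_graph k w) \<simeq> X"
    and "hits (first_stop k l - event_stops k l X) w \<longleftrightarrow> \<not> U l (root_graph k w) \<simeq> X"
proof -
  have c: "complete_word k 1 w" using w by (simp add: words_def)
  hence "legal k 1 w" "after k 1 w = 0" using complete_append[of k 1 w "[]"] by auto
  hence "act (canonical k w) = []" using length_act_canonical[OF k] by fastforce
  hence "stopped l (canonical k (take (length w) w))" by (simp add: stopped_def)
  from first_stop_exists[OF this] obtain i where i: "take i w \<in> first_stop k l" by blast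
  let ?p = "take i w"
  have wp: "w = ?p @ drop i w" by simp
  have st: "stopped l (canonical k ?p)" using i by (simp add: first_stop_def)
  have U: "U l (root_graph k w) = U l (root_graph k ?p)" using U_root_graph_append[OF k st, of "drop i w"] by simp
  have uniq: "p = ?p" if "p \<in> first_stop k l" "w = p @ es" for p es
    by (rule first_stop_unique[OF that(1) i that(2) wp])
  show "hits (event_stops k l X) w \<longleftrightarrow> U l (root_graph k w) \<simeq> X"
  proof
    assume "hits (event_stops k l X) w"
    then obtain p es where p: "w = p @ es" "p \<in> event_stops k l X" unfolding hits_def by blast
    hence "p = ?p" using uniq[of p es] by (simp add: event_stops_def)
    thus "U l (root_graph k w) \<simeq> X" using p U by (simp add: event_stops_def)
  next
    assume "U l (root_graph k w) \<simeq> X"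
    hence "?p \<in> event_stops k l X" using i U by (simp add: event_stops_def)
    thus "hits (event_stops k l X) w" unfolding hits_def using wp by blast
  qed
  show "hits (first_stop k l - event_stops k l X) w \<longleftrightarrow> \<not> U l (root_graph k w) \<simeq> X"
  proof
    assume "hits (first_stop k l - event_stops k l X) w"
    then obtain p es where p: "w = p @ es" "p \<in> first_stop k l" "p \<notin> event_stops k l X" unfolding hits_def by blast
    hence "p = ?p" using uniq[of p es] by simp
    thus "\<not> U l (root_graph k w) \<simeq> X" using p U by (simp add: event_stops_def)
  next
    assume "\<not> U l (root_graph k w) \<simeq> X"
    hence "?p \<in> first_stop k l - event_stops k l X" using i U by (simp add: event_stops_def)
    thus "hits (first_stop k l - event_stops k l X) w" unfolding hits_def using wp by blast
  qed
qed

lemma hit_prob_split: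
  assumes k: "k \<ge> 1" and t: "total_weight \<Omega> k n > 0"
  shows "hit_prob \<Omega> k n (event_stops k l X) + hit_prob \<Omega> k n (first_stop k l - event_stops k l X) = 1"
proof -
  have "{w. w \<in> words k n \<and> hits (event_stops k l X) w} \<inter> {w. w \<in> words k n \<and> hits (first_stop k l - event_stops k l X) w} = {}"
    and "{w. w \<in> words k n \<and> hits (event_stops k l X) w} \<union> {w. w \<in> words k n \<and> hits (first_stop k l - event_stops k l X) w} = words k n"
    using words_stopped[OF k, of _ n l X] by blast+
  hence "(\<Sum>w | w \<in> words k n \<and> hits (event_stops k l X) w. word_weight \<Omega> w) +
      (\<Sum>w | w \<in> words k n \<and> hits (first_stop k l - event_stops k l X) w. word_weight \<Omega> w) = total_weight \<Omega> k n"
    unfolding total_weight_def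
    by (subst sum.union_disjoint[symmetric]) (simp_all add: finite_words)
  thus ?thesis using t unfolding hit_prob_def by (simp add: add_divide_distrib[symmetric])
qed

lemma rooted_prob_hit:
  assumes "k \<ge> 1" "labelled_Omega_ktrees \<Omega> k n \<noteq> {}"
  shows "measure_pmf.prob (random_rooted_Omega_ktree \<Omega> k n) {H. U l H \<simeq> X} = hit_prob \<Omega> k n (event_stops k l X)"
proof -
  have "{ds. ds \<in> words k n \<and> U l (root_graph k ds) \<simeq> X} = {w. w \<in> words k n \<and> hits (event_stops k l X) w}"
    using words_stopped(1)[OF assms(1)] by blast
  thus ?thesis unfolding rooted_prob(2)[OF assms] hit_prob_def by simp
qed

lemma good_hits:
  assumes k: "k \<ge> 1" and g: "good \<Omega> k \<omega>"
  shows "(\<exists>i. pre \<omega> i \<in> event_stops k l X) \<longleftrightarrow> U l (limit_graph k \<omega>) \<simeq> X"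
    and "(\<exists>i. pre \<omega> i \<in> first_stop k l - event_stops k l X) \<longleftrightarrow> \<not> U l (limit_graph k \<omega>) \<simeq> X"
proof -
  interpret good_exploration \<Omega> k \<omega> by unfold_locales (use k g in auto)
  have U: "U l (limit_graph k \<omega>) = U l (root_graph k (pre \<omega> i))" if "pre \<omega> i \<in> first_stop k l" for i
    by (rule U_limit) (use that in \<open>simp add: first_stop_def\<close>)
  obtain j where "stopped l (st j)" using good_legal(4) by blast
  hence "stopped l (canonical k (take j (pre \<omega> j)))" by simp
  from first_stop_exists[OF this] obtain i where "i \<le> j" "take i (pre \<omega> j) \<in> first_stop k l" by blast
  hence i: "pre \<omega> i \<in> first_stop k l" by (simp add: take_pre)
  show "(\<exists>i. pre \<omega> i \<in> event_stops k l X) \<longleftrightarrow> U l (limit_graph k \<omega>) \<simeq> X"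
  proof
    assume "\<exists>i. pre \<omega> i \<in> event_stops k l X"
    then obtain i' where "pre \<omega> i' \<in> first_stop k l" "U l (root_graph k (pre \<omega> i')) \<simeq> X" by (auto simp: event_stops_def)
    thus "U l (limit_graph k \<omega>) \<simeq> X" using U[of i'] by simp
  next
    assume "U l (limit_graph k \<omega>) \<simeq> X"
    hence "pre \<omega> i \<in> event_stops k l X" using U[OF i] i by (simp add: event_stops_def)
    thus "\<exists>i. pre \<omega> i \<in> event_stops k l X" by blast
  qed
  show "(\<exists>i. pre \<omega> i \<in> first_stop k l - event_stops k l X) \<longleftrightarrow> \<not> U l (limit_graph k \<omega>) \<simeq> X"
  proof
    assume "\<exists>i. pre \<omega> i \<in> first_stop k l - event_stops k l X"
    then obtain i' where "pre \<omega> i' \<in> first_stop k l" "\<not> U l (root_graph k (pre \<omega> i')) \<simeq> X" by (auto simp: event_stops_def)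
    thus "\<not> U l (limit_graph k \<omega>) \<simeq> X" using U[of i'] by simp
  next
    assume "\<not> U l (limit_graph k \<omega>) \<simeq> X"
    hence "pre \<omega> i \<in> first_stop k l - event_stops k l X" using U[OF i] i by (simp add: event_stops_def)
    thus "\<exists>i. pre \<omega> i \<in> first_stop k l - event_stops k l X" by blast
  qed
qed

theorem theorem2:
  fixes k :: nat and \<Omega> :: "nat set"
  assumes "k \<ge> 1" and "0 \<in> \<Omega>" and "1 \<in> \<Omega>" and "\<exists>m\<in>\<Omega>. m > 1"
  shows "\<exists>M :: nat rooted_graph measure.
    prob_space M \<and>
    space M = infinite_rooted_Omega_ktrees \<Omega> k \<and>
    sets M = sets (local_space \<Omega> k) \<and>
    (\<forall>(l :: nat) (G :: nat rooted_graph). finite (fst (fst G)) \<and> front_rooted k G \<longrightarrow>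
      ((\<lambda>n. measure_pmf.prob (random_rooted_Omega_ktree \<Omega> k n) {H. U l H \<simeq> G})
        \<longlongrightarrow> measure M {H \<in> space M. U l H \<simeq> G})
      (inf sequentially (principal {n. labelled_Omega_ktrees \<Omega> k n \<noteq> {}})))"
proof -
  note k = assms(1)
  obtain K where K: "good_kernel \<Omega> k K" using good_kernel_exists[OF assms] by blast
  interpret S: prob_space "seq_space K" by (rule prob_space_seq_space)
  have AE: "AE \<omega> in seq_space K. good \<Omega> k \<omega>" by (rule AE_good[OF K k])
  have "\<exists>\<omega>0. good \<Omega> k \<omega>0"
  proof (rule ccontr)
    assume "\<not> ?thesis"
    hence "AE \<omega> in seq_space K. False" using AE by simp
    thus False by simp
  qed
  then obtain \<omega>0 where \<omega>0: "good \<Omega> k \<omega>0" ..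
  \<comment> \<open>On the null set of explorations that are not good, a fixed good one keeps the values in the space.\<close>
  define \<Gamma> where "\<Gamma> \<omega> = limit_graph k (if good \<Omega> k \<omega> then \<omega> else \<omega>0)" for \<omega>
  have in_space: "\<Gamma> \<omega> \<in> infinite_rooted_Omega_ktrees \<Omega> k" for \<omega>
  proof -
    interpret good_exploration \<Omega> k "if good \<Omega> k \<omega> then \<omega> else \<omega>0"
      by unfold_locales (use k \<omega>0 in auto)
    show ?thesis unfolding \<Gamma>_def by (rule limit_graph_in)
  qed
  have event: "{\<omega>. U l (\<Gamma> \<omega>) \<simeq> X} = ({\<omega>. good \<Omega> k \<omega>} \<inter> {\<omega>. \<exists>i. pre \<omega> i \<in> event_stops k l X}) \<union>
      (if U l (limit_graph k \<omega>0) \<simeq> X then UNIV - {\<omega>. good \<Omega> k \<omega>} else {})" for l X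
    using good_hits(1)[OF k, of \<Omega> _ l X] by (auto simp: \<Gamma>_def)
  have event_sets: "{\<omega>. U l (\<Gamma> \<omega>) \<simeq> X} \<in> S.events" for l and X :: "nat rooted_graph"
  proof -
    have "UNIV - {\<omega>. good \<Omega> k \<omega>} \<in> S.events" using sets.compl_sets[OF sets_good[of \<Omega> k K]] by simp
    thus ?thesis unfolding event by (intro sets.Un sets.Int sets_good sets_hit) auto
  qed
  have meas: "\<Gamma> \<in> measurable (seq_space K) (local_space \<Omega> k)"
    unfolding local_space_def
  proof (rule measurable_measure_of)
    show "{{G \<in> infinite_rooted_Omega_ktrees \<Omega> k. U l G \<simeq> H} | l H :: nat rooted_graph.
        finite (fst (fst H)) \<and> front_rooted k H} \<subseteq> Pow (infinite_rooted_Omega_ktrees \<Omega> k)" by blast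
    show "\<Gamma> \<in> space (seq_space K) \<rightarrow> infinite_rooted_Omega_ktrees \<Omega> k" using in_space by simp
    fix Y assume "Y \<in> {{G \<in> infinite_rooted_Omega_ktrees \<Omega> k. U l G \<simeq> H} | l H :: nat rooted_graph.
        finite (fst (fst H)) \<and> front_rooted k H}"
    then obtain l and H :: "nat rooted_graph" where "Y = {G \<in> infinite_rooted_Omega_ktrees \<Omega> k. U l G \<simeq> H}" by blast
    hence "\<Gamma> -` Y \<inter> space (seq_space K) = {\<omega>. U l (\<Gamma> \<omega>) \<simeq> H}" using in_space by auto
    thus "\<Gamma> -` Y \<inter> space (seq_space K) \<in> S.events" using event_sets by simp
  qed
  define M where "M = distr (seq_space K) (local_space \<Omega> k) \<Gamma>"
  have sM: "space M = infinite_rooted_Omega_ktrees \<Omega> k" by (simp add: M_def space_local_space)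
  have limit: "((\<lambda>n. measure_pmf.prob (random_rooted_Omega_ktree \<Omega> k n) {H. U l H \<simeq> X})
        \<longlongrightarrow> measure M {H \<in> space M. U l H \<simeq> X}) (class_filter \<Omega> k)"
    if X: "finite (fst (fst X))" "front_rooted k X" for l and X :: "nat rooted_graph"
  proof -
    let ?A = "event_stops k l X" let ?B = "first_stop k l - event_stops k l X"
    have AS: "?A \<subseteq> first_stop k l" and BS: "?B \<subseteq> first_stop k l" by (auto simp: event_stops_def)
    have "measure M {H \<in> space M. U l H \<simeq> X} = S.prob {\<omega>. U l (\<Gamma> \<omega>) \<simeq> X}"
    proof -
      have "{H \<in> space M. U l H \<simeq> X} \<in> sets (local_space \<Omega> k)"
        using neighbourhood_event_in_sets[OF X, of \<Omega> l] unfolding sM space_local_space .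
      hence "measure M {H \<in> space M. U l H \<simeq> X} = S.prob (\<Gamma> -` {H \<in> space M. U l H \<simeq> X} \<inter> space (seq_space K))"
        unfolding M_def by (rule measure_distr[OF meas])
      moreover have "\<Gamma> -` {H \<in> space M. U l H \<simeq> X} \<inter> space (seq_space K) = {\<omega>. U l (\<Gamma> \<omega>) \<simeq> X}"
        using in_space unfolding sM by auto
      ultimately show ?thesis by simp
    qed
    also have "\<dots> = limit_hit K ?A" unfolding limit_hit_def
    proof (rule S.finite_measure_eq_AE[OF _ event_sets sets_hit])
      show "AE \<omega> in seq_space K. \<omega> \<in> {\<omega>. U l (\<Gamma> \<omega>) \<simeq> X} \<longleftrightarrow> \<omega> \<in> {\<omega>. \<exists>i. pre \<omega> i \<in> ?A}"
        using AE by eventually_elim (use good_hits(1)[OF k] in \<open>auto simp: \<Gamma>_def\<close>)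
    qed
    finally have m: "measure M {H \<in> space M. U l H \<simeq> X} = limit_hit K ?A" .
    have total: "limit_hit K ?A + limit_hit K ?B = 1"
    proof -
      have "limit_hit K ?B = S.prob (UNIV - {\<omega>. \<exists>i. pre \<omega> i \<in> ?A})" unfolding limit_hit_def
      proof (rule S.finite_measure_eq_AE[OF _ sets_hit])
        show "AE \<omega> in seq_space K. \<omega> \<in> {\<omega>. \<exists>i. pre \<omega> i \<in> ?B} \<longleftrightarrow> \<omega> \<in> UNIV - {\<omega>. \<exists>i. pre \<omega> i \<in> ?A}"
          using AE
        proof eventually_elim
          case (elim \<omega>)
          show ?case using good_hits[OF k elim, of l X] by blast
        qed
        show "UNIV - {\<omega>. \<exists>i. pre \<omega> i \<in> ?A} \<in> S.events" using sets.compl_sets[OF sets_hit[of ?A K]] by simp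
      qed
      also have "\<dots> = 1 - limit_hit K ?A" unfolding limit_hit_def using S.prob_compl[OF sets_hit[of ?A K]] by simp
      finally show ?thesis by simp
    qed
    have "((\<lambda>n. hit_prob \<Omega> k n ?A) \<longlongrightarrow> limit_hit K ?A) (class_filter \<Omega> k)"
    proof (rule tendstoI)
      fix e :: real assume e: "e > 0"
      have "eventually (\<lambda>n. hit_prob \<Omega> k n ?A + hit_prob \<Omega> k n ?B = 1) (class_filter \<Omega> k)"
        by (rule eventually_class_filter[OF k]) (use hit_prob_split[OF k] in simp)
      thus "eventually (\<lambda>n. dist (hit_prob \<Omega> k n ?A) (limit_hit K ?A) < e) (class_filter \<Omega> k)"
        using hit_prob_liminf[OF K AS e] hit_prob_liminf[OF K BS e]
      proof eventually_elim
        case (elim n)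
        thus ?case using total by (auto simp: dist_real_def abs_less_iff)
      qed
    qed
    moreover have "eventually (\<lambda>n. hit_prob \<Omega> k n ?A = measure_pmf.prob (random_rooted_Omega_ktree \<Omega> k n) {H. U l H \<simeq> X}) (class_filter \<Omega> k)"
      unfolding class_filter_def eventually_inf_principal using rooted_prob_hit[OF k] by simp
    ultimately show ?thesis unfolding m by (rule Lim_transform_eventually)
  qed
  have "prob_space M" unfolding M_def by (rule S.prob_space_distr[OF meas])
  moreover have "sets M = sets (local_space \<Omega> k)" by (simp add: M_def)
  ultimately show ?thesis using sM limit unfolding class_filter_def by blast
qed

end
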